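(* Let $\delta \geq 0$ be a constant and, for $n\in\mathbb{N}$, let $F$ be a random formula following $\mathcal{F}_2(n,\delta n)$. There are constants $c,d>0$ (not depending on $n$) such that: (I) if $\delta < 1/2$, then $\lim_{n\to\infty}\Pr[\text{OBDD-size}(F)\leq n^c]=1$; (II) if $1/2<\delta<1$, then $\lim_{n\to\infty}\Pr[\text{OBDD-size}(F)\geq \exp(n^d)]=1$; (III) if $\delta>1$, then $\lim_{n\to\infty}\Pr[\text{OBDD-size}(F)=1]=1$.
   Context: A CNF formula is a conjunction of clauses; a clause is a disjunction of literals (Boolean variables or their negations), with no repeated literal and no pair of opposite literals. A 2-CNF is a CNF all of whose clauses contain exactly 2 literals. $\mathrm{var}(F)$ is the set of variables appearing in $F$. Let $X_n=\{x_1,\dots,x_n\}$; there are $4\binom{n}{2}$ clauses of size 2 over $X_n$. For $0\le m\le 4\binom n2$, $\mathcal{F}_2(n,m)$ is the uniform distribution over all 2-CNFs made of $m$ distinct clauses of size 2 over $X_n$. The number $\delta n$ is treated as an integer (read $\lfloor \delta n\rfloor$), and $n$ is taken large enough that the distribution is defined. A binary decision diagram (BDD) is a directed acyclic graph with a single source and one or two sinks, labeled $0$ and $1$ (a graph consisting of a single sink is allowed). Each internal node is labeled with a Boolean variable and has exactly two outgoing edges, a $0$-edge and a $1$-edge. A BDD is ordered (an OBDD) when on every source-to-sink path each variable appears at most once and always in the same order (for a fixed total order of the variables). An assignment $\alpha$ determines a path: start at the source and at each node labeled $x$ follow the $\alpha(x)$-edge; the label of the sink reached is the value computed on $\alpha$.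 The OBDD computes a Boolean function $f$ over a variable set $X$ if its value agrees with $f$ on every $\alpha\in\{0,1\}^X$. The size of an OBDD is its number of nodes, including sinks, and $\text{OBDD-size}(f)$ is the minimum size of an OBDD (over all variable orders) computing $f$. For a formula $F$, $\text{OBDD-size}(F)$ is the OBDD-size of the Boolean function over $\mathrm{var}(F)$ mapping an assignment to $1$ iff it satisfies $F$. *)

theory Defs
  imports "HOL-Probability.Probability_Mass_Function"
begin

datatype 'x literal = Pos 'x | Neg 'x

fun lit_var :: "'x literal \<Rightarrow> 'x" where
  "lit_var (Pos x) = x"
| "lit_var (Neg x) = x"

fun lit_holds :: "('x \<Rightarrow> bool) \<Rightarrow> 'x literal \<Rightarrow> bool" where
  "lit_holds \<alpha> (Pos x) \<longleftrightarrow> \<alpha> x"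
| "lit_holds \<alpha> (Neg x) \<longleftrightarrow> \<not> \<alpha> x"

text \<open>Clauses are sets of literals and CNFs are sets of clauses, so repetitions are
  excluded by the encoding.\<close>

type_synonym 'x clause = "'x literal set"
type_synonym 'x cnf = "'x clause set"

definition is_clause :: "'x clause \<Rightarrow> bool" where
  "is_clause C \<longleftrightarrow> finite C \<and> (\<forall>x. \<not> (Pos x \<in> C \<and> Neg x \<in> C))"

definition clause_vars :: "'x clause \<Rightarrow> 'x set" where
  "clause_vars C = lit_var ` C"

definition cnf_vars :: "'x cnf \<Rightarrow> 'x set" where
  "cnf_vars F = (\<Union>C\<in>F. clause_vars C)"

definition satisfies :: "('x \<Rightarrow> bool) \<Rightarrow> 'x cnf \<Rightarrow> bool" where
  "satisfies \<alpha> F \<longleftrightarrow> (\<forall>C\<in>F. \<exists>l\<in>C. lit_holds \<alpha> l)"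

definition two_clauses :: "'x set \<Rightarrow> 'x clause set" where
  "two_clauses X = {C. is_clause C \<and> card C = 2 \<and> clause_vars C \<subseteq> X}"

text \<open>The uniform distribution below is meaningful for \<open>m \<le> 4 * (n choose 2)\<close>; for larger
  \<open>m\<close> there is no such CNF and \<^const>\<open>pmf_of_set\<close> is unspecified.\<close>

definition random_2cnf :: "nat \<Rightarrow> nat \<Rightarrow> nat cnf pmf" where
  "random_2cnf n m = pmf_of_set {F. F \<subseteq> two_clauses {1..n} \<and> card F = m}"

text \<open>In \<open>Decision x u w\<close>, \<open>x\<close> is the variable labelling the node, \<open>u\<close> the target of its
  0-edge and \<open>w\<close> the target of its 1-edge. The two edges may have the same target.\<close>

datatype ('v, 'x) bdd_node = Sink bool | Decision 'x 'v 'v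

record ('v, 'x) bdd_graph =
  nodes :: "'v set"
  source :: 'v
  node_at :: "'v \<Rightarrow> ('v, 'x) bdd_node"

definition edges :: "('v, 'x) bdd_graph \<Rightarrow> ('v \<times> 'v) set" where
  "edges D = {(v, t). v \<in> nodes D \<and>
     (\<exists>x u w. node_at D v = Decision x u w \<and> (t = u \<or> t = w))}"

definition sinks :: "('v, 'x) bdd_graph \<Rightarrow> 'v set" where
  "sinks D = {v \<in> nodes D. \<exists>b. node_at D v = Sink b}"

definition bdd_vars :: "('v, 'x) bdd_graph \<Rightarrow> 'x set" where
  "bdd_vars D = {x. \<exists>v\<in>nodes D. \<exists>u w. node_at D v = Decision x u w}"

text \<open>Distinct sinks carry distinct labels, so there are at most two of them.\<close>

locale bdd =
  fixes D :: "('v, 'x) bdd_graph"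
  assumes finite_nodes: "finite (nodes D)"
    and source_in_nodes: "source D \<in> nodes D"
    and edges_closed: "edges D \<subseteq> nodes D \<times> nodes D"
    and acyclic_edges: "acyclic (edges D)"
    and unique_source: "\<And>v. v \<in> nodes D \<Longrightarrow> (\<forall>u. (u, v) \<notin> edges D) \<longleftrightarrow> v = source D"
    and sinks_nonempty: "sinks D \<noteq> {}"
    and inj_on_sinks: "inj_on (node_at D) (sinks D)"

definition source_sink_path :: "('v, 'x) bdd_graph \<Rightarrow> 'v list \<Rightarrow> bool" where
  "source_sink_path D p \<longleftrightarrow> p \<noteq> [] \<and> hd p = source D \<and> last p \<in> sinks D \<and>
     successively (\<lambda>u v. (u, v) \<in> edges D) p"

definition path_vars :: "('v, 'x) bdd_graph \<Rightarrow> 'v list \<Rightarrow> 'x list" where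
  "path_vars D p =
     List.map_filter (\<lambda>v. case node_at D v of Sink b \<Rightarrow> None | Decision x u w \<Rightarrow> Some x) p"

text \<open>Sortedness with respect to a strict order also makes the variables on a path
  distinct.\<close>

definition obdd :: "('v, 'x) bdd_graph \<Rightarrow> bool" where
  "obdd D \<longleftrightarrow> bdd D \<and>
     (\<exists>r. strict_linear_order r \<and>
       (\<forall>p. source_sink_path D p \<longrightarrow> sorted_wrt (\<lambda>x y. (x, y) \<in> r) (path_vars D p)))"

text \<open>\<open>evaluates D \<alpha> v b\<close>: following the edges chosen by \<open>\<alpha>\<close> from \<open>v\<close> leads to a sink
  labelled \<open>b\<close>.\<close>

inductive evaluates :: "('v, 'x) bdd_graph \<Rightarrow> ('x \<Rightarrow> bool) \<Rightarrow> 'v \<Rightarrow> bool \<Rightarrow> bool"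
  for D :: "('v, 'x) bdd_graph" and \<alpha> :: "'x \<Rightarrow> bool" where
  sink: "node_at D v = Sink b \<Longrightarrow> evaluates D \<alpha> v b"
| decision: "node_at D v = Decision x u w \<Longrightarrow> evaluates D \<alpha> (if \<alpha> x then w else u) b
    \<Longrightarrow> evaluates D \<alpha> v b"

text \<open>Assignments in \<open>{0,1}\<^sup>X\<close> are the functions that are extensional on \<open>X\<close>.\<close>

definition computes :: "('v, 'x) bdd_graph \<Rightarrow> 'x set \<Rightarrow> (('x \<Rightarrow> bool) \<Rightarrow> bool) \<Rightarrow> bool" where
  "computes D X f \<longleftrightarrow> bdd_vars D \<subseteq> X \<and>
     (\<forall>\<alpha> \<in> X \<rightarrow>\<^sub>E UNIV. evaluates D \<alpha> (source D) (f \<alpha>))"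

text \<open>Since diagrams are finite, taking natural numbers as nodes is no restriction.\<close>

definition obdd_size :: "'x set \<Rightarrow> (('x \<Rightarrow> bool) \<Rightarrow> bool) \<Rightarrow> nat" where
  "obdd_size X f =
     (LEAST s. \<exists>D :: (nat, 'x) bdd_graph. obdd D \<and> computes D X f \<and> card (nodes D) = s)"

definition cnf_obdd_size :: "'x cnf \<Rightarrow> nat" where
  "cnf_obdd_size F = obdd_size (cnf_vars F) (\<lambda>\<alpha>. satisfies \<alpha> F)"

end

theory Submission
  imports Defs "HOL-Real_Asymp.Real_Asymp"
begin

text \<open>
  Below density \<open>1/2\<close> the first moment method bounds all paths of the primal graph by \<open>O(log n)\<close>
  vertices; reading the variables in depth-first order, only the variables on the current path matter,
  so there are polynomially many subfunctions.

  Above density \<open>1\<close>, depth-first search in the implication digraph (queried one clause at a time,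
  as in Krivelevich and Sudakov's proof of the phase transition) finds an implication path
  \<open>l\<^sub>1 \<rightarrow> \<dots> \<rightarrow> l\<^sub>2\<^sub>h\<close> of linear length, and a few further random clauses contain some
  \<open>{l\<^sub>a, l\<^sub>b}\<close> from its first half and some \<open>{\<not>l\<^sub>i, \<not>l\<^sub>j}\<close> from its second half, a contradiction.

  Between \<open>1/2\<close> and \<open>1\<close>, the same search in the primal graph gives a linear path. Cut it into pieces of
  large constant length: a bipartition that cuts few path edges is essentially a bipartition of the
  pieces, of which there are so few that by a union bound the further random clauses cross all balanced
  ones linearly often. Hence every variable order has a prefix crossed by linearly many clauses. The
  formula is satisfiable since it has no bicycle, and most literals force only few others, so
  \<open>n\<^sup>1\<^sup>/\<^sup>2\<close> of the crossing clauses can be falsified on either side independently of each other,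
  which yields a fooling set of size \<open>2\<close> to the power \<open>n\<^sup>1\<^sup>/\<^sup>2\<close>.
\<close>

subsection \<open>Literals and uniform random subsets\<close>

text \<open>The thresholds are branching factors: at density \<delta> a literal implies about
  \<delta> others in one step, while a variable shares clauses with about 2 \<delta> others. So
  primal paths die out below 1/2 and implication paths below 1. Exploring clause by clause needs
  independent clauses, which a uniform set of fixed size does not have. The searches therefore run
  in a binomial random set, and only properties inherited by subsets (satisfiability, having a cheap
  balanced cut) are carried back, at the loss of a constant factor. Further clauses are independent
  of the search because a union of two independent binomial sets is again binomial. The other events
  ask for certain clauses to be present and are bounded by first moments in the uniform model
  itself. In the middle range the implication depth \<open>k\<close> meets two demands: so deep that
  few literals force anything farther away, yet so shallow that balls of radius \<open>2 * k\<close>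
  have size \<open>n\<close> to the \<open>o(1)\<close>. Degrees are only bounded by about
  \<open>ln n\<close>, so depth \<open>ln n\<close> would be too much; \<open>sqrt (ln n)\<close>
  serves both.\<close>

fun neg :: "'x literal \<Rightarrow> 'x literal" where
  "neg (Pos x) = Neg x"
| "neg (Neg x) = Pos x"

lemma neg_neg [simp]: "neg (neg l) = l"
  by (cases l) auto

lemma lit_var_neg [simp]: "lit_var (neg l) = lit_var l"
  by (cases l) auto

lemma neg_neq [simp]: "neg l \<noteq> l" "l \<noteq> neg l"
  by (cases l; simp)+

lemma neg_eq_iff [simp]: "neg a = neg b \<longleftrightarrow> a = b"
  by (metis neg_neg)

lemma inj_neg: "inj_on neg A"
  by (auto simp: inj_on_def)

lemma lit_holds_neg [simp]: "lit_holds \<alpha> (neg l) \<longleftrightarrow> \<not> lit_holds \<alpha> l"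
  by (cases l) auto

lemma lit_var_eqD: "lit_var a = lit_var b \<Longrightarrow> a = b \<or> a = neg b"
  by (cases a; cases b) auto

definition lits :: "'x set \<Rightarrow> 'x literal set" where
  "lits X = {l. lit_var l \<in> X}"

lemma lits_eq: "lits X = Pos ` X \<union> Neg ` X"
proof -
  have "l \<in> lits X \<longleftrightarrow> l \<in> Pos ` X \<union> Neg ` X" for l :: "'a literal"
    by (cases l) (auto simp: lits_def)
  then show ?thesis by blast
qed

lemma finite_lits [simp]: "finite X \<Longrightarrow> finite (lits X)"
  by (simp add: lits_eq)

lemma card_lits: "finite X \<Longrightarrow> card (lits X) = 2 * card X"
  unfolding lits_eq by (subst card_Un_disjoint) (auto simp: card_image inj_on_def)

lemma neg_in_lits [simp]: "neg l \<in> lits X \<longleftrightarrow> l \<in> lits X"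
  by (simp add: lits_def)

lemma two_clauses_iff:
  "C \<in> two_clauses X \<longleftrightarrow>
     (\<exists>a b. C = {a, b} \<and> lit_var a \<noteq> lit_var b \<and> lit_var a \<in> X \<and> lit_var b \<in> X)"
proof
  assume C: "C \<in> two_clauses X"
  then obtain a b where ab: "C = {a, b}" "a \<noteq> b"
    by (auto simp: two_clauses_def card_2_iff)
  have "lit_var a \<noteq> lit_var b"
    using C ab by (cases a; cases b) (auto simp: two_clauses_def is_clause_def)
  then show "\<exists>a b. C = {a, b} \<and> lit_var a \<noteq> lit_var b \<and> lit_var a \<in> X \<and> lit_var b \<in> X"
    using C ab by (auto simp: two_clauses_def clause_vars_def)
next
  assume "\<exists>a b. C = {a, b} \<and> lit_var a \<noteq> lit_var b \<and> lit_var a \<in> X \<and> lit_var b \<in> X"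
  then obtain a b where "C = {a, b}" "lit_var a \<noteq> lit_var b" "lit_var a \<in> X" "lit_var b \<in> X"
    by blast
  moreover from this have "a \<noteq> b" by blast
  ultimately show "C \<in> two_clauses X"
    by (cases a; cases b) (auto simp: two_clauses_def is_clause_def clause_vars_def)
qed

lemma doubleton_in_two_clauses [simp]:
  "{a, b} \<in> two_clauses X \<longleftrightarrow> lit_var a \<noteq> lit_var b \<and> lit_var a \<in> X \<and> lit_var b \<in> X"
  unfolding two_clauses_iff by (auto simp: doubleton_eq_iff)

text \<open>This form is made for counting: all pairs of literals minus the complementary pairs, of
  which there is one per variable.\<close>

lemma two_clauses_altdef:
  "two_clauses X = {C. C \<subseteq> lits X \<and> card C = 2} - (\<lambda>x. {Pos x, Neg x}) ` X"
proof (intro equalityI subsetI)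
  fix C assume "C \<in> two_clauses X"
  then show "C \<in> {C. C \<subseteq> lits X \<and> card C = 2} - (\<lambda>x. {Pos x, Neg x}) ` X"
    by (auto simp: two_clauses_def is_clause_def clause_vars_def lits_def)
next
  fix C assume C: "C \<in> {C. C \<subseteq> lits X \<and> card C = 2} - (\<lambda>x. {Pos x, Neg x}) ` X"
  then obtain a b where ab: "C = {a, b}" "a \<noteq> b"
    by (auto simp: card_2_iff)
  have "lit_var a \<noteq> lit_var b"
  proof
    assume e: "lit_var a = lit_var b"
    then have "C = {Pos (lit_var a), Neg (lit_var a)}"
      using ab by (cases a; cases b) auto
    with C ab show False by (auto simp: lits_def)
  qed
  with C ab show "C \<in> two_clauses X"
    by (auto simp: lits_def)
qed

lemma finite_two_clauses [simp]: "finite X \<Longrightarrow> finite (two_clauses X)"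
  unfolding two_clauses_altdef by (auto intro: finite_subset[of _ "Pow (lits X)"])

lemma card_two_clauses:
  assumes "finite X"
  shows "card (two_clauses X) = 2 * card X * (card X - 1)"
proof -
  have "card (two_clauses X) =
      card {C. C \<subseteq> lits X \<and> card C = 2} - card ((\<lambda>x. {Pos x, Neg x}) ` X)"
    unfolding two_clauses_altdef
    by (rule card_Diff_subset) (use assms in \<open>auto simp: lits_def\<close>)
  also have "card {C. C \<subseteq> lits X \<and> card C = 2} = (2 * card X) choose 2"
    using assms by (simp add: n_subsets card_lits)
  also have "card ((\<lambda>x::'a. {Pos x, Neg x}) ` X) = card X"
    by (rule card_image) (auto simp: inj_on_def doubleton_eq_iff)
  also have "((2 * card X) choose 2) - card X = 2 * card X * (card X - 1)"
    by (cases "card X") (simp_all add: choose_two algebra_simps)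
  finally show ?thesis .
qed

text \<open>A counting quotient instead of a \<open>pmf\<close>, so that all moment arguments are
  about cardinalities. For finite \<open>Q\<close> and \<open>m > card Q\<close> it is 0 / 0 =
  0.\<close>

definition unif_prob :: "'c set \<Rightarrow> nat \<Rightarrow> ('c set \<Rightarrow> bool) \<Rightarrow> real" where
  "unif_prob Q m P = real (card {F. F \<subseteq> Q \<and> card F = m \<and> P F}) / real (card Q choose m)"

lemma unif_prob_nonneg: "unif_prob Q m P \<ge> 0"
  by (simp add: unif_prob_def)

lemma finite_ksub: "finite Q \<Longrightarrow> finite {F. F \<subseteq> Q \<and> card F = m \<and> P F}"
  by (auto intro: finite_subset[of _ "Pow Q"])

lemma unif_prob_mono:
  assumes "finite Q" "\<And>F. F \<subseteq> Q \<Longrightarrow> card F = m \<Longrightarrow> P F \<Longrightarrow> R F"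
  shows "unif_prob Q m P \<le> unif_prob Q m R"
  unfolding unif_prob_def using assms
  by (intro divide_right_mono of_nat_mono card_mono finite_ksub) auto

lemma unif_prob_disj:
  assumes "finite Q"
  shows "unif_prob Q m (\<lambda>F. P F \<or> R F) \<le> unif_prob Q m P + unif_prob Q m R"
proof -
  have "{F. F \<subseteq> Q \<and> card F = m \<and> (P F \<or> R F)} =
      {F. F \<subseteq> Q \<and> card F = m \<and> P F} \<union> {F. F \<subseteq> Q \<and> card F = m \<and> R F}"
    by auto
  then have "card {F. F \<subseteq> Q \<and> card F = m \<and> (P F \<or> R F)} \<le>
      card {F. F \<subseteq> Q \<and> card F = m \<and> P F} + card {F. F \<subseteq> Q \<and> card F = m \<and> R F}"
    by (simp add: card_Un_le)
  then show ?thesis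
    unfolding unif_prob_def add_divide_distrib[symmetric]
    by (intro divide_right_mono) (simp_all flip: of_nat_add)
qed

lemma unif_prob_Bex:
  assumes "finite Q" "finite I"
  shows "unif_prob Q m (\<lambda>F. \<exists>i\<in>I. P i F) \<le> (\<Sum>i\<in>I. unif_prob Q m (P i))"
  using assms(2)
proof (induction I rule: finite_induct)
  case empty
  then show ?case by (simp add: unif_prob_def)
next
  case (insert i I)
  have "unif_prob Q m (\<lambda>F. \<exists>j\<in>insert i I. P j F) = unif_prob Q m (\<lambda>F. P i F \<or> (\<exists>j\<in>I. P j F))"
    by simp
  also have "\<dots> \<le> unif_prob Q m (P i) + unif_prob Q m (\<lambda>F. \<exists>j\<in>I. P j F)"
    by (rule unif_prob_disj[OF assms(1)])
  finally show ?case using insert by simp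
qed

lemma unif_prob_Not:
  assumes "finite Q" "m \<le> card Q"
  shows "unif_prob Q m (\<lambda>F. \<not> P F) = 1 - unif_prob Q m P"
proof -
  have "card {F. F \<subseteq> Q \<and> card F = m \<and> P F} + card {F. F \<subseteq> Q \<and> card F = m \<and> \<not> P F} =
      card ({F. F \<subseteq> Q \<and> card F = m \<and> P F} \<union> {F. F \<subseteq> Q \<and> card F = m \<and> \<not> P F})"
    by (subst card_Un_disjoint) (auto intro: finite_ksub assms)
  also have "{F. F \<subseteq> Q \<and> card F = m \<and> P F} \<union> {F. F \<subseteq> Q \<and> card F = m \<and> \<not> P F} =
      {F. F \<subseteq> Q \<and> card F = m}"
    by auto
  finally have "real (card {F. F \<subseteq> Q \<and> card F = m \<and> P F}) +
      real (card {F. F \<subseteq> Q \<and> card F = m \<and> \<not> P F}) = real (card Q choose m)"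
    using assms(1) by (simp add: n_subsets flip: of_nat_add)
  moreover have "(card Q choose m) > 0"
    using assms by simp
  ultimately show ?thesis
    unfolding unif_prob_def by (simp add: field_simps)
qed

lemma prob_random_2cnf:
  assumes "m \<le> card (two_clauses {1..n})"
  shows "measure_pmf.prob (random_2cnf n m) A = unif_prob (two_clauses {1..n}) m (\<lambda>F. F \<in> A)"
proof -
  let ?S = "{F. F \<subseteq> two_clauses {1..n} \<and> card F = m}"
  have card: "card ?S = card (two_clauses {1..n}) choose m"
    by (simp add: n_subsets)
  have fin: "finite ?S"
    by (rule finite_subset[of _ "Pow (two_clauses {1..n})"]) auto
  have "card ?S > 0"
    using assms card by simp
  then have "?S \<noteq> {}" by (metis card_gt_0_iff)
  moreover have "?S \<inter> A = {F. F \<subseteq> two_clauses {1..n} \<and> card F = m \<and> F \<in> A}"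
    by auto
  ultimately show ?thesis
    unfolding random_2cnf_def unif_prob_def
    using fin card by (simp add: measure_pmf_of_set)
qed

text \<open>The ratio of the two binomials is a product of factors (m - i) / (N - i), each at most m
  / N because m \<le> N.\<close>

lemma binomial_ratio_le:
  assumes "j \<le> m" "m \<le> N"
  shows "real ((N - j) choose (m - j)) \<le> (real m / real N) ^ j * real (N choose m)"
  using assms(1)
proof (induction j)
  case 0
  then show ?case by simp
next
  case (Suc j)
  obtain a where a: "m - j = Suc a" using Suc.prems by (metis Suc_diff_Suc Suc_le_lessD)
  obtain c where c: "N - j = Suc c" using Suc.prems assms(2)
    by (metis Suc_diff_Suc Suc_le_lessD order_trans)
  have "real (Suc a) * real (Suc c choose Suc a) = real (Suc c) * real (c choose a)"
    using binomial_absorption[of a c] by (metis of_nat_mult Suc_times_binomial)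
  then have "real (c choose a) = real (Suc a) / real (Suc c) * real (Suc c choose Suc a)"
    by (simp add: field_simps)
  also have "\<dots> \<le> real m / real N * real (Suc c choose Suc a)"
  proof (rule mult_right_mono)
    have "real (Suc a) = real m - real j" "real (Suc c) = real N - real j" "real m \<le> real N"
      using a c Suc.prems assms(2) by linarith+
    moreover have "real j * real m \<le> real j * real N"
      using \<open>real m \<le> real N\<close> by (intro mult_left_mono) auto
    moreover have "real N > 0" using c by linarith
    moreover have "real (Suc c) > 0" by simp
    ultimately show "real (Suc a) / real (Suc c) \<le> real m / real N"
      by (simp add: divide_simps) (simp add: algebra_simps)
  qed simp
  also have "\<dots> \<le> real m / real N * ((real m / real N) ^ j * real (N choose m))"
    using Suc a c by (intro mult_left_mono) auto
  finally show ?case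
    using a c by (metis diff_Suc diff_Suc_Suc mult.assoc nat.case(2) power_Suc)
qed

text \<open>The \<open>m\<close>-sets above \<open>H\<close> correspond to the subsets of
  \<open>Q - H\<close> with \<open>m - card H\<close> elements. This is the substitute for
  independence in the uniform model: prescribed clauses are at most as likely as under independent
  choice with probability \<open>m / card Q\<close>.\<close>

lemma unif_prob_superset_le:
  assumes "finite Q" "m \<le> card Q" "finite H"
  shows "unif_prob Q m (\<lambda>F. H \<subseteq> F) \<le> (real m / real (card Q)) ^ card H"
proof (cases "H \<subseteq> Q \<and> card H \<le> m")
  case False
  then have "{F. F \<subseteq> Q \<and> card F = m \<and> H \<subseteq> F} = {}"
    using assms(1) by (auto dest: card_mono[rotated] intro: finite_subset)
  then show ?thesis unfolding unif_prob_def by (simp only: card.empty) simp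
next
  case True
  have "bij_betw (\<lambda>F. F \<union> H) {F. F \<subseteq> Q - H \<and> card F = m - card H}
      {F. F \<subseteq> Q \<and> card F = m \<and> H \<subseteq> F}"
  proof (rule bij_betwI[where g = "\<lambda>F. F - H"])
    show "(\<lambda>F. F \<union> H) \<in> {F. F \<subseteq> Q - H \<and> card F = m - card H} \<rightarrow>
        {F. F \<subseteq> Q \<and> card F = m \<and> H \<subseteq> F}"
    proof
      fix F assume F: "F \<in> {F. F \<subseteq> Q - H \<and> card F = m - card H}"
      then have "finite F" using assms(1) by (auto intro: finite_subset)
      then have "card (F \<union> H) = card F + card H"
        using F assms(3) by (intro card_Un_disjoint) auto
      with F True show "F \<union> H \<in> {F. F \<subseteq> Q \<and> card F = m \<and> H \<subseteq> F}" by auto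
    qed
    show "(\<lambda>F. F - H) \<in> {F. F \<subseteq> Q \<and> card F = m \<and> H \<subseteq> F} \<rightarrow>
        {F. F \<subseteq> Q - H \<and> card F = m - card H}"
      using assms(3) by (auto simp: card_Diff_subset)
    show "F \<union> H - H = F" if "F \<in> {F. F \<subseteq> Q - H \<and> card F = m - card H}" for F
      using that by blast
    show "F - H \<union> H = F" if "F \<in> {F. F \<subseteq> Q \<and> card F = m \<and> H \<subseteq> F}" for F
      using that by blast
  qed
  then have "card {F. F \<subseteq> Q \<and> card F = m \<and> H \<subseteq> F} =
      card {F. F \<subseteq> Q - H \<and> card F = m - card H}"
    by (rule bij_betw_same_card[THEN sym])
  also have "\<dots> = (card Q - card H) choose (m - card H)"
    using assms True by (simp add: n_subsets card_Diff_subset)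
  finally have "unif_prob Q m (\<lambda>F. H \<subseteq> F) =
      real ((card Q - card H) choose (m - card H)) / real (card Q choose m)"
    by (simp add: unif_prob_def)
  also have "\<dots> \<le> (real m / real (card Q)) ^ card H"
    using binomial_ratio_le[of "card H" m "card Q"] True assms
    by (simp add: divide_le_eq)
  finally show ?thesis .
qed

text \<open>Union bound over certificates: whenever \<open>P\<close> holds, one of the clause sets
  \<open>H i\<close> is present as a whole.\<close>

lemma unif_prob_first_moment:
  assumes "finite Q" "m \<le> card Q" "finite I" "\<And>i. i \<in> I \<Longrightarrow> finite (H i)"
    "\<And>F. F \<subseteq> Q \<Longrightarrow> P F \<Longrightarrow> \<exists>i\<in>I. H i \<subseteq> F"
  shows "unif_prob Q m P \<le> (\<Sum>i\<in>I. (real m / real (card Q)) ^ card (H i))"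
proof -
  have "unif_prob Q m P \<le> unif_prob Q m (\<lambda>F. \<exists>i\<in>I. H i \<subseteq> F)"
    using assms by (intro unif_prob_mono) auto
  also have "\<dots> \<le> (\<Sum>i\<in>I. unif_prob Q m (\<lambda>F. H i \<subseteq> F))"
    using assms by (intro unif_prob_Bex)
  also have "\<dots> \<le> (\<Sum>i\<in>I. (real m / real (card Q)) ^ card (H i))"
    using assms by (intro sum_mono unif_prob_superset_le)
  finally show ?thesis .
qed

lemma sum_of_bool:
  "finite A \<Longrightarrow> (\<Sum>x\<in>A. of_bool (P x) :: real) = real (card {x \<in> A. P x})"
proof -
  assume "finite A"
  moreover have "{x \<in> A. P x} = A \<inter> {x. P x}" by auto
  ultimately show ?thesis by simp
qed

text \<open>Markov's inequality, after counting the pairs of a set \<open>F\<close> and an element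
  \<open>l\<close> with \<open>R l F\<close> in two ways.\<close>

lemma unif_prob_markov:
  assumes "finite Q" "finite B" "b > 0"
  shows "unif_prob Q m (\<lambda>F. b \<le> real (card {l \<in> B. R l F})) \<le> (\<Sum>l\<in>B. unif_prob Q m (R l)) / b"
proof -
  let ?S = "{F. F \<subseteq> Q \<and> card F = m}"
  let ?E = "{F. F \<subseteq> Q \<and> card F = m \<and> b \<le> real (card {l \<in> B. R l F})}"
  have fin: "finite ?S" using finite_ksub[OF assms(1), of m "\<lambda>_. True"] by simp
  have "b * real (card ?E) = (\<Sum>F\<in>?E. b)" by simp
  also have "\<dots> \<le> (\<Sum>F\<in>?E. real (card {l \<in> B. R l F}))"
    by (intro sum_mono) auto
  also have "\<dots> \<le> (\<Sum>F\<in>?S. real (card {l \<in> B. R l F}))"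
    using fin by (intro sum_mono2) auto
  also have "\<dots> = (\<Sum>F\<in>?S. \<Sum>l\<in>B. of_bool (R l F))"
    using assms(2) by (simp only: sum_of_bool)
  also have "\<dots> = (\<Sum>l\<in>B. \<Sum>F\<in>?S. of_bool (R l F))"
    by (rule sum.swap)
  also have "\<dots> = (\<Sum>l\<in>B. real (card {F. F \<subseteq> Q \<and> card F = m \<and> R l F}))"
  proof (rule sum.cong[OF refl])
    fix l
    have "{F. F \<subseteq> Q \<and> card F = m \<and> R l F} = {F \<in> ?S. R l F}" by auto
    then show "(\<Sum>F\<in>?S. of_bool (R l F)) = real (card {F. F \<subseteq> Q \<and> card F = m \<and> R l F})"
      using fin by (simp only: sum_of_bool)
  qed
  finally have "real (card ?E) \<le> (\<Sum>l\<in>B. real (card {F. F \<subseteq> Q \<and> card F = m \<and> R l F})) / b"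
    using assms(3) by (simp add: field_simps)
  then have "unif_prob Q m (\<lambda>F. b \<le> real (card {l \<in> B. R l F})) \<le>
      (\<Sum>l\<in>B. real (card {F. F \<subseteq> Q \<and> card F = m \<and> R l F})) / b / real (card Q choose m)"
    unfolding unif_prob_def by (intro divide_right_mono) auto
  also have "\<dots> = (\<Sum>l\<in>B. unif_prob Q m (R l)) / b"
    unfolding unif_prob_def sum_divide_distrib by (intro sum.cong) auto
  finally show ?thesis .
qed

subsection \<open>Binomial random subsets\<close>

text \<open>The expectation over a binomial random subset as an explicit finite sum, so that
  conditioning on one element is an algebraic identity. Probabilities are expectations of
  \<open>of_bool\<close>.\<close>

definition bern_expect :: "real \<Rightarrow> 'c set \<Rightarrow> ('c set \<Rightarrow> real) \<Rightarrow> real" where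
  "bern_expect p Q h = (\<Sum>F\<in>Pow Q. p ^ card F * (1 - p) ^ card (Q - F) * h F)"

lemma bern_expect_empty [simp]: "bern_expect p {} h = h {}"
  by (simp add: bern_expect_def)

text \<open>Conditioning on whether \<open>x\<close> is drawn. It drives the inductions over
  \<open>Q\<close>, and in the depth-first search it is the query of one clause.\<close>

lemma bern_expect_insert:
  assumes "finite Q" "x \<notin> Q"
  shows "bern_expect p (insert x Q) h = p * bern_expect p Q (\<lambda>F. h (insert x F)) + (1 - p) * bern_expect p Q h"
proof -
  let ?w = "\<lambda>F. p ^ card F * (1 - p) ^ card (insert x Q - F) * h F"
  have "bern_expect p (insert x Q) h = (\<Sum>F\<in>Pow Q. ?w F) + (\<Sum>F\<in>insert x ` Pow Q. ?w F)"
    unfolding bern_expect_def Pow_insert using assms by (intro sum.union_disjoint) auto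
  also have "(\<Sum>F\<in>insert x ` Pow Q. ?w F) = (\<Sum>F\<in>Pow Q. ?w (insert x F))"
    using assms by (subst sum.reindex) (auto simp: inj_on_def insert_ident)
  also have "\<dots> = p * bern_expect p Q (\<lambda>F. h (insert x F))"
    unfolding bern_expect_def sum_distrib_left
  proof (rule sum.cong[OF refl])
    fix F assume F: "F \<in> Pow Q"
    then have "card (insert x F) = Suc (card F)" "insert x Q - insert x F = Q - F"
      using assms by (auto intro!: card_insert_disjoint intro: finite_subset)
    then show "?w (insert x F) = p * (p ^ card F * (1 - p) ^ card (Q - F) * h (insert x F))"
      by simp
  qed
  also have "(\<Sum>F\<in>Pow Q. ?w F) = (1 - p) * bern_expect p Q h"
    unfolding bern_expect_def sum_distrib_left
  proof (rule sum.cong[OF refl])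
    fix F assume F: "F \<in> Pow Q"
    then have "insert x Q - F = insert x (Q - F)" using assms by auto
    then have "card (insert x Q - F) = Suc (card (Q - F))"
      using assms by simp
    then show "?w F = (1 - p) * (p ^ card F * (1 - p) ^ card (Q - F) * h F)"
      by simp
  qed
  finally show ?thesis by simp
qed

lemma bern_expect_add: "bern_expect p Q (\<lambda>F. h F + g F) = bern_expect p Q h + bern_expect p Q g"
  by (simp add: bern_expect_def algebra_simps sum.distrib)

lemma bern_expect_cmult: "bern_expect p Q (\<lambda>F. c * h F) = c * bern_expect p Q h"
  by (simp add: bern_expect_def sum_distrib_left algebra_simps)

lemma bern_expect_sum: "bern_expect p Q (\<lambda>F. \<Sum>i\<in>I. h i F) = (\<Sum>i\<in>I. bern_expect p Q (h i))"
  unfolding bern_expect_def sum_distrib_left by (rule sum.swap)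

lemma bern_expect_cong: "(\<And>F. F \<subseteq> Q \<Longrightarrow> h F = g F) \<Longrightarrow> bern_expect p Q h = bern_expect p Q g"
  unfolding bern_expect_def by (intro sum.cong) auto

lemma bern_expect_mono:
  assumes "0 \<le> p" "p \<le> 1" "\<And>F. F \<subseteq> Q \<Longrightarrow> h F \<le> g F"
  shows "bern_expect p Q h \<le> bern_expect p Q g"
  unfolding bern_expect_def using assms by (intro sum_mono mult_left_mono) auto

lemma bern_expect_const [simp]: "finite Q \<Longrightarrow> bern_expect p Q (\<lambda>_. c) = c"
  by (induction Q rule: finite_induct) (simp_all add: bern_expect_insert algebra_simps)

text \<open>The probability generating function: every element of \<open>Q \<inter> B\<close>
  contributes an independent factor p z + (1 - p). It is used with z = 0 for avoidance and z = 1/2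
  for a Chernoff bound.\<close>

lemma bern_expect_power_card_Int:
  assumes "finite Q"
  shows "bern_expect p Q (\<lambda>F. z ^ card (F \<inter> B)) = (1 - p * (1 - z)) ^ card (Q \<inter> B)"
  using assms
proof (induction Q rule: finite_induct)
  case (insert x Q)
  show ?case
  proof (cases "x \<in> B")
    case True
    have "bern_expect p Q (\<lambda>F. z ^ card (insert x F \<inter> B)) = bern_expect p Q (\<lambda>F. z * z ^ card (F \<inter> B))"
    proof (rule bern_expect_cong)
      fix F assume "F \<subseteq> Q"
      then have "finite F" "x \<notin> F" using insert by (auto intro: finite_subset)
      then show "z ^ card (insert x F \<inter> B) = z * z ^ card (F \<inter> B)"
        using True by simp
    qed
    with insert True show ?thesis
      by (simp add: bern_expect_insert bern_expect_cmult algebra_simps)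
  next
    case False
    with insert show ?thesis by (simp add: bern_expect_insert algebra_simps)
  qed
qed simp

text \<open>Exposure in two rounds: an element is missed by both with probability (1 - p) (1 -
  q).\<close>

lemma bern_expect_Un:
  assumes "finite Q"
  shows "bern_expect p Q (\<lambda>F. bern_expect q Q (\<lambda>G. h (F \<union> G))) = bern_expect (p + q - p * q) Q h"
  using assms
proof (induction Q arbitrary: h rule: finite_induct)
  case (insert x Q)
  have "bern_expect p (insert x Q) (\<lambda>F. bern_expect q (insert x Q) (\<lambda>G. h (F \<union> G))) =
      p * (q * bern_expect p Q (\<lambda>F. bern_expect q Q (\<lambda>G. h (insert x (F \<union> G)))) +
           (1 - q) * bern_expect p Q (\<lambda>F. bern_expect q Q (\<lambda>G. h (insert x (F \<union> G))))) +
      (1 - p) * (q * bern_expect p Q (\<lambda>F. bern_expect q Q (\<lambda>G. h (insert x (F \<union> G)))) +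
           (1 - q) * bern_expect p Q (\<lambda>F. bern_expect q Q (\<lambda>G. h (F \<union> G))))"
    using insert.hyps by (simp add: bern_expect_insert bern_expect_add bern_expect_cmult) (simp add: algebra_simps)
  also have "\<dots> = bern_expect (p + q - p * q) (insert x Q) h"
    using insert.hyps insert.IH[of h] insert.IH[of "\<lambda>F. h (insert x F)"]
    by (simp add: bern_expect_insert) (simp add: algebra_simps)
  finally show ?case .
qed simp

lemma bern_expect_card:
  assumes "finite Q"
  shows "bern_expect p Q (\<lambda>F. real (card F)) = p * real (card Q)"
  using assms
proof (induction Q rule: finite_induct)
  case (insert x Q)
  have "bern_expect p Q (\<lambda>F. real (card (insert x F))) = bern_expect p Q (\<lambda>F. 1 + real (card F))"
  proof (rule bern_expect_cong)
    fix F assume "F \<subseteq> Q"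
    then have "finite F" "x \<notin> F" using insert by (auto intro: finite_subset)
    then show "real (card (insert x F)) = 1 + real (card F)" by simp
  qed
  with insert show ?case
    by (simp add: bern_expect_insert bern_expect_add algebra_simps)
qed simp

text \<open>Markov's inequality in linear form: 1 - card F / (m + 1) stays below the indicator of
  card F \<le> m.\<close>

lemma bern_expect_card_le:
  assumes "finite Q" "0 \<le> p" "p \<le> 1"
  shows "bern_expect p Q (\<lambda>F. of_bool (card F \<le> m)) \<ge> 1 - p * real (card Q) / real (Suc m)"
proof -
  have "bern_expect p Q (\<lambda>F. of_bool (card F \<le> m)) \<ge>
      bern_expect p Q (\<lambda>F. 1 + (- 1 / real (Suc m)) * real (card F))"
  proof (rule bern_expect_mono[OF assms(2,3)])
    fix F :: "'a set"
    show "1 + - 1 / real (Suc m) * real (card F) \<le> of_bool (card F \<le> m)"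
      by (cases "card F \<le> m") (auto simp: field_simps)
  qed
  also have "bern_expect p Q (\<lambda>F. 1 + (- 1 / real (Suc m)) * real (card F)) =
      1 + (- 1 / real (Suc m)) * (p * real (card Q))"
    using assms(1) by (simp only: bern_expect_add bern_expect_cmult bern_expect_card bern_expect_const)
  finally show ?thesis by simp
qed

section \<open>From the binomial to the uniform model\<close>

text \<open>Double counting of pairs (F, c) with c in F: deleting c from a set of size k + 1 with
  property \<open>P\<close> leaves a set of size k with \<open>P\<close>, and each of those arises
  from at most \<open>card Q - k\<close> pairs.\<close>

lemma unif_prob_Suc_le:
  assumes "finite Q" "k < card Q" "\<And>F G. F \<subseteq> G \<Longrightarrow> G \<subseteq> Q \<Longrightarrow> P G \<Longrightarrow> P F"
  shows "unif_prob Q (Suc k) P \<le> unif_prob Q k P"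
proof -
  let ?A = "\<lambda>k. {F. F \<subseteq> Q \<and> card F = k \<and> P F}"
  have fin: "finite (?A j)" for j by (rule finite_ksub[OF assms(1)])
  have finF: "finite F" if "F \<subseteq> Q" for F using that assms(1) finite_subset by blast
  have "Suc k * card (?A (Suc k)) = card (SIGMA F:?A (Suc k). F)"
    using fin finF by (subst card_SigmaI) auto
  also have "\<dots> \<le> card (SIGMA G:?A k. Q - G)"
  proof (rule card_inj_on_le[where f = "\<lambda>(F, c). (F - {c}, c)"])
    show "inj_on (\<lambda>(F, c). (F - {c}, c)) (SIGMA F:?A (Suc k). F)"
      by (auto simp: inj_on_def)
    show "(\<lambda>(F, c). (F - {c}, c)) ` (SIGMA F:?A (Suc k). F) \<subseteq> (SIGMA G:?A k. Q - G)"
    proof (intro image_subsetI)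
      fix x assume "x \<in> (SIGMA F:?A (Suc k). F)"
      then obtain F c where x: "x = (F, c)" and F: "F \<subseteq> Q" "card F = Suc k" "P F" "c \<in> F"
        by auto
      then have "card (F - {c}) = k" "P (F - {c})"
        using finF assms(3)[of "F - {c}" F] by auto
      then show "(case x of (F, c) \<Rightarrow> (F - {c}, c)) \<in> (SIGMA G:?A k. Q - G)"
        using F x by auto
    qed
    show "finite (SIGMA G:?A k. Q - G)"
      using fin assms(1) by auto
  qed
  also have "\<dots> = (card Q - k) * card (?A k)"
    using fin finF assms(1) by (subst card_SigmaI) (auto simp: card_Diff_subset)
  finally have le: "Suc k * card (?A (Suc k)) \<le> (card Q - k) * card (?A k)" .
  have ch: "Suc k * (card Q choose Suc k) = (card Q - k) * (card Q choose k)"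
    using assms(2) binomial_absorption[of k "card Q"] binomial_absorb_comp[of "card Q" k]
    by simp
  have pos: "(card Q choose Suc k) > 0" "(card Q choose k) > 0"
    using assms(2) by auto
  have "card (?A (Suc k)) * (card Q choose k) * Suc k =
      (Suc k * card (?A (Suc k))) * (card Q choose k)"
    by (simp only: mult_ac)
  also have "\<dots> \<le> ((card Q - k) * card (?A k)) * (card Q choose k)"
    by (rule mult_le_mono1[OF le])
  also have "\<dots> = card (?A k) * ((card Q - k) * (card Q choose k))"
    by (simp only: mult_ac)
  also have "\<dots> = card (?A k) * (Suc k * (card Q choose Suc k))"
    by (simp only: ch)
  also have "\<dots> = card (?A k) * (card Q choose Suc k) * Suc k"
    by (simp only: mult_ac)
  finally have "card (?A (Suc k)) * (card Q choose k) \<le> card (?A k) * (card Q choose Suc k)"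
    by (simp only: mult_le_cancel2; simp)
  then have "real (card (?A (Suc k))) * real (card Q choose k) \<le>
      real (card (?A k)) * real (card Q choose Suc k)"
    by (simp only: of_nat_mult[symmetric] of_nat_le_iff)
  then show ?thesis
    unfolding unif_prob_def using pos by (simp add: divide_simps)
qed

lemma unif_prob_antimono:
  assumes "finite Q" "j \<le> k" "k \<le> card Q" "\<And>F G. F \<subseteq> G \<Longrightarrow> G \<subseteq> Q \<Longrightarrow> P G \<Longrightarrow> P F"
  shows "unif_prob Q k P \<le> unif_prob Q j P"
  using assms(2,3)
proof (induction k rule: dec_induct)
  case (step k)
  then have "unif_prob Q (Suc k) P \<le> unif_prob Q k P"
    using assms(1,4) by (intro unif_prob_Suc_le) auto
  with step show ?case by simp
qed simp

text \<open>Given its size, a binomial random subset is uniform.\<close>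

lemma bern_expect_group_card:
  assumes "finite Q"
  shows "bern_expect p Q (\<lambda>F. of_bool (P F)) =
    (\<Sum>k\<le>card Q. real (card Q choose k) * p ^ k * (1 - p) ^ (card Q - k) * unif_prob Q k P)"
proof -
  have fin: "finite (Pow Q)" using assms by simp
  have "bern_expect p Q (\<lambda>F. of_bool (P F)) =
    (\<Sum>k\<le>card Q. \<Sum>F | F \<in> Pow Q \<and> card F = k.
       p ^ card F * (1 - p) ^ card (Q - F) * of_bool (P F))"
    unfolding bern_expect_def
    by (rule sum.group[symmetric]) (use assms in \<open>auto intro: card_mono\<close>)
  also have "\<dots> = (\<Sum>k\<le>card Q.
      real (card Q choose k) * p ^ k * (1 - p) ^ (card Q - k) * unif_prob Q k P)"
  proof (rule sum.cong[OF refl])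
    fix k assume k: "k \<in> {..card Q}"
    have "(\<Sum>F | F \<in> Pow Q \<and> card F = k. p ^ card F * (1 - p) ^ card (Q - F) * of_bool (P F)) =
      (\<Sum>F | F \<in> Pow Q \<and> card F = k. p ^ k * (1 - p) ^ (card Q - k) * of_bool (P F))"
      using assms by (intro sum.cong) (auto simp: card_Diff_subset finite_subset)
    also have "\<dots> = p ^ k * (1 - p) ^ (card Q - k) *
        real (card {F \<in> {F. F \<in> Pow Q \<and> card F = k}. P F})"
      unfolding sum_distrib_left[symmetric]
      by (subst sum_of_bool) (auto intro: finite_subset[OF _ fin])
    also have "{F \<in> {F. F \<in> Pow Q \<and> card F = k}. P F} = {F. F \<subseteq> Q \<and> card F = k \<and> P F}"
      by auto
    also have "real (card \<dots>) = real (card Q choose k) * unif_prob Q k P"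
      using k by (simp add: unif_prob_def)
    finally show "(\<Sum>F | F \<in> Pow Q \<and> card F = k.
        p ^ card F * (1 - p) ^ card (Q - F) * of_bool (P F)) =
      real (card Q choose k) * p ^ k * (1 - p) ^ (card Q - k) * unif_prob Q k P"
      by (simp only: mult_ac)
  qed
  finally show ?thesis .
qed

text \<open>For a property inherited by subsets, the uniform probability at any size k \<le> m is at
  least that at size m, and by Markov's inequality the binomial set often has such a size. The loss
  is a constant factor once \<open>p * card Q\<close> is smaller than m by a constant
  factor.\<close>

lemma unif_prob_le_bern_expect:
  assumes "finite Q" "m \<le> card Q" "0 \<le> p" "p \<le> 1"
    "\<And>F G. F \<subseteq> G \<Longrightarrow> G \<subseteq> Q \<Longrightarrow> P G \<Longrightarrow> P F"
  shows "unif_prob Q m P * (1 - p * real (card Q) / real (Suc m)) \<le> bern_expect p Q (\<lambda>F. of_bool (P F))"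
proof -
  let ?b = "\<lambda>k. real (card Q choose k) * p ^ k * (1 - p) ^ (card Q - k)"
  have b: "?b k \<ge> 0" for k using assms by simp
  have "unif_prob Q m P * (1 - p * real (card Q) / real (Suc m)) \<le>
      unif_prob Q m P * bern_expect p Q (\<lambda>F. of_bool (card F \<le> m))"
    using assms by (intro mult_left_mono bern_expect_card_le unif_prob_nonneg)
  \<comment> \<open>Splitting the size event by cardinality as well allows a comparison term by
    term; its terms with k > m vanish.\<close>
  also have "\<dots> = (\<Sum>k\<le>card Q. unif_prob Q m P * (?b k * unif_prob Q k (\<lambda>F. card F \<le> m)))"
    using assms by (simp add: bern_expect_group_card sum_distrib_left)
  also have "\<dots> \<le> (\<Sum>k\<le>card Q. ?b k * unif_prob Q k P)"
  proof (rule sum_mono)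
    fix k assume k: "k \<in> {..card Q}"
    show "unif_prob Q m P * (?b k * unif_prob Q k (\<lambda>F. card F \<le> m)) \<le> ?b k * unif_prob Q k P"
    proof (cases "k \<le> m")
      case True
      have "unif_prob Q k (\<lambda>F. card F \<le> m) \<le> 1"
        using unif_prob_Not[of Q k "\<lambda>F. card F \<le> m"] unif_prob_nonneg[of Q k "\<lambda>F. \<not> card F \<le> m"] k assms
        by auto
      then have "unif_prob Q m P * (?b k * unif_prob Q k (\<lambda>F. card F \<le> m)) \<le> unif_prob Q m P * (?b k * 1)"
        by (intro mult_left_mono b unif_prob_nonneg)
      also have "\<dots> \<le> unif_prob Q k P * ?b k"
        using unif_prob_antimono[OF assms(1) True assms(2,5)] b[of k]
        by (simp add: mult_right_mono)
      finally show ?thesis by (simp only: mult.commute)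
    next
      case False
      then have "{F. F \<subseteq> Q \<and> card F = k \<and> card F \<le> m} = {}" by auto
      then have "unif_prob Q k (\<lambda>F. card F \<le> m) = 0" unfolding unif_prob_def by (simp only: card.empty; simp)
      then show ?thesis using b[of k] unif_prob_nonneg[of Q k P] by simp
    qed
  qed
  also have "\<dots> = bern_expect p Q (\<lambda>F. of_bool (P F))"
    using assms by (simp add: bern_expect_group_card)
  finally show ?thesis .
qed

subsection \<open>Depth-first search\<close>

text \<open>For \<open>b = False\<close> the links are the implications of the formula; for \<open>b = True\<close> the sign of
  \<open>u\<close> is ignored, so that links are edges of the primal graph.\<close>

definition link_clauses :: "bool \<Rightarrow> 'x literal \<Rightarrow> 'x literal \<Rightarrow> 'x cnf" where
  "link_clauses b u v = (if b then {{neg u, v}, {u, v}} else {{neg u, v}})"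

definition link :: "bool \<Rightarrow> 'x cnf \<Rightarrow> 'x literal \<Rightarrow> 'x literal \<Rightarrow> bool" where
  "link b F u v \<longleftrightarrow> link_clauses b u v \<inter> F \<noteq> {}"

text \<open>Distinct variables, not just distinct literals: the literals of a path are then
  consistent, and its links use pairwise different clauses.\<close>

definition litpath :: "bool \<Rightarrow> 'x cnf \<Rightarrow> 'x literal list \<Rightarrow> bool" where
  "litpath b F us \<longleftrightarrow> distinct (map lit_var us) \<and> successively (link b F) us"

lemma link_mono: "link b F u v \<Longrightarrow> F \<subseteq> G \<Longrightarrow> link b G u v"
  by (auto simp: link_def)

lemma successively_link_mono: "successively (link b F) us \<Longrightarrow> F \<subseteq> G \<Longrightarrow> successively (link b G) us"
  by (erule successively_mono) (auto intro: link_mono)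

lemma litpath_mono: "litpath b F us \<Longrightarrow> F \<subseteq> G \<Longrightarrow> litpath b G us"
  by (auto simp: litpath_def intro: successively_link_mono)

text \<open>This is the price of exhausting \<open>S\<close> while \<open>T\<close> stays unvisited.
  The clauses to be queried are pairwise different because the two sides share no variable; there
  are four per pair of variables if signs are ignored on both sides, and two otherwise.\<close>

lemma card_witnesses_ge:
  assumes "finite S" "finite T" "inj_on lit_var S" "lit_var ` S \<inter> T = {}"
    and sub: "\<And>u t. u \<in> S \<Longrightarrow> lit_var t \<in> T \<Longrightarrow> link_clauses b u t \<subseteq> W" and "finite W"
  shows "(if b then 4 else 2) * card S * card T \<le> card W"
proof -
  define S' where "S' = (if b then S \<union> neg ` S else neg ` S)"
  have "S \<inter> neg ` S = {}"
    using inj_onD[OF assms(3), of "neg _"] by force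
  then have "card S' = (if b then 2 else 1) * card S"
    using assms(1) by (simp add: S'_def card_Un_disjoint card_image inj_neg)
  then have "(if b then 4 else 2) * card S * card T = card (S' \<times> lits T)"
    using assms(2) by (simp add: card_cartesian_product card_lits)
  also have "\<dots> \<le> card W"
  proof (rule card_inj_on_le[where f = "\<lambda>(u, t). {u, t}"])
    have "lit_var u \<notin> T" if "u \<in> S'" for u
      using that assms(4) by (auto simp: S'_def split: if_splits)
    then show "inj_on (\<lambda>(u, t). {u, t}) (S' \<times> lits T)"
      by (auto simp: inj_on_def doubleton_eq_iff lits_def)
    show "(\<lambda>(u, t). {u, t}) ` (S' \<times> lits T) \<subseteq> W"
      using sub by (fastforce simp: S'_def lits_def link_clauses_def split: if_splits)
  qed (rule assms)
  finally show ?thesis .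
qed

text \<open>A run of depth-first search that queries the random clause set one clause at a time.
  \<open>S\<close> holds the exhausted literals, the stack \<open>U\<close> is a path, \<open>T\<close> are the unvisited variables,
  \<open>K\<close> and \<open>W\<close> are the clauses found and queried so far. Each clause found moves a variable from
  \<open>T\<close> to \<open>U\<close>, while no clause joins \<open>S\<close> to \<open>T\<close>; with few queries \<open>S\<close> stays small, so many
  found clauses force a long stack.\<close>

lemma dfs_bound:
  fixes p z :: real and X :: "'x set"
  assumes "0 \<le> p" "p \<le> 1" "0 < z" "z \<le> 1" "2 \<le> L" "finite X"
    and sep: "M < (if b then 4 else 2) * s * (card X - s - L)"
    and "W \<subseteq> two_clauses X" "K \<subseteq> W" "finite T"
    and "distinct (map lit_var U)" "inj_on lit_var S" "finite S"
    and "lit_var ` set U \<inter> lit_var ` S = {}" "lit_var ` set U \<inter> T = {}" "lit_var ` S \<inter> T = {}"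
    and "X = lit_var ` set U \<union> lit_var ` S \<union> T"
    and "successively (\<lambda>v u. link b K u v) U"
    and "\<And>u t. u \<in> S \<Longrightarrow> lit_var t \<in> T \<Longrightarrow> link_clauses b u t \<subseteq> W"
    and "card W \<le> M" "card K \<le> card S + length U" "card S < s" "length U < L"
  shows "bern_expect p (two_clauses X - W)
      (\<lambda>F. of_bool (\<not> (\<exists>us. length us = L \<and> litpath b (K \<union> F) us)))
    \<le> (1 / z) ^ (s + L - card K) * (1 - p * (1 - z)) ^ (M - card W)"
  using assms(8-)
\<comment> \<open>A push trades \<open>2 * card T\<close> against one more stack entry, a pop
  shortens the stack, a query raises \<open>card W\<close>, so the measure always drops. The bound
  is an exponential moment: each found clause is credited with z, and each remaining query costs the
  factor p z + (1 - p).\<close>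
proof (induction "(M - card W) + 2 * card T + length U" arbitrary: W K T U S rule: less_induct)
  case less
  note IH = less.hyps
  define g :: "'x cnf \<Rightarrow> real" where
    "g = (\<lambda>F. of_bool (\<not> (\<exists>us. length us = L \<and> litpath b F us)))"
  define y where "y = 1 - p * (1 - z)"
  define Q where "Q = two_clauses X"
  have finQ: "finite Q" using assms(6) by (simp add: Q_def)
  have W: "W \<subseteq> Q" "finite W" "finite K"
    using less.prems(1,2) finQ by (auto simp: Q_def intro: finite_subset)
  have pz: "p * z \<le> p" "0 \<le> p * z"
    using assms(1,3,4) by (simp_all add: mult_left_le)
  have y: "0 \<le> y" "y \<le> 1" "y = p * z + (1 - p)"
    using pz assms(2) by (simp_all add: y_def algebra_simps)
  have z1: "1 \<le> (1 / z) ^ j" for j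
    using assms(3,4) by (simp add: one_le_power)
  have cX: "card X = length U + card S + card T"
  proof -
    have "card X = card (lit_var ` set U \<union> lit_var ` S) + card T"
      unfolding less.prems(10) using less.prems(3,6-9)
      by (subst card_Un_disjoint) auto
    also have "card (lit_var ` set U \<union> lit_var ` S) = card (lit_var ` set U) + card (lit_var ` S)"
      using less.prems(6,7) by (subst card_Un_disjoint) auto
    also have "card (lit_var ` set U) = length U"
      using distinct_card[OF less.prems(4)] by simp
    also have "card (lit_var ` S) = card S"
      using less.prems(5) by (rule card_image)
    finally show ?thesis .
  qed
  \<comment> \<open>The right-hand side of \<open>sep\<close> is positive. Hence an empty stack
    always leaves an unvisited variable to restart from.\<close>
  have big: "s + L < card X"
    using sep by (cases "card X - s - L") auto
  have goal: "bern_expect p (Q - W) (\<lambda>F. g (K \<union> F)) \<le> (1 / z) ^ (s + L - card K) * y ^ (M - card W)"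
  proof (cases "card W = M")
    \<comment> \<open>All queries are spent: the remaining exponent of the second factor is 0 and
      the bound is at least 1.\<close>
    case True
    have "bern_expect p (Q - W) (\<lambda>F. g (K \<union> F)) \<le> bern_expect p (Q - W) (\<lambda>F. 1)"
      using assms(1,2) by (intro bern_expect_mono) (auto simp: g_def)
    also have "\<dots> = 1" using finQ by simp
    finally show ?thesis using True z1[of "s + L - card K"] by simp
  next
    case False
    then have WM: "card W < M" using less.prems(13) by simp
    show ?thesis
    proof (cases U)
      \<comment> \<open>A restart puts a variable on the stack without finding a clause, which is
        why \<open>card K\<close> is only bounded by \<open>card S + length U\<close>. The sign of
        the new root is arbitrary.\<close>
      case Nil
      then have "card T > 0" using cX big less.prems(15) by simp
      then obtain x where x: "x \<in> T" by (metis card_gt_0_iff ex_in_conv)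
      have "bern_expect p (two_clauses X - W)
          (\<lambda>F. of_bool (\<not> (\<exists>us. length us = L \<and> litpath b (K \<union> F) us)))
        \<le> (1 / z) ^ (s + L - card K) * (1 - p * (1 - z)) ^ (M - card W)"
      proof (rule IH[where T = "T - {x}" and U = "[Pos x]" and S = S])
        show "M - card W + 2 * card (T - {x}) + length [Pos x] <
            M - card W + 2 * card T + length U"
          using x Nil less.prems(3) \<open>card T > 0\<close> by (simp add: card_Diff_singleton)
      qed (use less.prems x Nil assms(5) in auto)
      then show ?thesis by (simp add: g_def Q_def y_def)
    next
      case (Cons u U')
      show ?thesis
      \<comment> \<open>Either some clause from the top \<open>u\<close> to an unvisited variable is
        still unknown and is queried now, or \<open>u\<close> is exhausted and popped.\<close>
      proof (cases "\<exists>t c. lit_var t \<in> T \<and> c \<in> link_clauses b u t \<and> c \<notin> W")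
        case True
        then obtain t c where t: "lit_var t \<in> T" "c \<in> link_clauses b u t" "c \<notin> W" by blast
        have uT: "lit_var u \<notin> T" using less.prems(8) Cons by auto
        have c: "c \<in> Q"
        proof -
          have "lit_var u \<in> X" "lit_var t \<in> X" "lit_var u \<noteq> lit_var t"
            using less.prems(10) Cons t(1) uT by auto
          then show ?thesis using t(2) by (auto simp: Q_def link_clauses_def split: if_splits)
        qed
        have Qc: "Q - W = insert c (Q - insert c W)" using c t(3) by auto
        have cK: "c \<notin> K" using t(3) less.prems(2) by auto
        have cc: "card (insert c K) = Suc (card K)" "card (insert c W) = Suc (card W)"
          using W cK t(3) by auto
        have split: "bern_expect p (Q - W) (\<lambda>F. g (K \<union> F)) =
            p * bern_expect p (Q - insert c W) (\<lambda>F. g (insert c K \<union> F)) +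
            (1 - p) * bern_expect p (Q - insert c W) (\<lambda>F. g (K \<union> F))"
          unfolding Qc using finQ by (subst bern_expect_insert) auto
        have no: "bern_expect p (Q - insert c W) (\<lambda>F. g (K \<union> F)) \<le>
            (1 / z) ^ (s + L - card K) * y ^ (M - card (insert c W))"
          unfolding g_def Q_def y_def
        proof (rule IH[where T = T and U = U and S = S])
          show "M - card (insert c W) + 2 * card T + length U < M - card W + 2 * card T + length U"
            using cc WM by simp
          show "insert c W \<subseteq> two_clauses X" using c W by (simp add: Q_def)
          show "card (insert c W) \<le> M" using cc WM by simp
          show "link_clauses b v t' \<subseteq> insert c W" if "v \<in> S" "lit_var t' \<in> T" for v t'
            using less.prems(12)[OF that] by blast
        qed (use less.prems in blast)+
        have Kk: "card K < s + L" using less.prems(14-16) by simp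
        have yes: "bern_expect p (Q - insert c W) (\<lambda>F. g (insert c K \<union> F)) \<le>
            (1 / z) ^ (s + L - Suc (card K)) * y ^ (M - card (insert c W))"
        proof (cases "Suc (length U) < L")
          case True
          show ?thesis
            unfolding g_def Q_def y_def cc(1)[symmetric]
          proof (rule IH[where T = "T - {lit_var t}" and U = "t # U" and S = S])
            show "M - card (insert c W) + 2 * card (T - {lit_var t}) + length (t # U) <
                M - card W + 2 * card T + length U"
            proof -
              have "card T > 0" using t(1) less.prems(3) by (auto simp: card_gt_0_iff)
              then show ?thesis using cc WM t(1) less.prems(3) by (simp add: card_Diff_singleton)
            qed
            show "insert c W \<subseteq> two_clauses X" using c W by (simp add: Q_def)
            show "card (insert c W) \<le> M" using cc WM by simp
            show "insert c K \<subseteq> insert c W" using less.prems(2) by auto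
            show "successively (\<lambda>v u. link b (insert c K) u v) (t # U)"
            proof -
              have "link b (insert c K) u t" using t(2) by (auto simp: link_def)
              moreover have "successively (\<lambda>v u. link b (insert c K) u v) U"
                by (rule successively_mono[OF less.prems(11)]) (auto intro: link_mono)
              ultimately show ?thesis using Cons by simp
            qed
            show "card (insert c K) \<le> card S + length (t # U)"
              using cc less.prems(14) by simp
            show "X = lit_var ` set (t # U) \<union> lit_var ` S \<union> (T - {lit_var t})"
              using less.prems(10) t(1) by auto
            show "length (t # U) < L" using True by simp
            show "link_clauses b v t' \<subseteq> insert c W"
              if "v \<in> S" "lit_var t' \<in> T - {lit_var t}" for v t'
              using less.prems(12)[of v t'] that by blast
          qed (use less.prems t(1) in auto)
        next
          \<comment> \<open>This push completes a stack of length L. Read from bottom to top it is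
            the desired path, so the event has probability 0.\<close>
          case False
          have "g (insert c K \<union> F) = 0" for F
          proof -
            have "link b (insert c K) u t" using t(2) by (auto simp: link_def)
            moreover have "successively (\<lambda>v u. link b (insert c K) u v) U"
              by (rule successively_mono[OF less.prems(11)]) (auto intro: link_mono)
            ultimately have "successively (\<lambda>v u. link b (insert c K) u v) (t # U)"
              using Cons by simp
            then have "successively (link b (insert c K)) (rev (t # U))"
              by (simp only: successively_rev)
            then have "successively (link b (insert c K \<union> F)) (rev (t # U))"
              by (rule successively_link_mono) auto
            moreover have "distinct (map lit_var (rev (t # U)))"
              using less.prems(4,8) t(1) by (auto simp: rev_map[symmetric])
            ultimately have "litpath b (insert c K \<union> F) (rev (t # U))"
              by (simp only: litpath_def)
            moreover have "length (rev (t # U)) = L"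
              using False less.prems(16) by simp
            ultimately have "\<exists>us. length us = L \<and> litpath b (insert c K \<union> F) us" by blast
            then show ?thesis unfolding g_def by simp
          qed
          then have "bern_expect p (Q - insert c W) (\<lambda>F. g (insert c K \<union> F)) = 0"
            using finQ by simp
          then show ?thesis using z1[of "s + L - Suc (card K)"] y(1) by simp
        qed
        have zz: "(1 / z) ^ (s + L - Suc (card K)) = z * (1 / z) ^ (s + L - card K)"
        proof -
          have "s + L - card K = Suc (s + L - Suc (card K))" using Kk by simp
          then show ?thesis using assms(3) by simp
        qed
        have yy: "y ^ (M - card W) = y * y ^ (M - card (insert c W))"
        proof -
          have "M - card W = Suc (M - card (insert c W))" using cc WM by simp
          then show ?thesis by simp
        qed
        have "bern_expect p (Q - W) (\<lambda>F. g (K \<union> F)) \<le>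
            p * ((1 / z) ^ (s + L - Suc (card K)) * y ^ (M - card (insert c W))) +
            (1 - p) * ((1 / z) ^ (s + L - card K) * y ^ (M - card (insert c W)))"
          unfolding split using assms(1,2) by (intro add_mono mult_left_mono yes no) auto
        also have "\<dots> = (1 / z) ^ (s + L - card K) * y ^ (M - card W)"
        proof -
          have "p * (z * a * c) + (1 - p) * (a * c) = a * (y * c)" for a c
            unfolding y(3) by (simp add: algebra_simps)
          then show ?thesis by (simp only: zz yy)
        qed
        finally show ?thesis .
      next
        case False
        have uS: "lit_var u \<notin> lit_var ` S" using less.prems(7) Cons by auto
        then have "u \<notin> S" by auto
        then have cS: "card (insert u S) = Suc (card S)" using less.prems(6) by simp
        have inj: "inj_on lit_var (insert u S)" using less.prems(5) uS by auto
        have wits: "link_clauses b v t \<subseteq> W" if "v \<in> insert u S" "lit_var t \<in> T" for v t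
          using that False less.prems(12) by blast
        have "(if b then 4 else 2) * card (insert u S) * card T \<le> card W"
          by (rule card_witnesses_ge[OF _ less.prems(3) inj _ wits])
            (use less.prems(6,8,9) Cons W in auto)
        then have le: "(if b then 4 else 2) * Suc (card S) * card T < M"
          using cS WM by simp
        \<comment> \<open>With s exhausted literals at least \<open>card X - s - L\<close> variables
          would be unvisited, and all clauses in between, more than M by \<open>sep\<close>, would
          have been queried.\<close>
        have "Suc (card S) < s"
        proof (rule ccontr)
          assume "\<not> Suc (card S) < s"
          then have e: "Suc (card S) = s" using less.prems(15) by simp
          then have "card X - s - L \<le> card T" using cX less.prems(16) Cons by simp
          then have "(if b then 4 else 2) * s * (card X - s - L) \<le> (if b then 4 else 2) * s * card T"
            by (rule mult_le_mono2)
          with le sep show False unfolding e by (meson le_less_trans less_irrefl less_trans)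
        qed
        have "bern_expect p (two_clauses X - W)
            (\<lambda>F. of_bool (\<not> (\<exists>us. length us = L \<and> litpath b (K \<union> F) us)))
          \<le> (1 / z) ^ (s + L - card K) * (1 - p * (1 - z)) ^ (M - card W)"
        proof (rule IH[where T = T and U = U' and S = "insert u S"])
          show "M - card W + 2 * card T + length U' < M - card W + 2 * card T + length U"
            using Cons by simp
          show "inj_on lit_var (insert u S)" by (rule inj)
          show "successively (\<lambda>v u. link b K u v) U'"
            using less.prems(11) Cons by (cases U') auto
          show "card (insert u S) < s" using cS \<open>Suc (card S) < s\<close> by simp
          show "card K \<le> card (insert u S) + length U'" using cS less.prems(14) Cons by simp
          show "link_clauses b v t \<subseteq> W" if "v \<in> insert u S" "lit_var t \<in> T" for v t
            using that by (rule wits)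
        qed (use less.prems Cons in auto)
        then show ?thesis by (simp add: g_def Q_def y_def)
      qed
    qed
  qed
  then show ?case by (simp add: g_def Q_def y_def)
qed

text \<open>From the empty state this is the Chernoff bound, with free parameter z, for fewer than s
  + L successes in M independent trials.\<close>

lemma long_litpath_bound:
  fixes p z :: real
  assumes "0 \<le> p" "p \<le> 1" "0 < z" "z \<le> 1" "2 \<le> L" "finite X" "0 < s"
    and "M < (if b then 4 else 2) * s * (card X - s - L)"
  shows "bern_expect p (two_clauses X) (\<lambda>F. of_bool (\<not> (\<exists>us. length us = L \<and> litpath b F us)))
    \<le> (1 / z) ^ (s + L) * (1 - p * (1 - z)) ^ M"
  using dfs_bound[where W = "{}" and K = "{}" and S = "{}" and U = "[]" and T = X,
      OF assms(1-6,8)] assms(5,6,7)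
  by simp

subsection \<open>Sprinkling\<close>

lemma litpath_vars:
  assumes "litpath b F us" "F \<subseteq> two_clauses X" "2 \<le> length us"
  shows "lit_var ` set us \<subseteq> X"
proof
  fix x assume "x \<in> lit_var ` set us"
  then obtain i where i: "i < length us" "x = lit_var (us ! i)"
    by (auto simp: in_set_conv_nth)
  have succ: "lit_var (us ! j) \<in> X \<and> lit_var (us ! Suc j) \<in> X" if "Suc j < length us" for j
  proof -
    have "link b F (us ! j) (us ! Suc j)"
      using assms(1) that by (simp add: litpath_def successively_conv_nth)
    then show ?thesis
      using assms(2) by (fastforce simp: link_def link_clauses_def split: if_splits)
  qed
  show "x \<in> X"
  proof (cases "Suc i < length us")
    case True
    then show ?thesis using succ i by simp
  next
    case False
    then obtain j where "i = Suc j" using assms(3) i by (cases i) auto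
    then show ?thesis using succ[of j] i by simp
  qed
qed

lemma bern_expect_disjoint:
  assumes "finite Q" "B \<subseteq> Q"
  shows "bern_expect p Q (\<lambda>F. of_bool (F \<inter> B = {})) = (1 - p) ^ card B"
proof -
  have "bern_expect p Q (\<lambda>F. of_bool (F \<inter> B = {})) = bern_expect p Q (\<lambda>F. 0 ^ card (F \<inter> B))"
  proof (rule bern_expect_cong)
    fix F assume "F \<subseteq> Q"
    then have "finite (F \<inter> B)" using assms finite_subset by blast
    then show "of_bool (F \<inter> B = {}) = (0::real) ^ card (F \<inter> B)" by auto
  qed
  then show ?thesis
    using assms by (simp add: bern_expect_power_card_Int Int_absorb1)
qed

text \<open>Chernoff bound with parameter 1/2: the indicator is at most 2 to the power s - card (F
  \<inter> B).\<close>

lemma bern_expect_few: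
  assumes "finite Q" "B \<subseteq> Q" "0 \<le> p" "p \<le> 1"
  shows "bern_expect p Q (\<lambda>F. of_bool (card (F \<inter> B) < s)) \<le> 2 ^ s * (1 - p / 2) ^ card B"
proof -
  have "bern_expect p Q (\<lambda>F. of_bool (card (F \<inter> B) < s)) \<le>
      bern_expect p Q (\<lambda>F. 2 ^ s * (1 / 2) ^ card (F \<inter> B))"
  proof (rule bern_expect_mono[OF assms(3,4)])
    fix F
    show "of_bool (card (F \<inter> B) < s) \<le> (2::real) ^ s * (1 / 2) ^ card (F \<inter> B)"
    proof (cases "card (F \<inter> B) < s")
      case True
      have "(2::real) ^ card (F \<inter> B) \<le> 2 ^ s"
        by (rule power_increasing) (use True in auto)
      then show ?thesis by (simp add: power_divide)
    qed simp
  qed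
  also have "\<dots> = 2 ^ s * (1 - p / 2) ^ card B"
    using assms by (simp add: bern_expect_cmult bern_expect_power_card_Int Int_absorb1)
  finally show ?thesis .
qed

section \<open>Unsatisfiability from a long implication path\<close>

lemma litpath_implies:
  assumes "litpath False F us" "satisfies \<alpha> F" "i \<le> j" "j < length us" "lit_holds \<alpha> (us ! i)"
  shows "lit_holds \<alpha> (us ! j)"
  using assms(3,4)
proof (induction j rule: dec_induct)
  case base
  then show ?case using assms(5) by simp
next
  case (step j)
  have "link False F (us ! j) (us ! Suc j)"
    using assms(1) step.prems by (simp add: litpath_def successively_conv_nth)
  then have "{neg (us ! j), us ! Suc j} \<in> F"
    by (simp add: link_def link_clauses_def)
  then have "\<exists>l\<in>{neg (us ! j), us ! Suc j}. lit_holds \<alpha> l"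
    using assms(2) unfolding satisfies_def by blast
  then show ?case using step by auto
qed

text \<open>A satisfying assignment makes a literal of \<open>C\<close> true. It lies in the first
  half, so it forces the whole second half along the path, in particular both literals of
  \<open>D\<close>, and the clause of their negations fails.\<close>

lemma unsat_gadget:
  assumes "litpath False F us" "length us = 2 * h"
    and "C \<in> F" "C \<subseteq> set (take h us)" "card C = 2"
    and "neg ` D \<in> F" "D \<subseteq> set (drop h us)" "card D = 2"
  shows "\<not> satisfies \<alpha> F"
proof
  assume sat: "satisfies \<alpha> F"
  obtain c c' where c: "C = {c, c'}" "c \<noteq> c'" using assms(5) by (auto simp: card_2_iff)
  obtain d d' where d: "D = {d, d'}" "d \<noteq> d'" using assms(8) by (auto simp: card_2_iff)
  have "\<exists>i<h. e = us ! i" if "e \<in> set (take h us)" for e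
    using that assms(2) by (auto simp: in_set_conv_nth)
  then obtain i i' where i: "i < h" "c = us ! i" "i' < h" "c' = us ! i'"
    using assms(4) c by (meson insert_subset)
  have "\<exists>j. h \<le> j \<and> j < 2 * h \<and> e = us ! j" if e: "e \<in> set (drop h us)" for e
  proof -
    obtain k where "k < length us - h" "e = drop h us ! k"
      using e by (auto simp: in_set_conv_nth)
    then show ?thesis using assms(2) by (intro exI[of _ "h + k"]) auto
  qed
  then obtain j j' where j: "h \<le> j" "j < 2 * h" "d = us ! j" "h \<le> j'" "j' < 2 * h" "d' = us ! j'"
    using assms(7) d by (meson insert_subset)
  have "\<exists>l\<in>C. lit_holds \<alpha> l" using sat assms(3) unfolding satisfies_def by blast
  then obtain k where k: "k < h" "lit_holds \<alpha> (us ! k)" using c i by auto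
  have "\<exists>l\<in>neg ` D. lit_holds \<alpha> l" using sat assms(6) unfolding satisfies_def by blast
  moreover have "lit_holds \<alpha> d" unfolding j(3)
    by (rule litpath_implies[OF assms(1) sat _ _ k(2)]) (use k j assms(2) in auto)
  moreover have "lit_holds \<alpha> d'" unfolding j(6)
    by (rule litpath_implies[OF assms(1) sat _ _ k(2)]) (use k j assms(2) in auto)
  ultimately show False using d(1) by simp
qed

text \<open>The first round provides the path. Given it, the formula can stay satisfiable only if
  the second round misses one of two explicit families of \<open>h choose 2\<close> clauses
  each.\<close>

lemma bern_expect_sat_le:
  assumes "0 \<le> p" "p \<le> 1" "0 \<le> q" "q \<le> 1" "finite X" "1 \<le> h"
  shows "bern_expect (p + q - p * q) (two_clauses X) (\<lambda>F. of_bool (\<exists>\<alpha>. satisfies \<alpha> F)) \<le>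
    bern_expect p (two_clauses X) (\<lambda>F. of_bool (\<not> (\<exists>us. length us = 2 * h \<and> litpath False F us)))
    + 2 * (1 - q) ^ (h choose 2)"
proof -
  define Q where "Q = two_clauses X"
  have finQ: "finite Q" using assms by (simp add: Q_def)
  let ?no = "\<lambda>F. \<not> (\<exists>us. length us = 2 * h \<and> litpath False F us)"
  have "bern_expect (p + q - p * q) Q (\<lambda>F. of_bool (\<exists>\<alpha>. satisfies \<alpha> F)) =
      bern_expect p Q (\<lambda>F. bern_expect q Q (\<lambda>G. of_bool (\<exists>\<alpha>. satisfies \<alpha> (F \<union> G))))"
    using bern_expect_Un[OF finQ, of p q "\<lambda>F. of_bool (\<exists>\<alpha>. satisfies \<alpha> F)"] by simp
  also have "\<dots> \<le> bern_expect p Q (\<lambda>F. of_bool (?no F) + 2 * (1 - q) ^ (h choose 2))"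
  proof (rule bern_expect_mono[OF assms(1,2)])
    fix F assume F: "F \<subseteq> Q"
    show "bern_expect q Q (\<lambda>G. of_bool (\<exists>\<alpha>. satisfies \<alpha> (F \<union> G))) \<le>
        of_bool (?no F) + 2 * (1 - q) ^ (h choose 2)"
    proof (cases "?no F")
      case True
      have "bern_expect q Q (\<lambda>G. of_bool (\<exists>\<alpha>. satisfies \<alpha> (F \<union> G))) \<le> bern_expect q Q (\<lambda>G. 1)"
        by (rule bern_expect_mono[OF assms(3,4)]) auto
      also have "\<dots> = 1" using finQ by simp
      also have "1 \<le> of_bool (?no F) + 2 * (1 - q) ^ (h choose 2)"
        using True assms by simp
      finally show ?thesis .
    next
      case False
      then obtain us where us: "length us = 2 * h" "litpath False F us" by blast
      have vars: "lit_var ` set us \<subseteq> X"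
        using us F assms(6) by (intro litpath_vars) (auto simp: Q_def)
      have inj: "inj_on lit_var (set us)" "distinct us"
        using us(2) by (auto simp: litpath_def distinct_map)
      define B1 where "B1 = {C. C \<subseteq> set (take h us) \<and> card C = 2}"
      define B2 where "B2 = (`) neg ` {C. C \<subseteq> set (drop h us) \<and> card C = 2}"
      have pair: "\<exists>a b. C = {a, b} \<and> lit_var a \<noteq> lit_var b \<and> lit_var a \<in> X \<and> lit_var b \<in> X"
        if "C \<subseteq> set us" "card C = 2" for C
      proof -
        obtain a b where "C = {a, b}" "a \<noteq> b" using \<open>card C = 2\<close> by (auto simp: card_2_iff)
        then show ?thesis using that vars inj(1) by (auto dest: inj_onD)
      qed
      have "C \<in> Q" if C: "C \<subseteq> set (take h us)" "card C = 2" for C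
      proof -
        have "C \<subseteq> set us" using C(1) set_take_subset by fast
        from pair[OF this C(2)] show ?thesis by (simp only: Q_def two_clauses_iff)
      qed
      then have B1: "B1 \<subseteq> Q" by (auto simp: B1_def)
      have "neg ` C \<in> Q" if C: "C \<subseteq> set (drop h us)" "card C = 2" for C
      proof -
        have "C \<subseteq> set us" using C(1) set_drop_subset by fast
        from pair[OF this C(2)] show ?thesis by (auto simp: Q_def)
      qed
      then have B2: "B2 \<subseteq> Q" by (auto simp: B2_def)
      have "card (set (take h us)) = h" "card (set (drop h us)) = h"
        using us(1) inj(2) by (simp_all add: distinct_card)
      moreover have "inj_on ((`) neg) S" for S :: "'a literal set set"
        by (rule inj_onI) (simp add: inj_image_eq_iff[OF inj_neg])
      ultimately have card: "card B1 = h choose 2" "card B2 = h choose 2"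
        by (simp_all add: B1_def B2_def n_subsets card_image)
      have "bern_expect q Q (\<lambda>G. of_bool (\<exists>\<alpha>. satisfies \<alpha> (F \<union> G))) \<le>
          bern_expect q Q (\<lambda>G. of_bool (G \<inter> B1 = {}) + of_bool (G \<inter> B2 = {}))"
      proof (rule bern_expect_mono[OF assms(3,4)])
        fix G assume "G \<subseteq> Q"
        have "\<not> (\<exists>\<alpha>. satisfies \<alpha> (F \<union> G))" if ne: "G \<inter> B1 \<noteq> {}" "G \<inter> B2 \<noteq> {}"
        proof -
          obtain C where "C \<in> G" "C \<in> B1" using ne(1) by blast
          moreover obtain E where "E \<in> G" "E \<in> B2" using ne(2) by blast
          moreover from this obtain D where "E = neg ` D" "D \<subseteq> set (drop h us)" "card D = 2"
            unfolding B2_def by blast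
          moreover have "litpath False (F \<union> G) us" using us(2) by (rule litpath_mono) auto
          ultimately show ?thesis
            using unsat_gadget[of "F \<union> G" us h C D] us(1) by (auto simp: B1_def)
        qed
        then show "(of_bool (\<exists>\<alpha>. satisfies \<alpha> (F \<union> G)) :: real) \<le>
            of_bool (G \<inter> B1 = {}) + of_bool (G \<inter> B2 = {})"
          by (cases "G \<inter> B1 = {}"; cases "G \<inter> B2 = {}") auto
      qed
      also have "\<dots> = 2 * (1 - q) ^ (h choose 2)"
        using finQ B1 B2 card by (simp add: bern_expect_add bern_expect_disjoint)
      finally show ?thesis by simp
    qed
  qed
  also have "\<dots> = bern_expect p Q (\<lambda>F. of_bool (?no F)) + 2 * (1 - q) ^ (h choose 2)"
    using finQ by (simp add: bern_expect_add)
  finally show ?thesis by (simp add: Q_def)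
qed

section \<open>Cuts of the variable set crossed by many clauses\<close>

definition crosses :: "'x set \<Rightarrow> 'x clause \<Rightarrow> bool" where
  "crosses A C \<longleftrightarrow> clause_vars C \<inter> A \<noteq> {} \<and> \<not> clause_vars C \<subseteq> A"

text \<open>\<open>P\<close> will be the variable set of a long primal path. Balance is measured on
  \<open>P\<close> alone, and \<open>A\<close> is arbitrary elsewhere, so that an initial segment of
  any variable order can play the role of \<open>A\<close>.\<close>

definition hard_to_cut :: "'x set \<Rightarrow> nat \<Rightarrow> 'x cnf \<Rightarrow> bool" where
  "hard_to_cut X s F \<longleftrightarrow>
     (\<exists>P\<subseteq>X. \<forall>A. card (A \<inter> P) = card P div 2 \<longrightarrow> s \<le> card {C \<in> F. crosses A C})"

lemma hard_to_cut_mono: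
  assumes "hard_to_cut X s F" "F \<subseteq> G" "finite G"
  shows "hard_to_cut X s G"
proof -
  have "card {C \<in> F. crosses A C} \<le> card {C \<in> G. crosses A C}" for A
    using assms(2,3) by (intro card_mono) auto
  then show ?thesis
    using assms(1) unfolding hard_to_cut_def by (meson order_trans)
qed

lemma ex_change:
  fixes R :: "nat \<Rightarrow> bool"
  assumes "a \<le> i" "i < b" "a \<le> j" "j < b" "R i" "\<not> R j"
  shows "\<exists>k. a \<le> k \<and> Suc k < b \<and> R k \<noteq> R (Suc k)"
proof (rule ccontr)
  assume no: "\<not> ?thesis"
  have eq: "R k = R a" if "a \<le> k" "k < b" for k
    using that
  proof (induction k rule: dec_induct)
    case (step k)
    then show ?case using no by (metis Suc_lessD)
  qed simp
  show False using eq[of i] eq[of j] assms by simp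
qed

text \<open>A piece meeting both sides of the cut contains a crossing clause, and different pieces
  give different clauses, so fewer than s \<le> r / 4 pieces are mixed. Each side holds half of the
  path, hence at least r / 4 whole pieces.\<close>

lemma path_pieces:
  fixes us :: "'x literal list"
  assumes path: "litpath b F us" and len: "length us = r * k" and fin: "finite F"
    and half: "card (A \<inter> lit_var ` set us) = (r * k) div 2"
    and few: "card {C \<in> F. crosses A C} < s" and "4 * s \<le> r" "1 \<le> k"
  defines "piece \<equiv> \<lambda>i. (\<lambda>j. lit_var (us ! j)) ` {i * k..<i * k + k}"
  shows "r \<le> 4 * card {i. i < r \<and> piece i \<subseteq> A}" "r \<le> 4 * card {i. i < r \<and> piece i \<inter> A = {}}"
proof -
  define v where "v = (\<lambda>j. lit_var (us ! j))"
  have v: "inj_on v {..<r * k}"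
    using path len by (auto simp: litpath_def distinct_conv_nth inj_on_def v_def)
  have img: "lit_var ` set us = v ` {..<r * k}"
    by (auto simp: v_def set_conv_nth len)
  have piece: "piece i = v ` {i * k..<i * k + k}" for i by (simp add: piece_def v_def)
  have blk: "j div k = i" if "j \<in> {i * k..<i * k + k}" for i j
    using that assms(7) by (intro div_nat_eqI) (auto simp: algebra_simps)
  have blk': "j \<in> {j div k * k..<j div k * k + k}" for j
  proof -
    have "j mod k < k" using assms(7) by simp
    then show ?thesis using div_mult_mod_eq[of j k]
      by (simp only: atLeastLessThan_iff) linarith
  qed
  have blk_less: "j < r * k" if "j \<in> {i * k..<i * k + k}" "i < r" for i j
  proof -
    have "Suc i * k \<le> r * k" using that(2) by (intro mult_le_mono1) simp
    then show ?thesis using that(1) by simp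
  qed
  have div_less: "j div k < r" if "j < r * k" for j
    using that by (simp add: less_mult_imp_div_less)
  define mixed where "mixed = {i. i < r \<and> \<not> piece i \<subseteq> A \<and> piece i \<inter> A \<noteq> {}}"
  have "\<exists>C j. C \<in> F \<and> crosses A C \<and> clause_vars C = {v j, v (Suc j)} \<and>
      j \<in> {i * k..<i * k + k} \<and> Suc j \<in> {i * k..<i * k + k}" if i: "i \<in> mixed" for i
  proof -
    obtain x y where "x \<in> piece i" "x \<in> A" "y \<in> piece i" "y \<notin> A"
      using i unfolding mixed_def by blast
    then obtain j j' where j: "j \<in> {i * k..<i * k + k}" "v j \<in> A"
      "j' \<in> {i * k..<i * k + k}" "v j' \<notin> A"
      unfolding piece by blast
    then obtain l where l: "i * k \<le> l" "Suc l < i * k + k" "(v l \<in> A) \<noteq> (v (Suc l) \<in> A)"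
      using ex_change[of "i * k" j "i * k + k" j' "\<lambda>j. v j \<in> A"] by auto
    have "Suc l < length us"
      using blk_less[of "Suc l" i] l i len by (auto simp: mixed_def)
    then have "link b F (us ! l) (us ! Suc l)"
      using path by (simp add: litpath_def successively_conv_nth)
    then obtain C where C: "C \<in> F" "clause_vars C = {v l, v (Suc l)}"
      by (auto simp: link_def link_clauses_def clause_vars_def v_def split: if_splits)
    then have "crosses A C" using l(3) by (auto simp: crosses_def)
    with C l show ?thesis by (intro exI[of _ C] exI[of _ l]) auto
  qed
  then have "\<forall>i\<in>mixed. \<exists>C. \<exists>j. C \<in> F \<and> crosses A C \<and> clause_vars C = {v j, v (Suc j)} \<and>
      j \<in> {i * k..<i * k + k} \<and> Suc j \<in> {i * k..<i * k + k}" by blast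
  from bchoice[OF this] obtain f where f: "\<forall>i\<in>mixed. \<exists>j. f i \<in> F \<and> crosses A (f i) \<and>
      clause_vars (f i) = {v j, v (Suc j)} \<and> j \<in> {i * k..<i * k + k} \<and> Suc j \<in> {i * k..<i * k + k}"
    by (rule exE)
  \<comment> \<open>The variables of a path clause determine its position on the path, and both of
    its ends lie in the same piece.\<close>
  have "inj_on f mixed"
  proof (rule inj_onI)
    fix i i' assume i: "i \<in> mixed" "i' \<in> mixed" "f i = f i'"
    obtain j where j: "clause_vars (f i) = {v j, v (Suc j)}" "j \<in> {i * k..<i * k + k}"
      "Suc j \<in> {i * k..<i * k + k}" using f i(1) by blast
    obtain j' where j': "clause_vars (f i') = {v j', v (Suc j')}" "j' \<in> {i' * k..<i' * k + k}"
      "Suc j' \<in> {i' * k..<i' * k + k}" using f i(2) by blast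
    have "i < r" "i' < r" using i by (auto simp: mixed_def)
    have "v j = v j' \<or> v j = v (Suc j')" using j(1) j'(1) i(3) by (auto simp: doubleton_eq_iff)
    then have "j = j' \<or> j = Suc j'"
      using v blk_less[OF j(2) \<open>i < r\<close>] blk_less[OF j'(2) \<open>i' < r\<close>] blk_less[OF j'(3) \<open>i' < r\<close>]
      by (auto simp: inj_on_eq_iff)
    then show "i = i'" using blk[OF j(2)] blk[OF j'(2)] blk[OF j'(3)] by auto
  qed
  then have "card mixed \<le> card {C \<in> F. crosses A C}"
    using f fin by (intro card_inj_on_le[of f]) auto
  then have mixed: "card mixed < s" using few by simp
  have finm: "finite mixed" by (simp add: mixed_def)
  have count: "card B \<le> k * card I + k * card mixed"
    if "B \<subseteq> {..<r * k}" "\<And>j. j \<in> B \<Longrightarrow> j div k \<in> I \<union> mixed" "finite I" for B I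
  proof -
    have "B \<subseteq> (\<Union>i\<in>I \<union> mixed. {i * k..<i * k + k})"
      using that(2) blk' by blast
    then have "card B \<le> card (\<Union>i\<in>I \<union> mixed. {i * k..<i * k + k})"
      using that(3) finm by (intro card_mono) auto
    also have "\<dots> \<le> (\<Sum>i\<in>I \<union> mixed. card {i * k..<i * k + k})"
      using that(3) finm by (intro card_UN_le) auto
    also have "\<dots> = k * card (I \<union> mixed)" by simp
    also have "\<dots> \<le> k * (card I + card mixed)"
      by (intro mult_le_mono2 card_Un_le)
    finally show ?thesis by (simp add: algebra_simps)
  qed
  \<comment> \<open>The strict inequality leaves a surplus of k, which absorbs the rounding in
    \<open>(r * k) div 2\<close>.\<close>
  have km: "k * card mixed + k \<le> k * s"
    using mixed by (metis Suc_leI add.commute mult_Suc_right mult_le_mono2)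
  have s4: "4 * (k * s) \<le> r * k"
    using mult_le_mono1[OF assms(6), of k] by (simp add: algebra_simps)
  have inB: "j div k < r \<and> v j \<in> piece (j div k)" if "j < r * k" for j
    using div_less[OF that] blk'[of j] unfolding piece by blast
  have A: "A \<inter> lit_var ` set us = v ` {j \<in> {..<r * k}. v j \<in> A}"
    unfolding img by auto
  have cA: "card {j \<in> {..<r * k}. v j \<in> A} = (r * k) div 2"
    using half unfolding A by (subst (asm) card_image) (auto intro: inj_on_subset[OF v])
  have cB: "card {j \<in> {..<r * k}. v j \<notin> A} = r * k - (r * k) div 2"
  proof -
    have "{j \<in> {..<r * k}. v j \<notin> A} = {..<r * k} - {j \<in> {..<r * k}. v j \<in> A}" by auto
    moreover have "card ({..<r * k} - {j \<in> {..<r * k}. v j \<in> A}) =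
        card {..<r * k} - card {j \<in> {..<r * k}. v j \<in> A}"
      by (rule card_Diff_subset) auto
    ultimately show ?thesis using cA by (simp only: card_lessThan)
  qed
  have fin: "finite {i. i < r \<and> S i}" for S by simp
  have "(r * k) div 2 \<le> k * card {i. i < r \<and> piece i \<subseteq> A} + k * card mixed"
    unfolding cA[symmetric]
  proof (rule count[OF _ _ fin])
    fix j assume "j \<in> {j \<in> {..<r * k}. v j \<in> A}"
    then show "j div k \<in> {i. i < r \<and> piece i \<subseteq> A} \<union> mixed"
      using inB[of j] by (auto simp: mixed_def)
  qed auto
  moreover have "r * k - (r * k) div 2 \<le> k * card {i. i < r \<and> piece i \<inter> A = {}} + k * card mixed"
    unfolding cB[symmetric]
  proof (rule count[OF _ _ fin])
    fix j assume "j \<in> {j \<in> {..<r * k}. v j \<notin> A}"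
    then show "j div k \<in> {i. i < r \<and> piece i \<inter> A = {}} \<union> mixed"
      using inB[of j] by (auto simp: mixed_def)
  qed auto
  ultimately have "r * k \<le> 4 * (k * card {i. i < r \<and> piece i \<subseteq> A})"
    "r * k \<le> 4 * (k * card {i. i < r \<and> piece i \<inter> A = {}})"
    using km s4 assms(7) by linarith+
  then have "k * r \<le> k * (4 * card {i. i < r \<and> piece i \<subseteq> A})"
    "k * r \<le> k * (4 * card {i. i < r \<and> piece i \<inter> A = {}})"
    by (simp_all add: algebra_simps)
  then show "r \<le> 4 * card {i. i < r \<and> piece i \<subseteq> A}" "r \<le> 4 * card {i. i < r \<and> piece i \<inter> A = {}}"
    using assms(7) by simp_all
qed

lemma card_UN_blocks:
  assumes "finite I"
  shows "card (\<Union>i\<in>I. {i * k..<i * k + k :: nat}) = card I * k"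
proof -
  have disj: "{i * k..<i * k + k} \<inter> {j * k..<j * k + k} = {}" if "i < j" for i j :: nat
  proof -
    have "Suc i * k \<le> j * k" using that by (intro mult_le_mono1) simp
    then show ?thesis by auto
  qed
  have "card (\<Union>i\<in>I. {i * k..<i * k + k}) = (\<Sum>i\<in>I. card {i * k..<i * k + k})"
  proof (rule card_UN_disjoint[OF assms])
    show "\<forall>i\<in>I. \<forall>j\<in>I. i \<noteq> j \<longrightarrow> {i * k..<i * k + k} \<inter> {j * k..<j * k + k} = {}"
      using disj by (metis Int_commute nat_neq_iff)
  qed simp
  then show ?thesis by simp
qed

text \<open>A cheap balanced cut has whole pieces \<open>I\<close> on one side and \<open>J\<close>
  on the other. The union bound runs over the at most 4 ^ r such pairs instead of over all cuts, and
  every pair offers at least \<open>D\<close> clauses to the second round.\<close>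

lemma bern_expect_cut_le:
  fixes X :: "'x set"
  assumes "0 \<le> p" "p \<le> 1" "0 \<le> q" "q \<le> 1" "finite X"
    and "1 \<le> k" "2 \<le> r * k" "4 * s \<le> r" "16 * D \<le> (r * k)\<^sup>2"
  shows "bern_expect (p + q - p * q) (two_clauses X) (\<lambda>F. of_bool (\<not> hard_to_cut X s F)) \<le>
    bern_expect p (two_clauses X) (\<lambda>F. of_bool (\<not> (\<exists>us. length us = r * k \<and> litpath True F us)))
    + 4 ^ r * (2 ^ s * (1 - q / 2) ^ D)"
proof -
  define Q where "Q = two_clauses X"
  have finQ: "finite Q" using assms by (simp add: Q_def)
  define e where "e = (2::real) ^ s * (1 - q / 2) ^ D"
  have e: "0 \<le> e" using assms by (simp add: e_def)
  let ?no = "\<lambda>F. \<not> (\<exists>us. length us = r * k \<and> litpath True F us)"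
  have "bern_expect (p + q - p * q) Q (\<lambda>F. of_bool (\<not> hard_to_cut X s F)) =
      bern_expect p Q (\<lambda>F. bern_expect q Q (\<lambda>G. of_bool (\<not> hard_to_cut X s (F \<union> G))))"
    using bern_expect_Un[OF finQ, of p q "\<lambda>F. of_bool (\<not> hard_to_cut X s F)"] by simp
  also have "\<dots> \<le> bern_expect p Q (\<lambda>F. of_bool (?no F) + 4 ^ r * e)"
  proof (rule bern_expect_mono[OF assms(1,2)])
    fix F assume F: "F \<subseteq> Q"
    show "bern_expect q Q (\<lambda>G. of_bool (\<not> hard_to_cut X s (F \<union> G))) \<le> of_bool (?no F) + 4 ^ r * e"
    proof (cases "?no F")
      case True
      have "bern_expect q Q (\<lambda>G. of_bool (\<not> hard_to_cut X s (F \<union> G))) \<le> bern_expect q Q (\<lambda>G. 1)"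
        by (rule bern_expect_mono[OF assms(3,4)]) auto
      also have "\<dots> = 1" using finQ by simp
      also have "1 \<le> of_bool (?no F) + 4 ^ r * e"
        using True e by simp
      finally show ?thesis .
    next
      case False
      then obtain us where us: "length us = r * k" "litpath True F us" by blast
      define v where "v = (\<lambda>j. lit_var (us ! j))"
      define piece where "piece = (\<lambda>i. v ` {i * k..<i * k + k})"
      have P: "lit_var ` set us \<subseteq> X"
        using us F assms(7) by (intro litpath_vars) (auto simp: Q_def)
      have v: "inj_on v {..<r * k}"
        using us by (auto simp: litpath_def distinct_conv_nth inj_on_def v_def)
      have cardP: "card (lit_var ` set us) = r * k"
        using us distinct_card[of "map lit_var us"] by (simp add: litpath_def)
      \<comment> \<open>Clauses with two positive literals are enough: one of four sign patterns per
        pair of variables costs only a constant factor.\<close>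
      define B where "B = (\<lambda>(I, J). (\<lambda>(x, y). {Pos x, Pos y}) ` (\<Union>(piece ` I) \<times> \<Union>(piece ` J)))"
      define good where "good = {(I, J). I \<subseteq> {..<r} \<and> J \<subseteq> {..<r} \<and> r \<le> 4 * card I \<and>
        r \<le> 4 * card J \<and> \<Union>(piece ` I) \<inter> \<Union>(piece ` J) = {}}"
      have good_sub: "good \<subseteq> Pow {..<r} \<times> Pow {..<r}" by (auto simp: good_def)
      then have fing: "finite good" by (rule finite_subset) simp
      have "card good \<le> card (Pow {..<r} \<times> Pow {..<r})"
        by (rule card_mono[OF _ good_sub]) simp
      also have "\<dots> = 4 ^ r"
        by (simp add: card_cartesian_product card_Pow power_mult_distrib[symmetric])
      finally have cardg: "real (card good) \<le> 4 ^ r"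
        by (metis of_nat_le_iff of_nat_numeral of_nat_power)
      have blk_sub: "(\<Union>i\<in>I. {i * k..<i * k + k}) \<subseteq> {..<r * k}" if "I \<subseteq> {..<r}" for I
      proof -
        have "i * k + k \<le> r * k" if "i \<in> I" for i
        proof -
          have "Suc i * k \<le> r * k" using that \<open>I \<subseteq> {..<r}\<close> by (intro mult_le_mono1) auto
          then show ?thesis by simp
        qed
        then show ?thesis by fastforce
      qed
      have Upiece: "\<Union>(piece ` I) = v ` (\<Union>i\<in>I. {i * k..<i * k + k})" for I
        by (auto simp: piece_def)
      have cardU: "card (\<Union>(piece ` I)) = card I * k" "\<Union>(piece ` I) \<subseteq> X" if "I \<subseteq> {..<r}" for I
      proof -
        have "card (\<Union>(piece ` I)) = card (\<Union>i\<in>I. {i * k..<i * k + k})"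
          unfolding Upiece by (rule card_image) (rule inj_on_subset[OF v blk_sub[OF that]])
        then show "card (\<Union>(piece ` I)) = card I * k"
          using that by (simp add: card_UN_blocks finite_subset)
        have "v ` {..<r * k} \<subseteq> X" using P us by (auto simp: v_def)
        then show "\<Union>(piece ` I) \<subseteq> X" unfolding Upiece using blk_sub[OF that] by blast
      qed
      have B: "B ij \<subseteq> Q" "D \<le> card (B ij)" if "ij \<in> good" for ij
      proof -
        obtain I J where ij: "ij = (I, J)" by (cases ij)
        have IJ: "I \<subseteq> {..<r}" "J \<subseteq> {..<r}" "r \<le> 4 * card I" "r \<le> 4 * card J"
          "\<Union>(piece ` I) \<inter> \<Union>(piece ` J) = {}"
          using that by (auto simp: good_def ij)
        have BIJ: "B ij = (\<lambda>(x, y). {Pos x, Pos y}) ` (\<Union>(piece ` I) \<times> \<Union>(piece ` J))"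
          by (simp add: B_def ij)
        show "B ij \<subseteq> Q"
        proof
          fix C assume "C \<in> B ij"
          then obtain xy where xy: "xy \<in> \<Union>(piece ` I) \<times> \<Union>(piece ` J)"
            "C = (\<lambda>(x, y). {Pos x, Pos y}) xy"
            unfolding BIJ by blast
          obtain x y where "xy = (x, y)" by (cases xy)
          with xy have C: "C = {Pos x, Pos y}" "x \<in> \<Union>(piece ` I)" "y \<in> \<Union>(piece ` J)"
            by simp_all
          then have "x \<noteq> y" "x \<in> X" "y \<in> X" using IJ(5) cardU(2) IJ(1,2) by blast+
          then show "C \<in> Q" by (simp add: Q_def C(1))
        qed
        have "inj_on (\<lambda>(x, y). {Pos x, Pos y}) (\<Union>(piece ` I) \<times> \<Union>(piece ` J))"
          using IJ(5) by (auto simp: inj_on_def doubleton_eq_iff)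
        then have "card (B ij) = (card I * k) * (card J * k)"
          unfolding BIJ using cardU(1)[OF IJ(1)] cardU(1)[OF IJ(2)]
          by (simp add: card_image card_cartesian_product)
        moreover have "(r * k) * (r * k) \<le> (4 * card I * k) * (4 * card J * k)"
          using IJ(3,4) by (intro mult_le_mono mult_le_mono1)
        moreover have "(r * k)\<^sup>2 = (r * k) * (r * k)" by (rule power2_eq_square)
        moreover have "(4 * card I * k) * (4 * card J * k) = 16 * ((card I * k) * (card J * k))"
          by simp
        ultimately have "(r * k)\<^sup>2 \<le> 16 * card (B ij)" by (simp only:)
        then show "D \<le> card (B ij)" using assms(9) by linarith
      qed
      have "bern_expect q Q (\<lambda>G. of_bool (\<not> hard_to_cut X s (F \<union> G))) \<le>
          bern_expect q Q (\<lambda>G. \<Sum>ij\<in>good. of_bool (card (G \<inter> B ij) < s))"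
      proof (rule bern_expect_mono[OF assms(3,4)])
        fix G assume G: "G \<subseteq> Q"
        show "(of_bool (\<not> hard_to_cut X s (F \<union> G)) :: real) \<le>
            (\<Sum>ij\<in>good. of_bool (card (G \<inter> B ij) < s))"
        proof (cases "hard_to_cut X s (F \<union> G)")
          case False
          have finFG: "finite (F \<union> G)" using F G finQ by (auto intro: finite_subset)
          have "\<exists>A. card (A \<inter> lit_var ` set us) = card (lit_var ` set us) div 2 \<and>
              \<not> s \<le> card {C \<in> F \<union> G. crosses A C}"
            using False P unfolding hard_to_cut_def by blast
          then obtain A where A: "card (A \<inter> lit_var ` set us) = (r * k) div 2"
            "card {C \<in> F \<union> G. crosses A C} < s"
            unfolding cardP not_le by blast
          have path: "litpath True (F \<union> G) us" using us(2) by (rule litpath_mono) auto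
          define I where "I = {i. i < r \<and> piece i \<subseteq> A}"
          define J where "J = {i. i < r \<and> piece i \<inter> A = {}}"
          have "r \<le> 4 * card I" "r \<le> 4 * card J"
            using path_pieces[OF path us(1) finFG A assms(8,6)]
            by (simp_all add: I_def J_def piece_def v_def)
          then have good: "(I, J) \<in> good" by (auto simp: good_def I_def J_def)
          have "crosses A C" if "C \<in> B (I, J)" for C
          proof -
            obtain xy where xy: "xy \<in> \<Union>(piece ` I) \<times> \<Union>(piece ` J)"
              "C = (\<lambda>(x, y). {Pos x, Pos y}) xy"
              using \<open>C \<in> B (I, J)\<close> by (auto simp: B_def)
            obtain x y where "xy = (x, y)" by (cases xy)
            with xy have "C = {Pos x, Pos y}" "x \<in> A" "y \<notin> A"
              unfolding I_def J_def by auto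
            then show ?thesis by (auto simp: crosses_def clause_vars_def)
          qed
          then have "card (G \<inter> B (I, J)) \<le> card {C \<in> F \<union> G. crosses A C}"
            using finFG by (intro card_mono) auto
          then have "card (G \<inter> B (I, J)) < s" using A(2) by simp
          then have "1 \<le> (\<Sum>ij\<in>{(I, J)}. of_bool (card (G \<inter> B ij) < s) :: real)" by simp
          also have "\<dots> \<le> (\<Sum>ij\<in>good. of_bool (card (G \<inter> B ij) < s))"
            using good fing by (intro sum_mono2) auto
          finally show ?thesis using False by simp
        qed (simp add: sum_nonneg)
      qed
      also have "\<dots> = (\<Sum>ij\<in>good. bern_expect q Q (\<lambda>G. of_bool (card (G \<inter> B ij) < s)))"
        by (rule bern_expect_sum)
      also have "\<dots> \<le> (\<Sum>ij\<in>good. e)"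
      proof (rule sum_mono)
        fix ij assume ij: "ij \<in> good"
        have "bern_expect q Q (\<lambda>G. of_bool (card (G \<inter> B ij) < s)) \<le> 2 ^ s * (1 - q / 2) ^ card (B ij)"
          using finQ B(1)[OF ij] assms by (intro bern_expect_few)
        also have "\<dots> \<le> e"
          unfolding e_def using assms B(2)[OF ij] by (intro mult_left_mono power_decreasing) auto
        finally show "bern_expect q Q (\<lambda>G. of_bool (card (G \<inter> B ij) < s)) \<le> e" .
      qed
      also have "\<dots> \<le> 4 ^ r * e" using cardg e by (simp add: mult_right_mono)
      finally show ?thesis by simp
    qed
  qed
  also have "\<dots> = bern_expect p Q (\<lambda>F. of_bool (?no F)) + 4 ^ r * e"
    using finQ by (simp add: bern_expect_add)
  finally show ?thesis by (simp add: Q_def e_def)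
qed

subsection \<open>Decision diagrams and subfunctions\<close>

definition follows :: "('v, 'x) bdd_graph \<Rightarrow> ('x \<Rightarrow> bool) \<Rightarrow> 'v \<Rightarrow> 'v \<Rightarrow> bool" where
  "follows D \<alpha> u w \<longleftrightarrow> (\<exists>x a c. node_at D u = Decision x a c \<and> w = (if \<alpha> x then c else a))"

lemma evaluates_imp_path:
  assumes "evaluates D \<alpha> v b"
  shows "\<exists>p. p \<noteq> [] \<and> hd p = v \<and> node_at D (last p) = Sink b \<and> successively (follows D \<alpha>) p"
  using assms
proof (induction rule: evaluates.induct)
  case (sink v b)
  then show ?case by (intro exI[of _ "[v]"]) simp
next
  case (decision v x u w b)
  then obtain p where p: "p \<noteq> []" "hd p = (if \<alpha> x then w else u)" "node_at D (last p) = Sink b"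
    "successively (follows D \<alpha>) p" by blast
  then have "successively (follows D \<alpha>) (v # p)"
    using decision(1) by (cases p) (auto simp: follows_def)
  with p show ?case by (intro exI[of _ "v # p"]) simp
qed

lemma path_imp_evaluates:
  assumes "successively (follows D \<alpha>) p" "p \<noteq> []" "node_at D (last p) = Sink b"
  shows "evaluates D \<alpha> (hd p) b"
  using assms
proof (induction p)
  case (Cons v p)
  show ?case
  proof (cases p)
    case Nil
    then show ?thesis using Cons by (auto intro: evaluates.sink)
  next
    case (Cons w q)
    then have "evaluates D \<alpha> w b" "follows D \<alpha> v w" using Cons.IH Cons.prems by auto
    then show ?thesis by (auto simp: follows_def intro: evaluates.decision)
  qed
qed simp

lemma evaluates_unique: "evaluates D \<alpha> v b \<Longrightarrow> evaluates D \<alpha> v c \<Longrightarrow> b = c"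
proof (induction arbitrary: c rule: evaluates.induct)
  case (sink v b)
  from sink(2) show ?case by (cases rule: evaluates.cases) (use sink(1) in auto)
next
  case (decision v x u w b)
  have node: "node_at D v = Decision x u w" by fact
  have IH: "evaluates D \<alpha> (if \<alpha> x then w else u) c \<Longrightarrow> b = c" by fact
  from decision.prems show ?case
  proof (cases rule: evaluates.cases)
    case sink
    then show ?thesis using node by simp
  next
    case (decision x' u' w')
    then have "x' = x" "u' = u" "w' = w" using node by simp_all
    then show ?thesis using decision(2) IH by (simp only:)
  qed
qed

lemma path_vars_Nil [simp]: "path_vars D [] = []"
  by (simp add: path_vars_def)

lemma path_vars_Cons:
  "path_vars D (v # p) = (case node_at D v of Sink b \<Rightarrow> [] | Decision x u w \<Rightarrow> [x]) @ path_vars D p"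
  by (simp add: path_vars_def split: bdd_node.split)

lemma path_vars_append: "path_vars D (p @ q) = path_vars D p @ path_vars D q"
  by (induction p) (simp_all add: path_vars_Cons)

lemma set_path_vars: "set (path_vars D p) = {x. \<exists>v\<in>set p. \<exists>a c. node_at D v = Decision x a c}"
proof (induction p)
  case (Cons v p)
  then show ?case by (cases "node_at D v") (auto simp: path_vars_Cons)
qed simp

lemma follows_cong:
  assumes "successively (follows D \<alpha>) p"
    "\<And>u x a c. u \<in> set p \<Longrightarrow> node_at D u = Decision x a c \<Longrightarrow> \<alpha> x = \<beta> x"
  shows "successively (follows D \<beta>) p"
proof (rule successively_mono[OF assms(1)])
  fix u w assume u: "u \<in> set p" "follows D \<alpha> u w"
  then obtain x a c where "node_at D u = Decision x a c" "w = (if \<alpha> x then c else a)"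
    by (auto simp: follows_def)
  then show "follows D \<beta> u w" using assms(2)[OF u(1)] by (simp add: follows_def)
qed

lemma follows_path_edges:
  assumes "bdd D" "successively (follows D \<alpha>) p" "p \<noteq> []" "hd p \<in> nodes D"
  shows "set p \<subseteq> nodes D \<and> successively (\<lambda>u v. (u, v) \<in> edges D) p"
  using assms(2-)
proof (induction p)
  case (Cons v p)
  show ?case
  proof (cases p)
    case (Cons w q)
    then have "(v, w) \<in> edges D"
      using Cons.prems by (auto simp: follows_def edges_def)
    moreover from this have "w \<in> nodes D"
      using bdd.edges_closed[OF assms(1)] by auto
    ultimately show ?thesis using Cons.IH Cons.prems Cons by auto
  qed (use Cons in auto)
qed simp

text \<open>The part read above the cut comes from \<alpha> and the part below from \<beta>;
  restricting to \<open>X\<close> makes the result an admissible input of the computed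
  function.\<close>

definition mix :: "'x set \<Rightarrow> 'x set \<Rightarrow> ('x \<Rightarrow> bool) \<Rightarrow> ('x \<Rightarrow> bool) \<Rightarrow> 'x \<Rightarrow> bool" where
  "mix X A \<alpha> \<beta> = restrict (\<lambda>x. if x \<in> A then \<alpha> x else \<beta> x) X"

text \<open>The path is cut at its first node not labelled in \<open>A\<close>. This node is a sink,
  or its variable precedes all later ones on the path; then none of those is in \<open>A\<close>, as
  \<open>A\<close> is an initial segment of the order.\<close>

lemma split_path_at_cut:
  assumes "bdd D" "computes D X f" "\<alpha> \<in> X \<rightarrow>\<^sub>E UNIV"
    and sorted: "\<And>p. source_sink_path D p \<Longrightarrow> sorted_wrt (\<lambda>x y. (x, y) \<in> r) (path_vars D p)"
    and down: "\<And>x y. (x, y) \<in> r \<Longrightarrow> y \<in> A \<Longrightarrow> x \<in> A"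
  shows "\<exists>p q. q \<noteq> [] \<and> hd (p @ q) = source D \<and> set (p @ q) \<subseteq> nodes D \<and>
    successively (follows D \<alpha>) (p @ q) \<and> node_at D (last q) = Sink (f \<alpha>) \<and>
    set (path_vars D p) \<subseteq> A \<and> set (path_vars D q) \<inter> A = {}"
proof -
  have "evaluates D \<alpha> (source D) (f \<alpha>)"
    using assms(2,3) by (simp add: computes_def)
  from evaluates_imp_path[OF this]
  obtain p where p: "p \<noteq> []" "hd p = source D" "node_at D (last p) = Sink (f \<alpha>)"
    "successively (follows D \<alpha>) p" by blast
  have nodes: "set p \<subseteq> nodes D" "successively (\<lambda>u v. (u, v) \<in> edges D) p"
    using follows_path_edges[OF assms(1) p(4,1)] p(2) bdd.source_in_nodes[OF assms(1)] by auto
  then have "source_sink_path D p"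
    using p by (auto simp: source_sink_path_def sinks_def)
  then have srt: "sorted_wrt (\<lambda>x y. (x, y) \<in> r) (path_vars D p)" by (rule sorted)
  define inA where "inA = (\<lambda>u. \<exists>x a c. node_at D u = Decision x a c \<and> x \<in> A)"
  define p1 where "p1 = takeWhile inA p"
  define p2 where "p2 = dropWhile inA p"
  have p12: "p = p1 @ p2" by (simp add: p1_def p2_def)
  have "\<not> inA (last p)" using p(3) by (simp add: inA_def)
  then have ne: "p2 \<noteq> []" using p(1) by (auto simp: p2_def)
  then obtain v q where vq: "p2 = v # q" by (cases p2) auto
  have v: "\<not> inA v" using hd_dropWhile[of inA p] ne vq by (simp add: p2_def)
  have "set (path_vars D p2) \<inter> A = {}"
  proof (cases "node_at D v")
    case (Sink b)
    have "q = []"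
      using p(4) Sink unfolding p12 vq
      by (cases q) (auto simp: successively_append_iff follows_def)
    then show ?thesis using vq Sink by (simp add: path_vars_Cons)
  next
    case (Decision x a c)
    then have "x \<notin> A" using v by (auto simp: inA_def)
    moreover have "\<forall>y\<in>set (path_vars D q). (x, y) \<in> r"
      using srt Decision unfolding p12 vq path_vars_append path_vars_Cons
      by (simp add: sorted_wrt_append)
    ultimately show ?thesis using vq Decision down by (auto simp: path_vars_Cons)
  qed
  moreover have "set (path_vars D p1) \<subseteq> A"
    unfolding p1_def by (auto simp: set_path_vars inA_def dest: set_takeWhileD)
  ultimately show ?thesis
    using p nodes ne p12 by (intro exI[of _ p1] exI[of _ p2]) auto
qed

text \<open>If two accepted inputs enter the lower part of the diagram at the same node, their lower
  paths can be exchanged, and both mixtures are accepted. Members of a fooling set therefore enter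
  at different nodes.\<close>

lemma fooling_set_bound:
  fixes \<tau> :: "'i \<Rightarrow> 'x \<Rightarrow> bool"
  assumes "bdd D" "computes D X f"
    and sorted: "\<And>p. source_sink_path D p \<Longrightarrow> sorted_wrt (\<lambda>x y. (x, y) \<in> r) (path_vars D p)"
    and down: "\<And>x y. (x, y) \<in> r \<Longrightarrow> y \<in> A \<Longrightarrow> x \<in> A"
    and sat: "\<And>i. i \<in> I \<Longrightarrow> \<tau> i \<in> X \<rightarrow>\<^sub>E UNIV \<and> f (\<tau> i)"
    and fool: "\<And>i j. i \<in> I \<Longrightarrow> j \<in> I \<Longrightarrow> i \<noteq> j \<Longrightarrow>
      \<not> f (mix X A (\<tau> i) (\<tau> j)) \<or> \<not> f (mix X A (\<tau> j) (\<tau> i))"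
  shows "card I \<le> card (nodes D)"
proof -
  have "\<exists>pq. snd pq \<noteq> [] \<and> hd (fst pq @ snd pq) = source D \<and> set (fst pq @ snd pq) \<subseteq> nodes D \<and>
    successively (follows D (\<tau> i)) (fst pq @ snd pq) \<and> node_at D (last (snd pq)) = Sink (f (\<tau> i)) \<and>
    set (path_vars D (fst pq)) \<subseteq> A \<and> set (path_vars D (snd pq)) \<inter> A = {}" if "i \<in> I" for i
    using split_path_at_cut[OF assms(1,2) _ sorted down, of "\<tau> i"] sat[OF that] by simp
  then obtain pq where pq: "\<And>i. i \<in> I \<Longrightarrow> snd (pq i) \<noteq> [] \<and>
    hd (fst (pq i) @ snd (pq i)) = source D \<and> set (fst (pq i) @ snd (pq i)) \<subseteq> nodes D \<and>
    successively (follows D (\<tau> i)) (fst (pq i) @ snd (pq i)) \<and>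
    node_at D (last (snd (pq i))) = Sink (f (\<tau> i)) \<and>
    set (path_vars D (fst (pq i))) \<subseteq> A \<and> set (path_vars D (snd (pq i))) \<inter> A = {}"
    by metis
  have vars: "x \<in> X" if "u \<in> nodes D" "node_at D u = Decision x a c" for u x a c
    using assms(2) that by (auto simp: computes_def bdd_vars_def)
  have mixed: "f (mix X A (\<tau> i) (\<tau> j))"
    if ij: "i \<in> I" "j \<in> I" "hd (snd (pq i)) = hd (snd (pq j))" for i j
  proof -
    let ?m = "mix X A (\<tau> i) (\<tau> j)"
    define p where "p = fst (pq i)"
    define q where "q = snd (pq i)"
    define q' where "q' = snd (pq j)"
    have i: "q \<noteq> []" "hd (p @ q) = source D" "set (p @ q) \<subseteq> nodes D"
      "successively (follows D (\<tau> i)) (p @ q)" "set (path_vars D p) \<subseteq> A"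
      using pq[OF ij(1)] by (auto simp: p_def q_def)
    have j: "q' \<noteq> []" "set q' \<subseteq> nodes D" "successively (follows D (\<tau> j)) q'"
      "set (path_vars D q') \<inter> A = {}" "node_at D (last q') = Sink True"
      using pq[OF ij(2)] sat[OF ij(2)] by (auto simp: q'_def successively_append_iff)
    have hq: "hd q = hd q'" using ij(3) by (simp add: q_def q'_def)
    have "successively (follows D ?m) p"
    proof (rule follows_cong)
      show "successively (follows D (\<tau> i)) p" using i(4) by (simp add: successively_append_iff)
      fix u x a c assume u: "u \<in> set p" "node_at D u = Decision x a c"
      then have "x \<in> A" using i(5) by (auto simp: set_path_vars)
      moreover have "x \<in> X" using vars u i(3) by auto
      ultimately show "\<tau> i x = ?m x" by (simp add: mix_def)
    qed
    moreover have "successively (follows D ?m) q'"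
    proof (rule follows_cong[OF j(3)])
      fix u x a c assume u: "u \<in> set q'" "node_at D u = Decision x a c"
      then have "x \<notin> A" using j(4) by (auto simp: set_path_vars)
      moreover have "x \<in> X" using vars u j(2) by auto
      ultimately show "\<tau> j x = ?m x" by (simp add: mix_def)
    qed
    \<comment> \<open>The edge leaving \<open>last p\<close> is chosen by a variable in
      \<open>A\<close>, so the mixture takes it as well and arrives at the shared node.\<close>
    moreover have "follows D ?m (last p) (hd q')" if "p \<noteq> []"
    proof -
      have "follows D (\<tau> i) (last p) (hd q)"
        using i(1,4) that by (simp add: successively_append_iff)
      then obtain x a c where x: "node_at D (last p) = Decision x a c"
        "hd q = (if \<tau> i x then c else a)" by (auto simp: follows_def)
      have "x \<in> A" using i(5) x(1) last_in_set[OF that] by (auto simp: set_path_vars)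
      moreover have "x \<in> X" using vars[OF _ x(1)] i(3) last_in_set[OF that] by auto
      ultimately have "?m x = \<tau> i x" by (simp add: mix_def)
      then show ?thesis using x hq by (auto simp: follows_def)
    qed
    ultimately have "successively (follows D ?m) (p @ q')"
      by (auto simp: successively_append_iff)
    then have "evaluates D ?m (hd (p @ q')) True"
      by (rule path_imp_evaluates) (use j(1,5) in auto)
    moreover have "hd (p @ q') = source D" using i(1,2) j(1) hq by (cases p) auto
    ultimately have "evaluates D ?m (source D) True" by simp
    moreover have "?m \<in> X \<rightarrow>\<^sub>E UNIV" by (simp add: mix_def)
    then have "evaluates D ?m (source D) (f ?m)"
      using assms(2) by (simp add: computes_def)
    ultimately show ?thesis using evaluates_unique[of D ?m "source D" True "f ?m"] by simp
  qed
  show ?thesis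
  proof (rule card_inj_on_le[of "\<lambda>i. hd (snd (pq i))"])
    show "inj_on (\<lambda>i. hd (snd (pq i))) I"
    proof (rule inj_onI, rule ccontr)
      fix i j assume ij: "i \<in> I" "j \<in> I" "hd (snd (pq i)) = hd (snd (pq j))" "i \<noteq> j"
      show False using mixed[OF ij(1-3)] mixed[OF ij(2,1) ij(3)[symmetric]] fool[OF ij(1,2,4)] by simp
    qed
    show "(\<lambda>i. hd (snd (pq i))) ` I \<subseteq> nodes D"
    proof (rule image_subsetI)
      fix i assume "i \<in> I"
      then have "snd (pq i) \<noteq> []" "set (snd (pq i)) \<subseteq> nodes D" using pq by auto
      then show "hd (snd (pq i)) \<in> nodes D" using hd_in_set by blast
    qed
    show "finite (nodes D)" by (rule bdd.finite_nodes[OF assms(1)])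
  qed
qed

section \<open>Diagrams from few subfunctions\<close>

text \<open>The result still takes an assignment to all variables but never looks at its values on
  \<open>A\<close>; equality of subfunctions is thus plain equality of functions.\<close>

definition subfun :: "'x set \<Rightarrow> (('x \<Rightarrow> bool) \<Rightarrow> bool) \<Rightarrow> 'x set \<Rightarrow> ('x \<Rightarrow> bool) \<Rightarrow> ('x \<Rightarrow> bool) \<Rightarrow> bool" where
  "subfun X f A \<alpha> = (\<lambda>\<beta>. f (mix X A \<alpha> \<beta>))"

lemma finite_range_subfun:
  assumes "finite X"
  shows "finite (range (subfun X f A))"
proof -
  have "subfun X f A \<alpha> = subfun X f A (restrict \<alpha> X)" for \<alpha>
    unfolding subfun_def mix_def by (intro ext arg_cong[of _ _ f] restrict_ext) auto
  then have "range (subfun X f A) \<subseteq> subfun X f A ` (X \<rightarrow>\<^sub>E UNIV)"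
    by (metis (no_types, lifting) UNIV_I image_eqI image_subsetI restrict_PiE_iff)
  then show ?thesis
    using assms by (rule finite_subset[OF _ finite_imageI[OF finite_PiE]]) auto
qed

text \<open>The order of an OBDD is strict and linear on the whole variable type, so list positions
  are extended injectively to all natural numbers, placing the other variables behind the
  list.\<close>

lemma ex_injective_position:
  fixes xs :: "nat list"
  assumes "distinct xs"
  shows "\<exists>pos. inj (pos :: nat \<Rightarrow> nat) \<and> (\<forall>i<length xs. pos (xs ! i) = i)"
proof -
  define n where "n = length xs"
  define pos where "pos = (\<lambda>x. if x \<in> set xs then inv_into {..<n} ((!) xs) x else n + x)"
  have inj: "inj_on ((!) xs) {..<n}"
    using assms by (simp add: inj_on_nth n_def)
  have img: "(!) xs ` {..<n} = set xs"
    by (auto simp: n_def set_conv_nth)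
  have "pos (xs ! i) = i" if "i < n" for i
    using that inj by (auto simp: pos_def n_def inv_into_f_f)
  moreover have "inj pos"
  proof (rule injI)
    fix x y assume e: "pos x = pos y"
    have lt: "pos z < n" if "z \<in> set xs" for z
      using inv_into_into[of z "(!) xs" "{..<n}"] that img by (simp add: pos_def)
    show "x = y"
    proof (cases "x \<in> set xs \<and> y \<in> set xs")
      case True
      then show ?thesis using e img by (simp add: pos_def) (metis inv_into_injective)
    next
      case False
      then show ?thesis
        using e lt[of x] lt[of y] by (auto simp: pos_def split: if_splits)
    qed
  qed
  ultimately show ?thesis unfolding n_def by blast
qed

text \<open>The node \<open>(i, g)\<close>, encoded as a number by \<open>e\<close>, stands for the subfunction \<open>g\<close> that remains
  after the first \<open>i\<close> variables of the list have been read.\<close>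

lemma ex_obdd_of_subfuns:
  fixes xs :: "nat list"
  assumes "distinct xs" "set xs = X"
  shows "\<exists>D :: (nat, nat) bdd_graph. obdd D \<and> computes D X f \<and>
    card (nodes D) \<le> (\<Sum>i\<le>length xs. card (range (subfun X f (set (take i xs)))))"
proof -
  define n where "n = length xs"
  have finX: "finite X" using assms(2) by auto
  define sf where "sf = (\<lambda>i. subfun X f (set (take i xs)))"
  define fix1 :: "((nat \<Rightarrow> bool) \<Rightarrow> bool) \<Rightarrow> nat \<Rightarrow> bool \<Rightarrow> (nat \<Rightarrow> bool) \<Rightarrow> bool" where
    "fix1 = (\<lambda>g x b \<beta>. g (\<beta>(x := b)))"
  define N where "N = (\<Union>i\<le>n. Pair i ` range (sf i))"
  have finN: "finite N"
    unfolding N_def sf_def using finX by (auto intro!: finite_range_subfun)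
  have cardN: "card N \<le> (\<Sum>i\<le>n. card (range (sf i)))"
  proof -
    have "card N \<le> (\<Sum>i\<le>n. card (Pair i ` range (sf i)))"
      unfolding N_def by (rule card_UN_le) simp
    also have "\<dots> = (\<Sum>i\<le>n. card (range (sf i)))"
      by (intro sum.cong card_image) (auto simp: inj_on_def)
    finally show ?thesis .
  qed
  obtain e :: "nat \<times> ((nat \<Rightarrow> bool) \<Rightarrow> bool) \<Rightarrow> nat" where e: "inj_on e N"
    using finite_imp_inj_to_nat_seg[OF finN] by blast
  define d where "d = inv_into N e"
  have d: "d (e z) = z" if "z \<in> N" for z
    using e that by (simp add: d_def)
  define D :: "(nat, nat) bdd_graph" where
    "D = \<lparr>nodes = e ` N, source = e (0, sf 0 undefined),
      node_at = (\<lambda>v. case d v of (i, g) \<Rightarrow> if i < n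
        then Decision (xs ! i) (e (Suc i, fix1 g (xs ! i) False)) (e (Suc i, fix1 g (xs ! i) True))
        else Sink (g (\<lambda>_. False)))\<rparr>"
  have inN: "(i, sf i \<alpha>) \<in> N" if "i \<le> n" for i \<alpha>
    using that by (auto simp: N_def)
  have Ncase: "\<exists>i \<alpha>. i \<le> n \<and> z = (i, sf i \<alpha>)" if "z \<in> N" for z
    using that by (auto simp: N_def)
  \<comment> \<open>Fixing the next variable yields a subfunction for the longer prefix, that of the
    updated \<alpha>. Hence edges stay inside \<open>N\<close>.\<close>
  have fix1: "fix1 (sf i \<alpha>) (xs ! i) b = sf (Suc i) (\<alpha>(xs ! i := b))" if "i < n" for i \<alpha> b
  proof -
    have "xs ! i \<notin> set (take i xs)"
      using that assms(1) by (auto simp: in_set_conv_nth n_def distinct_conv_nth)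
    moreover have "set (take (Suc i) xs) = insert (xs ! i) (set (take i xs))"
      using that by (simp add: take_Suc_conv_app_nth n_def)
    ultimately show ?thesis
      unfolding fix1_def sf_def subfun_def mix_def
      by (intro ext arg_cong[of _ _ f] restrict_ext) auto
  qed
  \<comment> \<open>Before any variable is read there is only one subfunction, so level 0 is the
    source alone.\<close>
  have sf0: "sf 0 \<alpha> = sf 0 \<beta>" for \<alpha> \<beta>
    by (simp add: sf_def subfun_def mix_def)
  have sfn: "sf n \<alpha> \<beta> = f (restrict \<alpha> X)" for \<alpha> \<beta>
    unfolding sf_def subfun_def mix_def n_def using assms(2)
    by (simp, intro arg_cong[of _ _ f] restrict_ext) auto
  have nodesD: "nodes D = e ` N" and sourceD: "source D = e (0, sf 0 \<alpha>)" for \<alpha>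
    using sf0[of undefined \<alpha>] by (simp_all add: D_def)
  have dec: "node_at D (e (i, sf i \<alpha>)) = Decision (xs ! i)
      (e (Suc i, sf (Suc i) (\<alpha>(xs ! i := False)))) (e (Suc i, sf (Suc i) (\<alpha>(xs ! i := True))))"
    if "i < n" for i \<alpha>
    using that d[OF inN[of i \<alpha>]] fix1[OF that] by (simp add: D_def)
  have snk: "node_at D (e (n, sf n \<alpha>)) = Sink (f (restrict \<alpha> X))" for \<alpha>
    using d[OF inN[of n \<alpha>]] by (simp add: D_def sfn)
  have edge: "(e (i, sf i \<alpha>), w) \<in> edges D \<longleftrightarrow>
      i < n \<and> (\<exists>b. w = e (Suc i, sf (Suc i) (\<alpha>(xs ! i := b))))" if "i \<le> n" for i \<alpha> w
  proof (cases "i < n")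
    case True
    then show ?thesis
      using dec[OF True, of \<alpha>] inN[OF that, of \<alpha>]
      by (auto simp: edges_def nodesD intro: exI[of _ True] exI[of _ False]) (metis (full_types))
  next
    case False
    then have "i = n" using that by simp
    then show ?thesis using snk[of \<alpha>] by (simp add: edges_def)
  qed
  \<comment> \<open>Every edge raises the level by exactly one. Acyclicity, the uniqueness of the
    source and the order of the labels on a path all follow from this.\<close>
  define lev where "lev = (\<lambda>v. fst (d v))"
  have lev: "lev (e (i, sf i \<alpha>)) = i" if "i \<le> n" for i \<alpha>
    using d[OF inN[OF that]] by (simp add: lev_def)
  have nodeE: "\<exists>i \<alpha>. i \<le> n \<and> v = e (i, sf i \<alpha>)" if v: "v \<in> nodes D" for v
  proof -
    obtain z where "z \<in> N" "v = e z" using v unfolding nodesD by blast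
    then show ?thesis using Ncase[of z] by auto
  qed
  have edges_nodes: "v \<in> nodes D" if "(v, w) \<in> edges D" for v w
    using that by (auto simp: edges_def)
  have edge_lev: "lev w = Suc (lev v) \<and> w \<in> nodes D" if vw: "(v, w) \<in> edges D" for v w
  proof -
    obtain i \<alpha> where i: "i \<le> n" "v = e (i, sf i \<alpha>)" using nodeE[OF edges_nodes[OF vw]] by blast
    then have "i < n" and "\<exists>b. w = e (Suc i, sf (Suc i) (\<alpha>(xs ! i := b)))"
      using edge[OF i(1)] vw by auto
    then show ?thesis using i lev[of i] lev[of "Suc i"] inN[of "Suc i"] by (auto simp: nodesD)
  qed
  have bdd: "bdd D"
  proof
    show "finite (nodes D)" using finN by (simp add: nodesD)
    show "source D \<in> nodes D" using inN[of 0] by (auto simp: nodesD sourceD[of undefined])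
    show "edges D \<subseteq> nodes D \<times> nodes D" using edges_nodes edge_lev by auto
    show "acyclic (edges D)"
    proof -
      have "lev v < lev w" if "(v, w) \<in> (edges D)\<^sup>+" for v w
        using that by (induction rule: trancl_induct) (use edge_lev in fastforce)+
      then show ?thesis unfolding acyclic_def by blast
    qed
    show "(\<forall>u. (u, v) \<notin> edges D) \<longleftrightarrow> v = source D" if v: "v \<in> nodes D" for v
    proof -
      obtain i \<alpha> where i: "i \<le> n" "v = e (i, sf i \<alpha>)" using nodeE[OF v] by blast
      show ?thesis
      proof (cases i)
        case 0
        have "(u, v) \<notin> edges D" for u
          using edge_lev[of u v] lev[of 0 \<alpha>] i 0 by auto
        then show ?thesis using i 0 sourceD by auto
      next
        case (Suc j)
        \<comment> \<open>The edge for the value that \<alpha> itself gives to the variable leads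
          here, since that update leaves \<alpha> unchanged.\<close>
        have "(e (j, sf j \<alpha>), v) \<in> edges D"
          using edge[of j \<alpha> v] i Suc by (auto intro!: exI[of _ "\<alpha> (xs ! j)"])
        moreover have "v \<noteq> source D"
          using lev[of 0 \<alpha>] lev[OF i(1), of \<alpha>] i(2) Suc sourceD[of \<alpha>] by auto
        ultimately show ?thesis by blast
      qed
    qed
    have "e (n, sf n undefined) \<in> sinks D"
      using snk inN[of n] by (auto simp: sinks_def nodesD)
    then show "sinks D \<noteq> {}" by blast
    \<comment> \<open>On the last level subfunctions are constant, so equal sink labels mean equal
      subfunctions and equal nodes.\<close>
    show "inj_on (node_at D) (sinks D)"
    proof (rule inj_onI)
      have s: "\<exists>\<alpha>. v = e (n, sf n \<alpha>)" if "v \<in> sinks D" for v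
      proof -
        obtain i \<alpha> b where i: "i \<le> n" "v = e (i, sf i \<alpha>)" "node_at D v = Sink b"
          using nodeE[of v] \<open>v \<in> sinks D\<close> by (auto simp: sinks_def)
        have "\<not> i < n"
        proof
          assume "i < n"
          from dec[OF this, of \<alpha>] i(2,3) show False by simp
        qed
        then have "i = n" using i(1) by linarith
        then show ?thesis using i(2) by (intro exI[of _ \<alpha>]) simp
      qed
      fix v w assume vw: "v \<in> sinks D" "w \<in> sinks D" "node_at D v = node_at D w"
      obtain \<alpha> where "v = e (n, sf n \<alpha>)" using s[OF vw(1)] by (rule exE)
      moreover obtain \<beta> where "w = e (n, sf n \<beta>)" using s[OF vw(2)] by (rule exE)
      moreover from calculation have "f (restrict \<alpha> X) = f (restrict \<beta> X)" using vw snk by simp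
      then have "sf n \<alpha> = sf n \<beta>" by (simp add: fun_eq_iff sfn)
      ultimately show "v = w" by simp
    qed
  qed
  obtain pos :: "nat \<Rightarrow> nat" where pos: "inj pos" "\<forall>i<n. pos (xs ! i) = i"
    using ex_injective_position[OF assms(1)] n_def by blast
  define r where "r = {(x, y). pos x < pos y}"
  have r: "strict_linear_order r"
    using pos(1) by (auto simp: strict_linear_order_on_def r_def trans_def irrefl_def total_on_def
        dest: injD intro: linorder_neqE_nat)
  have label: "x = xs ! lev v \<and> lev v < n" if v: "v \<in> nodes D" "node_at D v = Decision x a c" for v x a c
  proof -
    obtain i \<alpha> where i: "i \<le> n" "v = e (i, sf i \<alpha>)" using nodeE[OF v(1)] by blast
    then show ?thesis using v(2) dec[of i \<alpha>] snk[of \<alpha>] lev[OF i(1), of \<alpha>]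
      by (cases "i < n") auto
  qed
  have srt: "(\<forall>y\<in>set (path_vars D p). lev (hd p) \<le> pos y) \<and>
      sorted_wrt (\<lambda>x y. (x, y) \<in> r) (path_vars D p)"
    if "successively (\<lambda>u v. (u, v) \<in> edges D) p" "p \<noteq> []" "hd p \<in> nodes D" for p
    using that
  proof (induction p)
    case (Cons v p)
    show ?case
    proof (cases p)
      case Nil
      then show ?thesis using Cons.prems label[of v] pos(2)
        by (auto simp: path_vars_Cons split: bdd_node.splits)
    next
      case (Cons w q)
      have vw: "(v, w) \<in> edges D" using Cons.prems(1) Cons by simp
      then have w: "lev w = Suc (lev v)" "w \<in> nodes D" using edge_lev by auto
      have IH: "(\<forall>y\<in>set (path_vars D p). lev w \<le> pos y) \<and>
          sorted_wrt (\<lambda>x y. (x, y) \<in> r) (path_vars D p)"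
        using Cons.IH Cons.prems Cons w by simp
      obtain x a c where x: "node_at D v = Decision x a c"
        using vw by (auto simp: edges_def)
      have "x = xs ! lev v" "lev v < n" using label[OF _ x] Cons.prems(3) by auto
      then have "pos x = lev v" using pos(2) by simp
      then show ?thesis using IH x w by (fastforce simp: path_vars_Cons r_def)
    qed
  qed simp
  have "obdd D"
    unfolding obdd_def
  proof (intro conjI exI[of _ r] allI impI bdd r)
    fix p assume "source_sink_path D p"
    then show "sorted_wrt (\<lambda>x y. (x, y) \<in> r) (path_vars D p)"
      using srt[of p] bdd.source_in_nodes[OF bdd] by (simp add: source_sink_path_def)
  qed
  moreover have "computes D X f"
    unfolding computes_def
  proof (intro conjI ballI)
    show "bdd_vars D \<subseteq> X"
    proof
      fix x assume "x \<in> bdd_vars D"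
      then obtain v a c where "v \<in> nodes D" "node_at D v = Decision x a c"
        unfolding bdd_vars_def by blast
      from label[OF this] show "x \<in> X"
        unfolding assms(2)[symmetric] n_def by (metis nth_mem)
    qed
    fix \<alpha> :: "nat \<Rightarrow> bool" assume \<alpha>: "\<alpha> \<in> X \<rightarrow>\<^sub>E UNIV"
    then have res: "restrict \<alpha> X = \<alpha>" by (rule PiE_restrict)
    have "evaluates D \<alpha> (e (n - k, sf (n - k) \<alpha>)) (f \<alpha>)" if "k \<le> n" for k
      using that
    proof (induction k)
      case 0
      then show ?case using snk[of \<alpha>] res by (auto intro: evaluates.sink)
    next
      case (Suc k)
      define i where "i = n - Suc k"
      have i: "i < n" "n - k = Suc i" using Suc.prems by (auto simp: i_def)
      have "evaluates D \<alpha> (if \<alpha> (xs ! i) then e (Suc i, sf (Suc i) (\<alpha>(xs ! i := True)))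
          else e (Suc i, sf (Suc i) (\<alpha>(xs ! i := False)))) (f \<alpha>)"
      proof -
        have "\<alpha>(xs ! i := True) = \<alpha>" if "\<alpha> (xs ! i)" using that by (simp add: fun_eq_iff)
        moreover have "\<alpha>(xs ! i := False) = \<alpha>" if "\<not> \<alpha> (xs ! i)" using that by (simp add: fun_eq_iff)
        ultimately show ?thesis using Suc i by simp
      qed
      then show ?case
        using evaluates.decision[OF dec[OF i(1)]] by (simp add: i_def)
    qed
    from this[of n] show "evaluates D \<alpha> (source D) (f \<alpha>)" by (simp add: sourceD[of \<alpha>])
  qed
  moreover have "card (nodes D) \<le> (\<Sum>i\<le>length xs. card (range (subfun X f (set (take i xs)))))"
    using cardN card_image_le[OF finN, of e] by (simp add: nodesD n_def sf_def)
  ultimately show ?thesis by blast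
qed

lemma obdd_size_le:
  fixes xs :: "nat list"
  assumes "distinct xs" "set xs = X"
  shows "obdd_size X f \<le> (\<Sum>i\<le>length xs. card (range (subfun X f (set (take i xs)))))"
proof -
  obtain D :: "(nat, nat) bdd_graph" where D: "obdd D" "computes D X f"
    "card (nodes D) \<le> (\<Sum>i\<le>length xs. card (range (subfun X f (set (take i xs)))))"
    using ex_obdd_of_subfuns[OF assms] by blast
  have "obdd_size X f \<le> card (nodes D)"
    unfolding obdd_size_def by (rule Least_le) (use D in blast)
  then show ?thesis using D(3) by simp
qed

lemma obdd_size_attained:
  fixes X :: "nat set"
  assumes "finite X"
  obtains D :: "(nat, nat) bdd_graph" where "obdd D" "computes D X f" "card (nodes D) = obdd_size X f"
proof -
  obtain xs where "distinct xs" "set xs = X" using assms finite_distinct_list by blast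
  then obtain D :: "(nat, nat) bdd_graph" where "obdd D" "computes D X f"
    using ex_obdd_of_subfuns by blast
  then have "\<exists>s. \<exists>D :: (nat, nat) bdd_graph. obdd D \<and> computes D X f \<and> card (nodes D) = s"
    by blast
  from LeastI_ex[OF this] show ?thesis
    using that unfolding obdd_size_def by blast
qed

text \<open>A single sink computes the function, and no diagram is smaller since it contains its
  source. This turns unsatisfiability into size exactly 1.\<close>

lemma obdd_size_const_False:
  fixes X :: "nat set"
  assumes "finite X" "\<And>\<alpha>. \<not> f \<alpha>"
  shows "obdd_size X f = 1"
proof (rule antisym)
  define D :: "(nat, nat) bdd_graph" where
    "D = \<lparr>nodes = {0}, source = 0, node_at = (\<lambda>_. Sink False)\<rparr>"
  have edges: "edges D = {}" and sinks: "sinks D = {0}"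
    by (auto simp: D_def edges_def sinks_def)
  have "bdd D"
    by unfold_locales (simp_all add: edges sinks acyclic_def, simp_all add: D_def)
  moreover have "strict_linear_order {(x, y :: nat). x < y}"
    by (auto simp: strict_linear_order_on_def trans_def irrefl_def total_on_def)
  moreover have "path_vars D p = []" for p
    by (induction p) (simp_all add: path_vars_Cons, simp add: D_def)
  ultimately have "obdd D" unfolding obdd_def by auto
  moreover have "computes D X f"
    unfolding computes_def using assms(2)
    by (auto simp: bdd_vars_def D_def intro!: evaluates.sink)
  moreover have "card (nodes D) = 1" by (simp add: D_def)
  ultimately show "obdd_size X f \<le> 1"
    unfolding obdd_size_def by (intro Least_le) blast
  obtain D' :: "(nat, nat) bdd_graph" where D': "obdd D'" "card (nodes D') = obdd_size X f"
    using obdd_size_attained[OF assms(1)] by blast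
  then interpret D': bdd D' by (simp add: obdd_def)
  have "card (nodes D') \<noteq> 0" using D'.finite_nodes D'.source_in_nodes by auto
  then show "1 \<le> obdd_size X f" using D'(2) by simp
qed

subsection \<open>Implications, bicycles and fooling sets\<close>

abbreviation reach :: "'x cnf \<Rightarrow> 'x literal \<Rightarrow> 'x literal \<Rightarrow> bool" where
  "reach F \<equiv> (link False F)\<^sup>*\<^sup>*"

lemma link_False_iff: "link False F u v \<longleftrightarrow> {neg u, v} \<in> F"
  by (simp add: link_def link_clauses_def)

lemma link_contra: "link False F u v \<Longrightarrow> link False F (neg v) (neg u)"
  by (simp add: link_False_iff insert_commute)

lemma reach_contra: "reach F u v \<Longrightarrow> reach F (neg v) (neg u)"
  by (induction rule: rtranclp_induct) (auto dest: link_contra intro: converse_rtranclp_into_rtranclp)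

lemma link_vars:
  assumes "link b F u v" "F \<subseteq> two_clauses X"
  shows "lit_var u \<in> X \<and> lit_var v \<in> X \<and> lit_var u \<noteq> lit_var v"
  using assms by (fastforce simp: link_def link_clauses_def split: if_splits)

text \<open>\<open>L\<close> is consistent and closed under implication. While a variable is
  undecided, one of its two literals does not imply its own negation, and adding all its
  consequences keeps \<open>L\<close> consistent. When everything is decided, closure under
  implication satisfies every clause.\<close>

lemma extend_to_satisfying:
  assumes "finite X" "F \<subseteq> two_clauses X"
    and nocontra: "\<And>l. \<not> (reach F l (neg l) \<and> reach F (neg l) l)"
    and "L \<subseteq> lits X" "\<And>u v. u \<in> L \<Longrightarrow> link False F u v \<Longrightarrow> v \<in> L" "\<And>u. u \<in> L \<Longrightarrow> neg u \<notin> L"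
  shows "\<exists>\<alpha>. satisfies \<alpha> F \<and> (\<forall>l\<in>L. lit_holds \<alpha> l)"
  using assms(4-)
proof (induction "card (lits X - L)" arbitrary: L rule: less_induct)
  case less
  show ?case
  proof (cases "\<exists>l\<in>lits X. l \<notin> L \<and> neg l \<notin> L")
    case True
    then obtain l where l: "l \<in> lits X" "l \<notin> L" "neg l \<notin> L" "\<not> reach F l (neg l)"
      using nocontra by (metis neg_in_lits neg_neg)
    define M where "M = L \<union> {v. reach F l v}"
    have LM: "v \<in> L" if "u \<in> L" "reach F u v" for u v
      using that(2,1) by (induction rule: rtranclp_induct) (auto intro: less.prems(2))
    have "v \<in> lits X" if "reach F l v" for v
      using that by (induction rule: rtranclp_induct)
        (use l(1) link_vars[OF _ assms(2)] in \<open>auto simp: lits_def\<close>)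
    then have sub: "M \<subseteq> lits X" using less.prems(1) by (auto simp: M_def)
    have clo: "v \<in> M" if "u \<in> M" "link False F u v" for u v
      using that less.prems(2) by (auto simp: M_def intro: rtranclp.rtrancl_into_rtrancl)
    have con: "neg u \<notin> M" if "u \<in> M" for u
    proof
      assume nu: "neg u \<in> M"
      \<comment> \<open>If \<open>l\<close> forced some \<open>w\<close> whose negation is in
        \<open>L\<close> already, contraposition would put \<open>neg l\<close> into the closed set
        \<open>L\<close>.\<close>
      have 1: False if "reach F l w" "neg w \<in> L" for w
        using LM[OF that(2) reach_contra[OF that(1)]] l(3) by simp
      have 2: False if "reach F l u" "reach F l (neg u)"
        using reach_contra[OF that(2)] that(1) l(4) by (metis neg_neg rtranclp_trans)
      show False
        using \<open>u \<in> M\<close> nu 1[of u] 1[of "neg u"] 2 less.prems(3) by (auto simp: M_def)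
    qed
    have "l \<in> M" by (simp add: M_def)
    then have "lits X - M \<subset> lits X - L" using l by (auto simp: M_def)
    then have "card (lits X - M) < card (lits X - L)"
      using assms(1) by (intro psubset_card_mono) auto
    then have "\<exists>\<alpha>. satisfies \<alpha> F \<and> (\<forall>l\<in>M. lit_holds \<alpha> l)"
      by (rule less.hyps[OF _ sub]) (use clo con in blast)+
    then show ?thesis by (auto simp: M_def)
  next
    case False
    define \<alpha> where "\<alpha> = (\<lambda>x. Pos x \<in> L)"
    have holds: "lit_holds \<alpha> l" if "l \<in> L" for l
      using that less.prems(3)[of l] by (cases l) (auto simp: \<alpha>_def)
    have "\<exists>l\<in>C. lit_holds \<alpha> l" if C: "C \<in> F" for C
    proof -
      obtain a b where ab: "C = {a, b}" "lit_var a \<in> X"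
        using C assms(2) two_clauses_iff[of C X] by blast
      show ?thesis
      proof (cases "neg a \<in> L")
        case True
        then have "b \<in> L" using less.prems(2)[of "neg a" b] C ab by (simp add: link_False_iff)
        then show ?thesis using holds ab by auto
      next
        case False
        then have "a \<in> L" using \<open>\<not> (\<exists>l\<in>lits X. l \<notin> L \<and> neg l \<notin> L)\<close> ab(2)
          by (auto simp: lits_def)
        then show ?thesis using holds ab by auto
      qed
    qed
    then show ?thesis using holds by (auto simp: satisfies_def)
  qed
qed

lemma reach_imp_distinct_path:
  assumes "reach F l u"
  shows "\<exists>us. us \<noteq> [] \<and> hd us = l \<and> last us = u \<and> distinct us \<and> successively (link False F) us"
  using assms
proof (induction rule: rtranclp_induct)
  case base
  show ?case by (intro exI[of _ "[l]"]) simp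
next
  case (step u w)
  then obtain us where us: "us \<noteq> []" "hd us = l" "last us = u" "distinct us"
    "successively (link False F) us" by blast
  show ?case
  proof (cases "w \<in> set us")
    case True
    then obtain xs ys where "us = xs @ w # ys" by (meson split_list)
    then show ?thesis using us
      by (intro exI[of _ "xs @ [w]"]) (auto simp: successively_append_iff hd_append)
  next
    case False
    then show ?thesis using us step(2)
      by (intro exI[of _ "us @ [w]"]) (auto simp: successively_append_iff)
  qed
qed

section \<open>Obstructions to consistent propagation\<close>

text \<open>A simple implication path that runs into the negation of one of its own literals: the
  first obstacle that propagation along a path can meet.\<close>

definition lollipop :: "'x cnf \<Rightarrow> 'x literal list \<Rightarrow> bool" where
  "lollipop F us \<longleftrightarrow> us \<noteq> [] \<and> litpath False F us \<and> (\<exists>i<length us. link False F (last us) (neg (us ! i)))"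

text \<open>On a path with distinct literals, a variable can come back for the first time only
  through the negation of an earlier literal, and this closes a lollipop.\<close>

lemma distinct_path_cases:
  assumes "distinct us" "us \<noteq> []" "successively (link False F) us"
  shows "litpath False F us \<or> (\<exists>vs. lollipop F vs \<and> hd vs = hd us)"
  using assms
proof (induction us rule: rev_induct)
  case (snoc w us)
  show ?case
  proof (cases "us = []")
    case True
    then show ?thesis by (simp add: litpath_def)
  next
    case False
    then have IH: "litpath False F us \<or> (\<exists>vs. lollipop F vs \<and> hd vs = hd us)"
      using snoc by (auto simp: successively_append_iff)
    have lnk: "link False F (last us) w"
      using snoc.prems(3) False by (simp add: successively_append_iff)
    show ?thesis
    proof (cases "litpath False F us")
      case True
      show ?thesis
      proof (cases "lit_var w \<in> lit_var ` set us")
        case True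
        then obtain i where i: "i < length us" "lit_var w = lit_var (us ! i)"
          by (auto simp: in_set_conv_nth)
        have "w \<notin> set us" using snoc.prems(1) by simp
        then have "w \<noteq> us ! i" using i(1) by auto
        then have "w = neg (us ! i)" using lit_var_eqD[OF i(2)] by auto
        then have "lollipop F us"
          using i(1) lnk False \<open>litpath False F us\<close> unfolding lollipop_def by blast
        then show ?thesis using False by auto
      next
        case False
        then have "litpath False F (us @ [w])"
          using \<open>litpath False F us\<close> snoc.prems(3) by (simp add: litpath_def)
        then show ?thesis by blast
      qed
    next
      case False
      then show ?thesis using IH \<open>us \<noteq> []\<close> by auto
    qed
  qed
qed simp

lemma lollipop_of_contra:
  assumes "reach F l (neg l)"
  shows "\<exists>vs. lollipop F vs \<and> hd vs = l"
proof -
  obtain us where us: "us \<noteq> []" "hd us = l" "last us = neg l" "distinct us"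
    "successively (link False F) us"
    using reach_imp_distinct_path[OF assms] by blast
  have "\<not> litpath False F us"
  proof
    assume "litpath False F us"
    then have "inj_on lit_var (set us)" by (simp add: litpath_def distinct_map)
    moreover have "l \<in> set us" "neg l \<in> set us" using us(1-3) by (metis hd_in_set last_in_set)+
    ultimately show False using inj_onD[of lit_var "set us" l "neg l"] by simp
  qed
  then show ?thesis using distinct_path_cases[OF us(4,1,5)] us(2) by auto
qed

text \<open>The predecessors in \<open>qs\<close> are put in front one by one, from the last to the
  first, as long as they bring new variables; the one that does not is \<open>y\<close>.\<close>

lemma bicycle_extend:
  assumes "successively (link False F) (qs @ vs)" "vs \<noteq> []" "litpath False F vs"
    "\<exists>q\<in>set qs. lit_var q \<in> lit_var ` set vs"
  shows "\<exists>qs' y. litpath False F (qs' @ vs) \<and> link False F y (hd (qs' @ vs)) \<and>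
    lit_var y \<in> lit_var ` set (qs' @ vs)"
  using assms
proof (induction qs arbitrary: vs rule: rev_induct)
  case (snoc q qs)
  have lnk: "link False F q (hd vs)"
    using snoc.prems(1,2) by (cases vs) (simp_all add: successively_append_iff)
  show ?case
  proof (cases "lit_var q \<in> lit_var ` set vs")
    case True
    then show ?thesis using lnk snoc.prems by (intro exI[of _ "[]"] exI[of _ q]) auto
  next
    case False
    have succ: "successively (link False F) (qs @ (q # vs))"
      using snoc.prems(1) by simp
    have "litpath False F (q # vs)"
      using False snoc.prems(2,3) lnk by (cases vs) (auto simp: litpath_def)
    from snoc.IH[OF succ _ this] obtain qs' y where
      "litpath False F (qs' @ q # vs)" "link False F y (hd (qs' @ q # vs))"
      "lit_var y \<in> lit_var ` set (qs' @ q # vs)"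
      using snoc.prems(4) False by auto
    then show ?thesis by (intro exI[of _ "qs' @ [q]"] exI[of _ y]) simp
  qed
qed simp

text \<open>A simple implication path with both ends hooked onto its own variables, as known from
  the satisfiability threshold of random 2-CNFs. It has one more clause than literals, which makes
  it rare when each literal implies fewer than one other on average.\<close>

definition bicycle :: "'x cnf \<Rightarrow> 'x literal list \<Rightarrow> 'x literal \<Rightarrow> 'x literal \<Rightarrow> bool" where
  "bicycle F ws y z \<longleftrightarrow> ws \<noteq> [] \<and> litpath False F ws \<and> link False F y (hd ws) \<and>
     link False F (last ws) z \<and> lit_var y \<in> lit_var ` set ws \<and> neg z \<in> set ws"

text \<open>The implication from \<open>l\<close> to its negation gives a lollipop, whose stick end
  is the end \<open>z\<close>. The path back, followed backwards from \<open>l\<close>, meets a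
  variable of the lollipop at the latest in \<open>neg l\<close>, which gives
  \<open>y\<close>.\<close>

lemma bicycle_of_contra:
  assumes "reach F l (neg l)" "reach F (neg l) l"
  shows "\<exists>ws y z. bicycle F ws y z"
proof -
  obtain vs where vs: "lollipop F vs" "hd vs = l"
    using lollipop_of_contra[OF assms(1)] by blast
  then obtain i where i: "vs \<noteq> []" "litpath False F vs" "i < length vs"
    "link False F (last vs) (neg (vs ! i))" by (auto simp: lollipop_def)
  obtain ps where ps: "ps \<noteq> []" "hd ps = neg l" "last ps = l" "successively (link False F) ps"
    using reach_imp_distinct_path[OF assms(2)] by blast
  then obtain qs where qs: "ps = qs @ [l]" by (metis append_butlast_last_id)
  then obtain q qs2 where q: "qs = q # qs2" "q = neg l" using ps(2) by (cases qs) auto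
  obtain vs' where vs': "vs = l # vs'" using vs(2) i(1) by (cases vs) auto
  have "successively (link False F) (qs @ vs)"
    using ps(4) i(2) unfolding qs vs' litpath_def by (auto simp: successively_append_iff)
  moreover have "\<exists>q\<in>set qs. lit_var q \<in> lit_var ` set vs"
    using q vs' by auto
  ultimately obtain qs' y where y: "litpath False F (qs' @ vs)" "link False F y (hd (qs' @ vs))"
    "lit_var y \<in> lit_var ` set (qs' @ vs)"
    using bicycle_extend[of F qs vs] i(1,2) by blast
  have "bicycle F (qs' @ vs) y (neg (vs ! i))"
    using y i unfolding bicycle_def by simp
  then show ?thesis by blast
qed

text \<open>Both alternatives are explicit clause patterns starting at \<open>l\<close>, so the
  number of bad literals has a first moment bound. Their absence keeps everything that
  \<open>l\<close> implies within primal distance k.\<close>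

definition bad_lit :: "'x cnf \<Rightarrow> nat \<Rightarrow> 'x literal \<Rightarrow> bool" where
  "bad_lit F k l \<longleftrightarrow> (\<exists>us. us \<noteq> [] \<and> hd us = l \<and>
     (litpath False F us \<and> length us = Suc k \<or> lollipop F us \<and> length us \<le> k))"

lemma litpath_take: "litpath b F us \<Longrightarrow> litpath b F (take m us)"
  unfolding litpath_def
  by (auto simp: take_map[symmetric] successively_conv_nth)

text \<open>The length limits in \<open>bad_lit\<close> come for free: anything longer starts with a
  path of \<open>Suc k\<close> literals from the same \<open>l\<close>.\<close>

lemma not_bad_lit:
  assumes "\<not> bad_lit F k l"
  shows "litpath False F us \<Longrightarrow> us \<noteq> [] \<Longrightarrow> hd us = l \<Longrightarrow> length us \<le> k"
    and "lollipop F us \<Longrightarrow> hd us \<noteq> l"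
    and "\<not> reach F l (neg l)"
proof -
  show 1: "length us \<le> k" if us: "litpath False F us" "us \<noteq> []" "hd us = l" for us
  proof (rule ccontr)
    assume "\<not> length us \<le> k"
    then have "length (take (Suc k) us) = Suc k" by simp
    moreover have "litpath False F (take (Suc k) us)" by (rule litpath_take[OF us(1)])
    moreover have "take (Suc k) us \<noteq> []" "hd (take (Suc k) us) = l"
      using us by (auto simp: hd_conv_nth)
    ultimately show False using assms unfolding bad_lit_def by blast
  qed
  show 2: "hd us \<noteq> l" if us: "lollipop F us" for us
  proof
    assume "hd us = l"
    moreover from this have "length us \<le> k" using 1 us by (auto simp: lollipop_def)
    ultimately show False using assms us unfolding bad_lit_def lollipop_def by blast
  qed
  show "\<not> reach F l (neg l)" using 2 lollipop_of_contra by blast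
qed

section \<open>Balls in the primal graph and the choice of independent clauses\<close>

text \<open>The closed neighbourhood in the primal graph; its iterate \<open>nbhd F ^^ j\<close> is
  the ball of radius j.\<close>

definition nbhd :: "'x cnf \<Rightarrow> 'x set \<Rightarrow> 'x set" where
  "nbhd F S = S \<union> \<Union>(clause_vars ` {C \<in> F. clause_vars C \<inter> S \<noteq> {}})"

lemma nbhd_mono: "S \<subseteq> T \<Longrightarrow> nbhd F S \<subseteq> nbhd F T"
  by (auto simp: nbhd_def)

lemma nbhd_pow_mono: "S \<subseteq> T \<Longrightarrow> (nbhd F ^^ j) S \<subseteq> (nbhd F ^^ j) T"
  by (induction j) (auto dest: nbhd_mono[of _ _ F])

lemma nbhd_pow_increasing: "i \<le> j \<Longrightarrow> (nbhd F ^^ i) S \<subseteq> (nbhd F ^^ j) S"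
proof (induction j rule: dec_induct)
  case (step j)
  then show ?case by (auto simp: nbhd_def)
qed simp

lemma nbhd_iff:
  "x \<in> nbhd F S \<longleftrightarrow> x \<in> S \<or> (\<exists>C y. C \<in> F \<and> y \<in> clause_vars C \<and> y \<in> S \<and> x \<in> clause_vars C)"
  by (auto simp: nbhd_def)

lemma nbhd_pow_sym:
  assumes "x \<in> (nbhd F ^^ j) S"
  shows "\<exists>s\<in>S. s \<in> (nbhd F ^^ j) {x}"
  using assms
proof (induction j arbitrary: x)
  case (Suc j)
  have "x \<in> nbhd F ((nbhd F ^^ j) S)" using Suc.prems by simp
  then consider "x \<in> (nbhd F ^^ j) S"
    | C y where "C \<in> F" "y \<in> clause_vars C" "y \<in> (nbhd F ^^ j) S" "x \<in> clause_vars C"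
    unfolding nbhd_iff by blast
  then show ?case
  proof cases
    case 1
    then obtain s where "s \<in> S" "s \<in> (nbhd F ^^ j) {x}" using Suc.IH by blast
    then show ?thesis using nbhd_pow_increasing[of j "Suc j" F "{x}"] by auto
  next
    case 2
    then obtain s where s: "s \<in> S" "s \<in> (nbhd F ^^ j) {y}" using Suc.IH by blast
    have "{y} \<subseteq> nbhd F {x}" using 2 by (auto simp: nbhd_def)
    then have "(nbhd F ^^ j) {y} \<subseteq> (nbhd F ^^ j) (nbhd F {x})" by (rule nbhd_pow_mono)
    then have "s \<in> (nbhd F ^^ Suc j) {x}" using s(2) by (auto simp: funpow_swap1)
    then show ?thesis using s(1) by blast
  qed
qed simp

lemma card_incident_le:
  assumes "finite F" "finite S" "\<And>x. card {C \<in> F. x \<in> clause_vars C} \<le> d"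
  shows "card {C \<in> F. clause_vars C \<inter> S \<noteq> {}} \<le> d * card S"
proof -
  have "{C \<in> F. clause_vars C \<inter> S \<noteq> {}} = (\<Union>x\<in>S. {C \<in> F. x \<in> clause_vars C})" by auto
  then have "card {C \<in> F. clause_vars C \<inter> S \<noteq> {}} \<le> (\<Sum>x\<in>S. card {C \<in> F. x \<in> clause_vars C})"
    using card_UN_le[OF assms(2)] by simp
  also have "\<dots> \<le> (\<Sum>x\<in>S. d)" by (intro sum_mono assms(3))
  finally show ?thesis by (simp add: mult.commute)
qed

lemma clause_vars_two_clause:
  assumes "C \<in> two_clauses X"
  shows "finite (clause_vars C)" "card (clause_vars C) = 2"
  using assms by (auto simp: two_clauses_iff clause_vars_def)

text \<open>A variable lies in at most d clauses with two variables each, so one step multiplies the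
  size by at most 2 d + 1.\<close>

lemma card_nbhd_pow:
  assumes "finite F" "F \<subseteq> two_clauses X" "\<And>x. card {C \<in> F. x \<in> clause_vars C} \<le> d" "finite S"
  shows "finite ((nbhd F ^^ j) S) \<and> card ((nbhd F ^^ j) S) \<le> (2 * d + 1) ^ j * card S"
proof (induction j)
  case (Suc j)
  define T where "T = (nbhd F ^^ j) S"
  have T: "finite T" "card T \<le> (2 * d + 1) ^ j * card S" using Suc by (simp_all add: T_def)
  let ?I = "{C \<in> F. clause_vars C \<inter> T \<noteq> {}}"
  have fin: "finite (clause_vars C)" if "C \<in> F" for C
    using that assms(2) clause_vars_two_clause by blast
  have two: "card (clause_vars C) = 2" if "C \<in> F" for C
    using that assms(2) clause_vars_two_clause(2) by blast
  have "card (\<Union>(clause_vars ` ?I)) \<le> (\<Sum>C\<in>?I. card (clause_vars C))"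
    using assms(1) by (intro card_UN_le) auto
  also have "\<dots> = (\<Sum>C\<in>?I. 2)"
    using two by (intro sum.cong) auto
  also have "\<dots> \<le> 2 * (d * card T)"
    using card_incident_le[OF assms(1) T(1) assms(3)] by simp
  finally have "card (nbhd F T) \<le> (2 * d + 1) * card T"
    unfolding nbhd_def using card_Un_le[of T "\<Union>(clause_vars ` ?I)"] by simp
  also have "\<dots> \<le> (2 * d + 1) * ((2 * d + 1) ^ j * card S)"
    by (rule mult_le_mono2[OF T(2)])
  finally have "card (nbhd F T) \<le> (2 * d + 1) ^ Suc j * card S" by (simp add: algebra_simps)
  moreover have "finite (nbhd F T)" using T(1) assms(1) fin by (auto simp: nbhd_def)
  moreover have "(nbhd F ^^ Suc j) S = nbhd F T" by (simp add: T_def)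
  ultimately show ?case by (simp only:)
qed (use assms in simp)

lemma litpath_in_nbhd_pow:
  assumes "litpath False F us" "us \<noteq> []" "lit_var (hd us) \<in> S"
  shows "lit_var (last us) \<in> (nbhd F ^^ (length us - 1)) S"
  using assms
proof (induction us rule: rev_induct)
  case (snoc w us)
  show ?case
  proof (cases "us = []")
    case False
    then have "litpath False F us" "link False F (last us) w"
      using snoc.prems(1) by (auto simp: litpath_def successively_append_iff)
    then have "lit_var (last us) \<in> (nbhd F ^^ (length us - 1)) S"
      and C: "{neg (last us), w} \<in> F"
      using snoc False by (auto simp: link_False_iff)
    then have "lit_var w \<in> nbhd F ((nbhd F ^^ (length us - 1)) S)"
      unfolding nbhd_def clause_vars_def by force
    then have "lit_var w \<in> (nbhd F ^^ Suc (length us - 1)) S" by simp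
    moreover have "Suc (length us - 1) = length us" using False by (cases us) auto
    ultimately show ?thesis by (simp del: funpow.simps)
  qed (use snoc in simp)
qed simp

text \<open>Each chosen clause removes itself and everything in conflict with it, at most g clauses
  in all.\<close>

lemma greedy_independent:
  assumes "finite G" "\<And>C. C \<in> G \<Longrightarrow> R C C" "\<And>C C'. R C C' \<Longrightarrow> R C' C"
    "\<And>C. C \<in> G \<Longrightarrow> card {C' \<in> G. R C C'} \<le> g"
  shows "\<exists>I\<subseteq>G. (\<forall>C\<in>I. \<forall>C'\<in>I. C \<noteq> C' \<longrightarrow> \<not> R C C') \<and> card G \<le> g * card I"
  using assms(1,2,4)
proof (induction "card G" arbitrary: G rule: less_induct)
  case less
  show ?case
  proof (cases "G = {}")
    case False
    then obtain C where C: "C \<in> G" by blast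
    define H where "H = {C' \<in> G. \<not> R C C'}"
    have "H \<subset> G" using C less.prems(2) by (auto simp: H_def)
    then have "card H < card G" using less.prems(1) by (simp add: psubset_card_mono)
    moreover have fH: "finite H" using less.prems(1) by (simp add: H_def)
    moreover have "card {C'' \<in> H. R C' C''} \<le> g" if "C' \<in> H" for C'
    proof -
      have "card {C'' \<in> H. R C' C''} \<le> card {C'' \<in> G. R C' C''}"
        using less.prems(1) by (intro card_mono) (auto simp: H_def)
      also have "\<dots> \<le> g" using that less.prems(3) by (simp add: H_def)
      finally show ?thesis .
    qed
    ultimately obtain I where I: "I \<subseteq> H" "\<forall>C\<in>I. \<forall>C'\<in>I. C \<noteq> C' \<longrightarrow> \<not> R C C'"
      "card H \<le> g * card I"
      using less.hyps[of H] less.prems(2) by (auto simp: H_def)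
    have "C \<notin> I" using I(1) C less.prems(2) by (auto simp: H_def)
    moreover have "finite I" using I(1) fH finite_subset by blast
    ultimately have cI: "card (insert C I) = Suc (card I)" by simp
    have "G = {C' \<in> G. R C C'} \<union> H" by (auto simp: H_def)
    then have "card G \<le> card {C' \<in> G. R C C'} + card H" by (metis card_Un_le)
    also have "\<dots> \<le> g + g * card I" using I(3) less.prems(3)[OF C] by simp
    finally have "card G \<le> g * card (insert C I)" using cI by simp
    moreover have "\<forall>D\<in>insert C I. \<forall>D'\<in>insert C I. D \<noteq> D' \<longrightarrow> \<not> R D D'"
      using I(1,2) assms(3) by (auto simp: H_def)
    moreover have "insert C I \<subseteq> G" using I(1) C by (auto simp: H_def)
    ultimately show ?thesis by blast
  qed (auto intro: exI[of _ "{}"])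
qed

text \<open>\<open>A\<close> gains one element of \<open>P\<close> at a time: the least missing one,
  together with all its predecessors, of which those in \<open>P\<close> are present
  already.\<close>

lemma ex_down_closed:
  assumes "strict_linear_order r" "finite P" "m \<le> card P"
  shows "\<exists>A. (\<forall>x y. (x, y) \<in> r \<longrightarrow> y \<in> A \<longrightarrow> x \<in> A) \<and> card (A \<inter> P) = m"
  using assms(3)
proof (induction m)
  case 0
  show ?case by (intro exI[of _ "{}"]) simp
next
  case (Suc m)
  have r: "trans r" "irrefl r" "total_on UNIV r"
    using assms(1) by (auto simp: strict_linear_order_on_def)
  obtain A where A: "\<forall>x y. (x, y) \<in> r \<longrightarrow> y \<in> A \<longrightarrow> x \<in> A" "card (A \<inter> P) = m"
    using Suc by auto
  \<comment> \<open>The order lives on the whole type, so leastness is expressed by counting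
    predecessors inside the finite set \<open>P\<close>.\<close>
  define rank where "rank = (\<lambda>z. card {x \<in> P. (x, z) \<in> r})"
  have "\<not> P \<subseteq> A"
    using A(2) Suc.prems by (auto simp: Int_absorb1)
  then obtain z0 where "z0 \<in> P \<and> z0 \<notin> A" by blast
  from ex_has_least_nat[of "\<lambda>z. z \<in> P \<and> z \<notin> A", OF this, of rank]
  obtain z where z: "z \<in> P" "z \<notin> A" "\<And>y. y \<in> P \<Longrightarrow> y \<notin> A \<Longrightarrow> rank z \<le> rank y" by blast
  have min: "x \<in> A" if x: "x \<in> P" "(x, z) \<in> r" for x
  proof (rule ccontr)
    assume "x \<notin> A"
    have "{w \<in> P. (w, x) \<in> r} \<subset> {w \<in> P. (w, z) \<in> r}"
      using x r(1,2) by (auto dest: transD simp: irrefl_def)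
    then have "rank x < rank z"
      unfolding rank_def using assms(2) by (intro psubset_card_mono) auto
    then show False using z(3)[OF x(1) \<open>x \<notin> A\<close>] by simp
  qed
  define B where "B = A \<union> {x. (x, z) \<in> r} \<union> {z}"
  have "B \<inter> P = insert z (A \<inter> P)" using min z(1) by (auto simp: B_def)
  then have "card (B \<inter> P) = Suc m" using A(2) z(2) assms(2) by simp
  moreover have "\<forall>x y. (x, y) \<in> r \<longrightarrow> y \<in> B \<longrightarrow> x \<in> B"
    using A(1) r(1) by (auto simp: B_def dest: transD)
  ultimately show ?case by blast
qed

lemma reach_vars_in_nbhd_pow:
  assumes "\<not> bad_lit F k l" "reach F l u" "lit_var l \<in> S"
  shows "lit_var u \<in> (nbhd F ^^ k) S"
proof -
  obtain us where us: "us \<noteq> []" "hd us = l" "last us = u" "distinct us"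
    "successively (link False F) us"
    using reach_imp_distinct_path[OF assms(2)] by blast
  have path: "litpath False F us"
    using distinct_path_cases[OF us(4,1,5)] not_bad_lit(2)[OF assms(1)] us(2) by blast
  then have "length us \<le> k" using not_bad_lit(1)[OF assms(1) path us(1,2)] by simp
  then have "(nbhd F ^^ (length us - 1)) S \<subseteq> (nbhd F ^^ k) S"
    by (intro nbhd_pow_increasing) simp
  then show ?thesis
    using litpath_in_nbhd_pow[OF path us(1), of S] us(2,3) assms(3) by blast
qed

text \<open>The clauses \<open>{a, b}\<close> in \<open>I\<close> cross the cut and the forced literals \<open>R(\<not>a)\<close>, \<open>R(\<not>b)\<close> of
  different clauses live on disjoint variables. Hence for each \<open>S \<subseteq> I\<close> there is a satisfying
  assignment falsifying the literal on the left for clauses in \<open>S\<close> and the one on the right for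
  the others; these assignments form a fooling set.\<close>

lemma fooling_set_of_crossing_clauses:
  fixes X :: "nat set"
  assumes "finite X" "F \<subseteq> two_clauses X"
    and nocontra: "\<And>l. \<not> (reach F l (neg l) \<and> reach F (neg l) l)"
    and I: "I \<subseteq> F" "\<And>C. C \<in> I \<Longrightarrow> crosses A C"
      "\<And>C l. C \<in> I \<Longrightarrow> l \<in> C \<Longrightarrow> \<not> reach F (neg l) l"
      "\<And>C C' l l' u u'. C \<in> I \<Longrightarrow> C' \<in> I \<Longrightarrow> C \<noteq> C' \<Longrightarrow> l \<in> C \<Longrightarrow> l' \<in> C' \<Longrightarrow>
         reach F (neg l) u \<Longrightarrow> reach F (neg l') u' \<Longrightarrow> lit_var u \<noteq> lit_var u'"
    and D: "bdd D" "computes D (cnf_vars F) (\<lambda>\<alpha>. satisfies \<alpha> F)"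
      "\<And>p. source_sink_path D p \<Longrightarrow> sorted_wrt (\<lambda>x y. (x, y) \<in> r) (path_vars D p)"
      "\<And>x y. (x, y) \<in> r \<Longrightarrow> y \<in> A \<Longrightarrow> x \<in> A"
  shows "2 ^ card I \<le> card (nodes D)"
proof -
  define V where "V = cnf_vars F"
  have finF: "finite F" using assms(1,2) finite_subset finite_two_clauses by blast
  then have finI: "finite I" using I(1) finite_subset by blast
  have "\<exists>a b. C = {a, b} \<and> lit_var a \<in> A \<and> lit_var b \<notin> A" if C: "C \<in> I" for C
  proof -
    obtain a b where ab: "C = {a, b}"
      using C I(1) assms(2) two_clauses_iff[of C X] by blast
    have "crosses A C" using I(2) C by blast
    then have "lit_var a \<in> A \<and> lit_var b \<notin> A \<or> lit_var b \<in> A \<and> lit_var a \<notin> A"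
      by (auto simp: crosses_def clause_vars_def ab)
    then show ?thesis using ab by (metis insert_commute)
  qed
  then obtain a b where ab: "\<And>C. C \<in> I \<Longrightarrow> C = {a C, b C} \<and> lit_var (a C) \<in> A \<and> lit_var (b C) \<notin> A"
    by metis
  have sat_cong: "satisfies \<alpha> F \<longleftrightarrow> satisfies \<beta> F" if eq: "\<And>x. x \<in> V \<Longrightarrow> \<alpha> x = \<beta> x" for \<alpha> \<beta>
  proof -
    have "lit_holds \<alpha> l = lit_holds \<beta> l" if "C \<in> F" "l \<in> C" for C l
    proof -
      have "lit_var l \<in> V" using that by (auto simp: V_def cnf_vars_def clause_vars_def)
      then show ?thesis using eq by (cases l) auto
    qed
    then show ?thesis unfolding satisfies_def by blast
  qed
  have "\<exists>\<alpha>. satisfies \<alpha> F \<and> (\<forall>C\<in>S. \<not> lit_holds \<alpha> (a C)) \<and> (\<forall>C\<in>I - S. \<not> lit_holds \<alpha> (b C))"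
    if S: "S \<subseteq> I" for S
  proof -
    define c where "c = (\<lambda>C. if C \<in> S then a C else b C)"
    have c: "c C \<in> C" if "C \<in> I" for C using ab[OF that] by (auto simp: c_def)
    define L where "L = {u. \<exists>C\<in>I. reach F (neg (c C)) u}"
    have "L \<subseteq> lits X"
    proof
      fix u assume "u \<in> L"
      then obtain C where C: "C \<in> I" "reach F (neg (c C)) u" by (auto simp: L_def)
      have "lit_var (c C) \<in> X"
        using c[OF C(1)] C(1) I(1) assms(2) by (auto simp: two_clauses_def clause_vars_def)
      with C(2) show "u \<in> lits X"
        by (induction rule: rtranclp_induct) (use link_vars[OF _ assms(2)] in \<open>auto simp: lits_def\<close>)
    qed
    moreover have "v \<in> L" if "u \<in> L" "link False F u v" for u v
      using that by (auto simp: L_def intro: rtranclp.rtrancl_into_rtrancl)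
    \<comment> \<open>If both signs come from one clause, its falsified literal would be implied by
      its own negation; for two clauses the forced variables are disjoint.\<close>
    moreover have "neg u \<notin> L" if u: "u \<in> L" for u
    proof
      assume "neg u \<in> L"
      then obtain C C' where C: "C \<in> I" "reach F (neg (c C)) u" "C' \<in> I" "reach F (neg (c C')) (neg u)"
        using u by (auto simp: L_def)
      show False
      proof (cases "C = C'")
        case True
        then have "reach F u (c C)" using reach_contra[OF C(4)] by simp
        then have "reach F (neg (c C)) (c C)" using C(2) by simp
        then show False using I(3)[OF C(1) c[OF C(1)]] by blast
      next
        case False
        then show False using I(4)[OF C(1,3) False c[OF C(1)] c[OF C(3)] C(2,4)] by simp
      qed
    qed
    ultimately obtain \<alpha> where \<alpha>: "satisfies \<alpha> F" "\<forall>l\<in>L. lit_holds \<alpha> l"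
      using extend_to_satisfying[OF assms(1,2) nocontra, of L] by blast
    have nh: "\<not> lit_holds \<alpha> (c C)" if "C \<in> I" for C
    proof -
      have "neg (c C) \<in> L" using that by (auto simp: L_def)
      then have "lit_holds \<alpha> (neg (c C))" using \<alpha>(2) by blast
      then show ?thesis by simp
    qed
    have "\<not> lit_holds \<alpha> (a C)" if "C \<in> S" for C
      using nh[of C] that S by (auto simp: c_def)
    moreover have "\<not> lit_holds \<alpha> (b C)" if "C \<in> I - S" for C
      using nh[of C] that by (auto simp: c_def)
    ultimately show ?thesis using \<alpha>(1) by blast
  qed
  then have "\<forall>S\<in>Pow I. \<exists>\<alpha>. satisfies \<alpha> F \<and> (\<forall>C\<in>S. \<not> lit_holds \<alpha> (a C)) \<and>
      (\<forall>C\<in>I - S. \<not> lit_holds \<alpha> (b C))"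
    by blast
  from bchoice[OF this] obtain \<sigma> where "\<forall>S\<in>Pow I. satisfies (\<sigma> S) F \<and>
      (\<forall>C\<in>S. \<not> lit_holds (\<sigma> S) (a C)) \<and> (\<forall>C\<in>I - S. \<not> lit_holds (\<sigma> S) (b C))"
    by (rule exE)
  then have \<sigma>: "satisfies (\<sigma> S) F \<and>
      (\<forall>C\<in>S. \<not> lit_holds (\<sigma> S) (a C)) \<and> (\<forall>C\<in>I - S. \<not> lit_holds (\<sigma> S) (b C))" if "S \<subseteq> I" for S
    using that by blast
  define \<tau> where "\<tau> = (\<lambda>S. restrict (\<sigma> S) V)"
  have inV: "lit_var (a C) \<in> V" "lit_var (b C) \<in> V" if "C \<in> I" for C
    using ab[OF that] that I(1) by (auto simp: V_def cnf_vars_def clause_vars_def)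
  \<comment> \<open>On \<open>C\<close> the mixture takes the left literal from
    \<open>\<tau> S\<close> and the right one from \<open>\<tau> S'\<close>, and each of these
    assignments falsifies just that literal.\<close>
  have conflict: "\<not> satisfies (mix V A (\<tau> S) (\<tau> S')) F"
    if S: "S \<subseteq> I" "S' \<subseteq> I" "C \<in> S" "C \<notin> S'" for S S' C
  proof
    assume sat: "satisfies (mix V A (\<tau> S) (\<tau> S')) F"
    have C: "C \<in> I" using S by auto
    have "\<not> lit_holds (mix V A (\<tau> S) (\<tau> S')) (a C)"
      using \<sigma>[OF S(1)] S(3) ab[OF C] inV[OF C]
      by (cases "a C") (auto simp: mix_def \<tau>_def dest!: bspec[of S _ C])
    moreover have "\<not> lit_holds (mix V A (\<tau> S) (\<tau> S')) (b C)"
      using \<sigma>[OF S(2)] S(4) C ab[OF C] inV[OF C]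
      by (cases "b C") (auto simp: mix_def \<tau>_def dest!: bspec[of "I - S'" _ C])
    moreover have "\<exists>l\<in>C. lit_holds (mix V A (\<tau> S) (\<tau> S')) l"
      using sat C I(1) unfolding satisfies_def by blast
    ultimately show False using ab[OF C] by (metis empty_iff insert_iff)
  qed
  have "card (Pow I) \<le> card (nodes D)"
  proof (rule fooling_set_bound[where \<tau> = \<tau> and X = V and A = A and r = r])
    show "bdd D" by fact
    show "computes D V (\<lambda>\<alpha>. satisfies \<alpha> F)" using D(2) by (simp add: V_def)
    show "\<tau> S \<in> V \<rightarrow>\<^sub>E UNIV \<and> satisfies (\<tau> S) F" if "S \<in> Pow I" for S
      using \<sigma>[of S] that sat_cong[of "\<tau> S" "\<sigma> S"] by (auto simp: \<tau>_def)
    show "\<not> satisfies (mix V A (\<tau> S) (\<tau> S')) F \<or> \<not> satisfies (mix V A (\<tau> S') (\<tau> S)) F"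
      if S: "S \<in> Pow I" "S' \<in> Pow I" "S \<noteq> S'" for S S'
    proof -
      obtain C where "C \<in> S \<and> C \<notin> S' \<or> C \<in> S' \<and> C \<notin> S" using S(3) by blast
      then show ?thesis using conflict S(1,2) by blast
    qed
  qed (use D in auto)
  then show ?thesis using finI by (simp add: card_Pow)
qed

text \<open>At most \<open>\<beta> * d\<close> crossing clauses involve a bad literal. For the rest,
  overlapping consequences put two clauses within primal distance 2 k of each other, so a greedy
  choice keeps \<open>t\<close> independent ones, which yield the fooling set.\<close>

lemma cnf_obdd_size_ge:
  fixes X :: "nat set"
  assumes "finite X" "F \<subseteq> two_clauses X"
    and nocontra: "\<And>l. \<not> (reach F l (neg l) \<and> reach F (neg l) l)"
    and cut: "hard_to_cut X s F"
    and deg: "\<And>x. card {C \<in> F. x \<in> clause_vars C} \<le> d"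
    and bad: "card {l \<in> lits X. bad_lit F k l} \<le> \<beta>"
  shows "\<exists>t. 2 ^ t \<le> cnf_obdd_size F \<and> s \<le> \<beta> * d + 2 * d * (2 * d + 1) ^ (2 * k) * t"
proof -
  have finF: "finite F" using assms(1,2) finite_subset finite_two_clauses by blast
  have "cnf_vars F \<subseteq> X"
    using assms(2) by (force simp: cnf_vars_def two_clauses_def)
  then have "finite (cnf_vars F)" using assms(1) finite_subset by blast
  then obtain D :: "(nat, nat) bdd_graph" where D: "obdd D"
    "computes D (cnf_vars F) (\<lambda>\<alpha>. satisfies \<alpha> F)" "card (nodes D) = cnf_obdd_size F"
    unfolding cnf_obdd_size_def by (rule obdd_size_attained)
  then obtain r where r: "strict_linear_order r"
    "\<And>p. source_sink_path D p \<Longrightarrow> sorted_wrt (\<lambda>x y. (x, y) \<in> r) (path_vars D p)"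
    unfolding obdd_def by blast
  obtain P where P: "P \<subseteq> X"
    "\<And>A. card (A \<inter> P) = card P div 2 \<Longrightarrow> s \<le> card {C \<in> F. crosses A C}"
    using cut unfolding hard_to_cut_def by blast
  have "finite P" using P(1) assms(1) finite_subset by blast
  then obtain A where A: "\<forall>x y. (x, y) \<in> r \<longrightarrow> y \<in> A \<longrightarrow> x \<in> A" "card (A \<inter> P) = card P div 2"
    using ex_down_closed[OF r(1), of P "card P div 2"] by auto
  define cr where "cr = {C \<in> F. crosses A C}"
  define B where "B = {l \<in> lits X. bad_lit F k l}"
  \<comment> \<open>Falsifying \<open>l\<close> makes \<open>neg l\<close> true, so it is the
    consequences of \<open>neg l\<close> that have to stay local.\<close>
  define G where "G = {C \<in> cr. \<forall>l\<in>C. \<not> bad_lit F k (neg l)}"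
  have fin: "finite cr" "finite G" "finite B"
    using finF assms(1) by (auto simp: cr_def G_def B_def)
  have s: "s \<le> card cr" unfolding cr_def by (rule P(2)[OF A(2)])
  have "cr - G \<subseteq> {C \<in> F. clause_vars C \<inter> lit_var ` B \<noteq> {}}"
  proof
    fix C assume C: "C \<in> cr - G"
    then obtain l where l: "C \<in> F" "l \<in> C" "bad_lit F k (neg l)" by (auto simp: G_def cr_def)
    have "neg l \<in> lits X"
      using l(1,2) assms(2) by (auto simp: two_clauses_def clause_vars_def lits_def)
    then have "neg l \<in> B" using l(3) by (simp add: B_def)
    then have "lit_var (neg l) \<in> lit_var ` B" by (rule imageI)
    then have "lit_var l \<in> lit_var ` B" by simp
    then show "C \<in> {C \<in> F. clause_vars C \<inter> lit_var ` B \<noteq> {}}"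
      using l by (auto simp: clause_vars_def)
  qed
  then have "card (cr - G) \<le> card {C \<in> F. clause_vars C \<inter> lit_var ` B \<noteq> {}}"
    using finF by (intro card_mono) auto
  also have "\<dots> \<le> d * card (lit_var ` B)"
    using fin(3) by (intro card_incident_le[OF finF _ deg]) auto
  also have "\<dots> \<le> d * \<beta>"
    using card_image_le[OF fin(3), of lit_var] bad by (intro mult_le_mono2) (simp add: B_def)
  finally have crG: "card (cr - G) \<le> d * \<beta>" .
  have "card cr \<le> card (cr - G) + card G"
    using card_Un_le[of "cr - G" G] fin by (simp add: G_def Un_absorb2)
  then have sG: "s \<le> \<beta> * d + card G" using s crG by (simp add: mult.commute)
  define V where "V = (\<lambda>C. lit_var ` {u. \<exists>l\<in>C. reach F (neg l) u})"
  define R where "R = (\<lambda>C C'. V C \<inter> V C' \<noteq> {})"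
  have V: "V C \<subseteq> (nbhd F ^^ k) (clause_vars C)" if "C \<in> G" for C
    using that by (auto simp: V_def G_def clause_vars_def intro!: reach_vars_in_nbhd_pow)
  have VC: "clause_vars C \<subseteq> V C" for C
  proof
    fix x assume "x \<in> clause_vars C"
    then obtain l where "l \<in> C" "x = lit_var (neg l)" by (auto simp: clause_vars_def)
    then show "x \<in> V C" unfolding V_def by blast
  qed
  have refl: "R C C" if "C \<in> G" for C
  proof -
    have "C \<in> two_clauses X" using that assms(2) by (auto simp: G_def cr_def)
    then have "clause_vars C \<noteq> {}" by (auto simp: two_clauses_iff clause_vars_def)
    then show ?thesis using VC[of C] by (auto simp: R_def)
  qed
  have "card {C' \<in> G. R C C'} \<le> 2 * d * (2 * d + 1) ^ (2 * k)" if C: "C \<in> G" for C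
  proof -
    let ?N = "(nbhd F ^^ (2 * k)) (clause_vars C)"
    have CX: "C \<in> two_clauses X" using C assms(2) by (auto simp: G_def cr_def)
    have N: "finite ?N" "card ?N \<le> (2 * d + 1) ^ (2 * k) * 2"
      using card_nbhd_pow[OF finF assms(2) deg, of "clause_vars C" "2 * k"]
        clause_vars_two_clause[OF CX] by auto
    have "{C' \<in> G. R C C'} \<subseteq> {C' \<in> F. clause_vars C' \<inter> ?N \<noteq> {}}"
    proof
      fix C' assume C': "C' \<in> {C' \<in> G. R C C'}"
      then obtain x where x: "x \<in> V C" "x \<in> V C'" by (auto simp: R_def)
      have "x \<in> (nbhd F ^^ k) (clause_vars C')" using V C' x(2) by blast
      from nbhd_pow_sym[OF this] obtain y where
        y: "y \<in> clause_vars C'" "y \<in> (nbhd F ^^ k) {x}" by blast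
      have "{x} \<subseteq> (nbhd F ^^ k) (clause_vars C)" using V C x(1) by blast
      then have "(nbhd F ^^ k) {x} \<subseteq> (nbhd F ^^ k) ((nbhd F ^^ k) (clause_vars C))"
        by (rule nbhd_pow_mono)
      also have "\<dots> = ?N" by (simp add: mult_2 funpow_add)
      finally show "C' \<in> {C' \<in> F. clause_vars C' \<inter> ?N \<noteq> {}}"
        using y C' by (auto simp: G_def cr_def)
    qed
    then have "card {C' \<in> G. R C C'} \<le> card {C' \<in> F. clause_vars C' \<inter> ?N \<noteq> {}}"
      using finF by (intro card_mono) auto
    also have "\<dots> \<le> d * card ?N" by (rule card_incident_le[OF finF N(1) deg])
    also have "\<dots> \<le> d * ((2 * d + 1) ^ (2 * k) * 2)" by (rule mult_le_mono2[OF N(2)])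
    finally show ?thesis by (simp add: algebra_simps)
  qed
  moreover have "R C' C" if "R C C'" for C C' using that by (auto simp: R_def)
  ultimately obtain I where I: "I \<subseteq> G" "\<forall>C\<in>I. \<forall>C'\<in>I. C \<noteq> C' \<longrightarrow> \<not> R C C'"
    "card G \<le> 2 * d * (2 * d + 1) ^ (2 * k) * card I"
    using greedy_independent[OF fin(2), of R "2 * d * (2 * d + 1) ^ (2 * k)"] refl by blast
  have "2 ^ card I \<le> card (nodes D)"
  proof (rule fooling_set_of_crossing_clauses[OF assms(1,2) nocontra, where A = A and r = r])
    show "I \<subseteq> F" using I(1) by (auto simp: G_def cr_def)
    show "crosses A C" if "C \<in> I" for C using that I(1) by (auto simp: G_def cr_def)
    show "\<not> reach F (neg l) l" if l: "C \<in> I" "l \<in> C" for C l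
    proof -
      have "\<not> bad_lit F k (neg l)" using l I(1) by (auto simp: G_def)
      from not_bad_lit(3)[OF this] show ?thesis by simp
    qed
    show "lit_var u \<noteq> lit_var u'" if h: "C \<in> I" "C' \<in> I" "C \<noteq> C'" "l \<in> C" "l' \<in> C'"
      "reach F (neg l) u" "reach F (neg l') u'" for C C' l l' u u'
    proof -
      have "lit_var u \<in> V C" "lit_var u' \<in> V C'" using h(4-7) by (auto simp: V_def)
      moreover have "V C \<inter> V C' = {}" using I(2) h(1-3) by (auto simp: R_def)
      ultimately show ?thesis by auto
    qed
    show "bdd D" using D(1) by (simp add: obdd_def)
  qed (use D r A in auto)
  then have "2 ^ card I \<le> cnf_obdd_size F" using D(3) by simp
  moreover have "s \<le> \<beta> * d + 2 * d * (2 * d + 1) ^ (2 * k) * card I"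
    using sG I(3) by linarith
  ultimately show ?thesis by blast
qed

subsection \<open>First moment bounds\<close>

text \<open>\<open>sg i\<close> tells with which sign the literal at position i enters its clause
  with the next one. Implication paths are the case of constant \<open>False\<close>; primal paths
  need arbitrary sign patterns.\<close>

definition chain :: "(nat \<Rightarrow> bool) \<Rightarrow> 'x literal list \<Rightarrow> 'x cnf" where
  "chain sg us = (\<lambda>i. {if sg i then us ! i else neg (us ! i), us ! Suc i}) ` {..<length us - 1}"

abbreviation chain0 :: "'x literal list \<Rightarrow> 'x cnf" where
  "chain0 \<equiv> chain (\<lambda>_. False)"

lemma finite_chain [simp]: "finite (chain sg us)"
  by (simp add: chain_def)

text \<open>Whatever the signs, the unordered pair of neighbouring variables already distinguishes
  the clauses.\<close>

lemma card_chain: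
  assumes "distinct (map lit_var us)"
  shows "card (chain sg us) = length us - 1"
proof -
  have v: "i = j" if "lit_var (us ! i) = lit_var (us ! j)" "i < length us" "j < length us" for i j
    using assms that by (auto simp: distinct_conv_nth)
  have "inj_on (\<lambda>i. {if sg i then us ! i else neg (us ! i), us ! Suc i}) {..<length us - 1}"
  proof (rule inj_onI)
    fix i j assume ij: "i \<in> {..<length us - 1}" "j \<in> {..<length us - 1}"
      "{if sg i then us ! i else neg (us ! i), us ! Suc i} =
       {if sg j then us ! j else neg (us ! j), us ! Suc j}"
    then have "lit_var ` {if sg i then us ! i else neg (us ! i), us ! Suc i} =
       lit_var ` {if sg j then us ! j else neg (us ! j), us ! Suc j}" by (simp only:)
    then have "{lit_var (us ! i), lit_var (us ! Suc i)} = {lit_var (us ! j), lit_var (us ! Suc j)}"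
      by (simp split: if_splits)
    then have "lit_var (us ! i) = lit_var (us ! j) \<or>
        lit_var (us ! i) = lit_var (us ! Suc j) \<and> lit_var (us ! Suc i) = lit_var (us ! j)"
      by (auto simp: doubleton_eq_iff)
    then show "i = j"
    proof (elim disjE conjE)
      assume "lit_var (us ! i) = lit_var (us ! j)"
      then show ?thesis by (rule v) (use ij in auto)
    next
      assume 1: "lit_var (us ! i) = lit_var (us ! Suc j)" and 2: "lit_var (us ! Suc i) = lit_var (us ! j)"
      have "i = Suc j" using 1 by (rule v) (use ij in auto)
      moreover have "Suc i = j" using 2 by (rule v) (use ij in auto)
      ultimately show ?thesis by simp
    qed
  qed
  then show ?thesis by (simp add: chain_def card_image)
qed

lemma chain0_subset: "litpath False F us \<Longrightarrow> chain0 us \<subseteq> F"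
  by (auto simp: chain_def litpath_def successively_conv_nth link_False_iff)

lemma chain_subset:
  assumes "litpath True F us"
  shows "\<exists>ss. length ss = length us - 1 \<and> chain ((!) ss) us \<subseteq> F"
proof -
  let ?ss = "map (\<lambda>i. {us ! i, us ! Suc i} \<in> F) [0..<length us - 1]"
  have "{if ?ss ! i then us ! i else neg (us ! i), us ! Suc i} \<in> F" if "i < length us - 1" for i
  proof -
    have "link True F (us ! i) (us ! Suc i)"
      using assms that by (simp add: litpath_def successively_conv_nth)
    then show ?thesis using that by (auto simp: link_def link_clauses_def)
  qed
  then show ?thesis by (intro exI[of _ ?ss]) (auto simp: chain_def)
qed

definition paths :: "'x set \<Rightarrow> nat \<Rightarrow> 'x literal list set" where
  "paths X j = {us. set us \<subseteq> lits X \<and> length us = j \<and> distinct (map lit_var us)}"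

lemma paths_card:
  assumes "finite X"
  shows "finite (paths X j)" "card (paths X j) \<le> (2 * card X) ^ j"
proof -
  have fin: "finite {us. set us \<subseteq> lits X \<and> length us = j}"
    using assms by (intro finite_lists_length_eq) simp
  have sub: "paths X j \<subseteq> {us. set us \<subseteq> lits X \<and> length us = j}" by (auto simp: paths_def)
  show "finite (paths X j)" using fin sub finite_subset by blast
  have "card (paths X j) \<le> card {us. set us \<subseteq> lits X \<and> length us = j}"
    using fin sub by (rule card_mono)
  also have "\<dots> = (2 * card X) ^ j"
    using assms by (simp add: card_lists_length_eq card_lits)
  finally show "card (paths X j) \<le> (2 * card X) ^ j" .
qed

lemma litpath_in_paths:
  assumes "litpath b F us" "F \<subseteq> two_clauses X" "us \<noteq> []" "lit_var (hd us) \<in> X \<or> 2 \<le> length us"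
  shows "us \<in> paths X (length us)"
proof (cases "2 \<le> length us")
  case True
  then show ?thesis
    using litpath_vars[OF assms(1,2) True] assms(1) by (auto simp: paths_def litpath_def lits_def)
next
  case False
  moreover have "length us \<noteq> 0" using assms(3) by simp
  ultimately have "length us = 1" by linarith
  then obtain u where "us = [u]" by (auto simp: length_Suc_conv)
  then show ?thesis using assms False by (auto simp: paths_def lits_def)
qed

lemma sum_paths_le:
  fixes q :: real
  assumes "finite X" "0 \<le> q"
  shows "(\<Sum>us\<in>paths X j. q ^ i) \<le> (2 * real (card X)) ^ j * q ^ i"
proof -
  have "real (card (paths X j)) \<le> real ((2 * card X) ^ j)"
    using paths_card(2)[OF assms(1)] by (simp only: of_nat_le_iff)
  then show ?thesis using assms(2) by (simp add: mult_right_mono)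
qed

section \<open>Expected numbers of paths, lollipops, bicycles and high degrees\<close>

text \<open>Each prescribed clause costs a factor \<open>q\<close>. The products
  \<open>2 * card X * q\<close> and \<open>4 * card X * q\<close> are the branching factors of the
  implication digraph and of the primal graph.\<close>

context
  fixes X :: "'x set" and m :: nat and Q :: "'x cnf" and q :: real
  assumes finX: "finite X" and mQ: "m \<le> card (two_clauses X)"
  defines "Q \<equiv> two_clauses X" and "q \<equiv> real m / real (card (two_clauses X))"
begin

lemma finite_Q: "finite Q" and q_nonneg: "0 \<le> q"
  using finX by (simp_all add: Q_def q_def)

lemma q_eq: "q = real m / real (card Q)" and m_le_card_Q: "m \<le> card Q"
  using mQ by (simp_all add: Q_def q_def)

text \<open>There are \<open>2 ^ L\<close> sign patterns and at most
  \<open>(2 * card X) ^ Suc L\<close> literal lists, each prescribing L clauses.\<close>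

lemma unif_prob_True_path_le:
  assumes "1 \<le> L"
  shows "unif_prob Q m (\<lambda>F. \<exists>us. length us = Suc L \<and> litpath True F us) \<le>
    2 * card X * (4 * card X * q) ^ L"
proof -
  let ?S = "{ss :: bool list. length ss = L}"
  let ?I = "?S \<times> paths X (Suc L)"
  have S: "finite ?S" "card ?S = 2 ^ L"
    using finite_lists_length_eq[of "UNIV :: bool set" L] card_lists_length_eq[of "UNIV :: bool set" L]
    by simp_all
  have "unif_prob Q m (\<lambda>F. \<exists>us. length us = Suc L \<and> litpath True F us) \<le>
      (\<Sum>i\<in>?I. (real m / real (card Q)) ^ card (case i of (ss, us) \<Rightarrow> chain ((!) ss) us))"
  proof (rule unif_prob_first_moment)
    show "finite ?I" using S(1) paths_card(1)[OF finX] by simp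
    fix F assume F: "F \<subseteq> Q" "\<exists>us. length us = Suc L \<and> litpath True F us"
    then obtain us where us: "length us = Suc L" "litpath True F us" by blast
    obtain ss where ss: "length ss = L" "chain ((!) ss) us \<subseteq> F"
      using chain_subset[OF us(2)] us(1) by auto
    have "us \<in> paths X (Suc L)"
      using litpath_in_paths[OF us(2), of X] F(1) us(1) assms by (cases us) (auto simp: Q_def)
    then show "\<exists>i\<in>?I. (case i of (ss, us) \<Rightarrow> chain ((!) ss) us) \<subseteq> F"
      using ss by (intro bexI[of _ "(ss, us)"]) auto
  qed (use finite_Q mQ in \<open>auto simp: Q_def\<close>)
  also have "\<dots> = (\<Sum>i\<in>?I. q ^ L)"
    by (intro sum.cong) (auto simp: paths_def card_chain q_def Q_def)
  also have "\<dots> = real (card ?S) * (\<Sum>us\<in>paths X (Suc L). q ^ L)"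
    by (simp add: card_cartesian_product)
  also have "\<dots> \<le> 2 ^ L * ((2 * real (card X)) ^ Suc L * q ^ L)"
    unfolding S(2) using sum_paths_le[OF finX q_nonneg, where j = "Suc L" and i = L] by (simp add: mult_left_mono)
  also have "\<dots> = 2 * real (card X) * (2 * (2 * real (card X)) * q) ^ L"
    by (simp only: power_mult_distrib power_Suc mult_ac)
  also have "2 * (2 * real (card X)) * q = 4 * card X * q" by simp
  finally show ?thesis by simp
qed

lemma unif_prob_False_path_le:
  assumes "1 \<le> k"
  shows "unif_prob Q m (\<lambda>F. \<exists>us. length us = Suc k \<and> litpath False F us) \<le>
    2 * card X * (2 * card X * q) ^ k"
proof -
  have "unif_prob Q m (\<lambda>F. \<exists>us. length us = Suc k \<and> litpath False F us) \<le>
      (\<Sum>us\<in>paths X (Suc k). (real m / real (card Q)) ^ card (chain0 us))"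
  proof (rule unif_prob_first_moment)
    fix F assume F: "F \<subseteq> Q" "\<exists>us. length us = Suc k \<and> litpath False F us"
    then obtain us where us: "length us = Suc k" "litpath False F us" by blast
    have "us \<in> paths X (Suc k)"
      using litpath_in_paths[OF us(2), of X] F(1) us(1) assms by (cases us) (auto simp: Q_def)
    then show "\<exists>us\<in>paths X (Suc k). chain0 us \<subseteq> F" using chain0_subset[OF us(2)] by blast
  qed (use finite_Q mQ finX paths_card in \<open>auto simp: Q_def\<close>)
  also have "\<dots> = (\<Sum>us\<in>paths X (Suc k). q ^ k)"
    by (intro sum.cong) (auto simp: paths_def card_chain q_def Q_def)
  also have "\<dots> \<le> (2 * real (card X)) ^ Suc k * q ^ k"
    by (rule sum_paths_le[OF finX q_nonneg])
  also have "\<dots> = 2 * card X * (2 * card X * q) ^ k"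
    by (simp add: power_mult_distrib)
  finally show ?thesis .
qed

lemma neg_notin_path:
  "distinct (map lit_var us) \<Longrightarrow> u \<in> set us \<Longrightarrow> neg u \<notin> set us"
  using inj_onD[of lit_var "set us" u "neg u"] by (auto simp: distinct_map)

text \<open>In the clauses of the path only literals before the last occur negated, so
  \<open>neg (last us)\<close> is in none of them. Closing a lollipop thus costs a new
  clause.\<close>

lemma last_clause_notin_chain0:
  assumes "distinct (map lit_var us)" "us \<noteq> []" "neg (last us) \<in> C"
  shows "C \<notin> chain0 us"
proof
  assume "C \<in> chain0 us"
  then obtain i where i: "i < length us - 1" "C = {neg (us ! i), us ! Suc i}"
    by (auto simp: chain_def)
  have "us ! Suc i \<in> set us" "us ! i \<in> set us" using i(1) by auto
  moreover have "last us \<noteq> us ! i"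
    using assms(1,2) i(1) by (auto simp: last_conv_nth distinct_map nth_eq_iff_index_eq)
  ultimately show False
    using assms i(2) neg_notin_path[OF assms(1), of "last us"] by auto
qed

lemma card_lollipop:
  assumes "distinct (map lit_var us)" "us \<noteq> []"
  shows "card (insert {neg (last us), z} (chain0 us)) = length us"
  using last_clause_notin_chain0[OF assms, of "{neg (last us), z}"] card_chain[OF assms(1)] assms(2)
  by (cases us) auto

text \<open>Summing over \<open>l\<close> frees the first literal, so every certificate is counted
  once. Lollipops with j literals use j clauses and have j places of attachment, contributing at
  most j; over all j \<le> k this gives at most k squared.\<close>

lemma sum_unif_prob_bad_lit_le:
  assumes "1 \<le> k" "2 * card X * q \<le> 1"
  shows "(\<Sum>l\<in>lits X. unif_prob Q m (\<lambda>F. bad_lit F k l)) \<le> 2 * card X * (2 * card X * q) ^ k + real k ^ 2"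
proof -
  \<comment> \<open>For j \<le> k a triple is a lollipop with j literals attached at position i; j =
    \<open>Suc k\<close> encodes a bare path, with 0 as dummy position.\<close>
  define I where "I = Sigma {1..Suc k} (\<lambda>j. paths X j \<times> (if j = Suc k then {0} else {..<j}))"
  define H where "H = (\<lambda>(j, us :: 'x literal list, i :: nat). if j = Suc k then chain0 us
    else insert {neg (last us), neg (us ! i)} (chain0 us))"
  define g where "g = (\<lambda>(j :: nat, us :: 'x literal list, i :: nat). hd us)"
  define e where "e = (\<lambda>j. if j = Suc k then k else j)"
  have finI: "finite I" using paths_card(1)[OF finX] by (auto simp: I_def)
  have nonempty: "us \<noteq> []" if "us \<in> paths X j" "1 \<le> j" for us j
    using that by (auto simp: paths_def)
  have cardH: "card (H (j, us, i)) = e j" if "(j, us, i) \<in> I" for j us i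
    using that card_chain[of us] card_lollipop[of us] nonempty[of us j]
    by (auto simp: H_def I_def paths_def e_def)
  have gI: "g ` I \<subseteq> lits X"
  proof (rule image_subsetI)
    fix x assume "x \<in> I"
    then obtain j us i where x: "x = (j, us, i)" "us \<in> paths X j" "1 \<le> j" by (auto simp: I_def)
    then have "hd us \<in> set us" using nonempty[OF x(2,3)] by simp
    then show "g x \<in> lits X" using x(1,2) by (auto simp: g_def paths_def)
  qed
  have "unif_prob Q m (\<lambda>F. bad_lit F k l) \<le> (\<Sum>x | x \<in> I \<and> g x = l. q ^ card (H x))" if l: "l \<in> lits X" for l
    unfolding q_eq
  proof (rule unif_prob_first_moment[OF finite_Q m_le_card_Q])
    show "finite {x \<in> I. g x = l}" using finI by simp
    fix F assume "F \<subseteq> Q" "bad_lit F k l"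
    then have F: "F \<subseteq> two_clauses X" "bad_lit F k l" by (simp_all add: Q_def)
    then obtain us where us: "us \<noteq> []" "hd us = l"
      "litpath False F us \<and> length us = Suc k \<or> lollipop F us \<and> length us \<le> k"
      unfolding bad_lit_def by blast
    have path: "litpath False F us" using us(3) by (auto simp: lollipop_def)
    have P: "us \<in> paths X (length us)"
      by (rule litpath_in_paths[OF path F(1) us(1)]) (use l us(2) in \<open>auto simp: lits_def\<close>)
    from us(3) show "\<exists>x\<in>{x \<in> I. g x = l}. H x \<subseteq> F"
    proof
      assume "litpath False F us \<and> length us = Suc k"
      then show ?thesis using P us(2) chain0_subset[OF path]
        by (intro bexI[of _ "(Suc k, us, 0)"]) (auto simp: H_def I_def g_def)
    next
      assume lol: "lollipop F us \<and> length us \<le> k"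
      then obtain i where i: "i < length us" "link False F (last us) (neg (us ! i))"
        by (auto simp: lollipop_def)
      have "1 \<le> length us" using us(1) by (cases us) auto
      then show ?thesis using P us(2) chain0_subset[OF path] i lol
        by (intro bexI[of _ "(length us, us, i)"]) (auto simp: H_def I_def g_def link_False_iff)
    qed
  qed (auto simp: H_def split: prod.splits)
  then have "(\<Sum>l\<in>lits X. unif_prob Q m (\<lambda>F. bad_lit F k l)) \<le>
      (\<Sum>l\<in>lits X. \<Sum>x | x \<in> I \<and> g x = l. q ^ card (H x))"
    by (rule sum_mono)
  also have "\<dots> = (\<Sum>x\<in>I. q ^ card (H x))"
    by (rule sum.group[OF finI _ gI]) (use finX in simp)
  also have "\<dots> = (\<Sum>(j, us, i)\<in>I. q ^ e j)"
    by (intro sum.cong) (auto simp: cardH)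
  also have "\<dots> = (\<Sum>j\<in>{1..Suc k}. \<Sum>(us, i)\<in>paths X j \<times> (if j = Suc k then {0} else {..<j}). q ^ e j)"
    unfolding I_def using paths_card(1)[OF finX] by (subst sum.Sigma) auto
  also have "\<dots> = (\<Sum>j\<in>{1..Suc k}. (if j = Suc k then 1 else real j) * (\<Sum>us\<in>paths X j. q ^ e j))"
    by (intro sum.cong) (auto simp: card_cartesian_product split_beta)
  also have "\<dots> \<le> (\<Sum>j\<in>{1..Suc k}. (if j = Suc k then 1 else real j) *
      ((2 * real (card X)) ^ j * q ^ e j))"
    by (intro sum_mono mult_left_mono sum_paths_le finX q_nonneg) auto
  also have "\<dots> = (\<Sum>j\<in>{1..k}. real j * (2 * real (card X) * q) ^ j) +
      2 * card X * (2 * card X * q) ^ k"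
    by (simp add: e_def power_mult_distrib)
  also have "(\<Sum>j\<in>{1..k}. real j * (2 * real (card X) * q) ^ j) \<le> (\<Sum>j\<in>{1..k}. real k * 1)"
    using assms(2) q_nonneg by (intro sum_mono mult_mono power_le_one) auto
  also have "\<dots> = real k ^ 2" by (simp add: power2_eq_square)
  finally show ?thesis by simp
qed

text \<open>With j literals and j + 1 clauses the path sum is at most q, times at most 2 k choices
  of \<open>y\<close> and k of \<open>z\<close>; the sum over j \<le> k adds the third factor
  k.\<close>

lemma unif_prob_bicycle_le:
  assumes "2 * card X * q \<le> 1"
  shows "unif_prob Q m (\<lambda>F. \<exists>ws y z. bicycle F ws y z \<and> length ws \<le> k) \<le> 2 * real k ^ 3 * q"
proof -
  define I where "I = Sigma {1..k} (\<lambda>j. Sigma (paths X j) (\<lambda>ws. (set ws \<union> neg ` set ws) \<times> neg ` set ws))"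
  define H where "H = (\<lambda>(j :: nat, ws :: 'x literal list, y, z).
    insert {neg y, hd ws} (insert {neg (last ws), z} (chain0 ws)))"
  have finI: "finite I" using paths_card(1)[OF finX] by (auto simp: I_def)
  have cardH: "card (H (j, ws, y, z)) = Suc j" if "(j, ws, y, z) \<in> I" for j ws y z
  proof -
    have ws: "length ws = j" "1 \<le> j" "distinct (map lit_var ws)" "neg z \<in> set ws"
      using that by (auto simp: I_def paths_def)
    then have ne: "ws \<noteq> []" by auto
    have "{neg y, hd ws} \<notin> chain0 ws"
    proof
      assume "{neg y, hd ws} \<in> chain0 ws"
      then obtain i where i: "i < length ws - 1" "{neg y, hd ws} = {neg (ws ! i), ws ! Suc i}"
        by (auto simp: chain_def)
      have "hd ws = neg (ws ! i) \<or> hd ws = ws ! Suc i" using i(2) by blast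
      moreover have "hd ws \<noteq> neg (ws ! i)"
        using neg_notin_path[OF ws(3), of "ws ! i"] i(1) ne by (metis hd_in_set add_lessD1 less_diff_conv nth_mem)
      moreover have "hd ws \<noteq> ws ! Suc i"
        using ws(3) ne i(1) by (auto simp: hd_conv_nth distinct_map nth_eq_iff_index_eq)
      ultimately show False by blast
    qed
    moreover have "hd ws \<noteq> neg (last ws)" "hd ws \<noteq> z"
      using neg_notin_path[OF ws(3)] ne ws(4) by (metis hd_in_set last_in_set, metis hd_in_set)
    then have "{neg y, hd ws} \<noteq> {neg (last ws), z}" by (auto simp: doubleton_eq_iff)
    ultimately show ?thesis
      using card_lollipop[OF ws(3) ne, of z] ws(1) by (simp add: H_def)
  qed
  have "unif_prob Q m (\<lambda>F. \<exists>ws y z. bicycle F ws y z \<and> length ws \<le> k) \<le> (\<Sum>x\<in>I. q ^ card (H x))"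
    unfolding q_eq
  proof (rule unif_prob_first_moment[OF finite_Q m_le_card_Q finI])
    fix F assume "F \<subseteq> Q" "\<exists>ws y z. bicycle F ws y z \<and> length ws \<le> k"
    then obtain ws y z where b: "bicycle F ws y z" "length ws \<le> k" and F: "F \<subseteq> two_clauses X"
      unfolding Q_def by blast
    have ws: "ws \<noteq> []" "litpath False F ws" "link False F y (hd ws)" "link False F (last ws) z"
      "lit_var y \<in> lit_var ` set ws" "neg z \<in> set ws"
      using b(1) by (auto simp: bicycle_def)
    have P: "ws \<in> paths X (length ws)"
      using litpath_in_paths[OF ws(2) F(1) ws(1)] link_vars[OF ws(3) F(1)] by blast
    have "y \<in> set ws \<union> neg ` set ws"
    proof -
      obtain w where "w \<in> set ws" "lit_var y = lit_var w" using ws(5) by auto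
      then show ?thesis using lit_var_eqD[of y w] by auto
    qed
    moreover have "z \<in> neg ` set ws" using ws(6) by (metis image_eqI neg_neg)
    moreover have "1 \<le> length ws" using ws(1) by (cases ws) auto
    ultimately show "\<exists>x\<in>I. H x \<subseteq> F"
      using P b(2) chain0_subset[OF ws(2)] ws(3,4)
      by (intro bexI[of _ "(length ws, ws, y, z)"]) (auto simp: H_def I_def link_False_iff)
  qed (auto simp: H_def split: prod.splits)
  also have "\<dots> = (\<Sum>x\<in>I. q ^ Suc (fst x))"
    by (intro sum.cong) (auto simp: cardH)
  also have "\<dots> = (\<Sum>j\<in>{1..k}. \<Sum>x\<in>Sigma (paths X j) (\<lambda>ws. (set ws \<union> neg ` set ws) \<times> neg ` set ws).
      q ^ Suc j)"
    unfolding I_def using paths_card(1)[OF finX] by (subst sum.Sigma) (auto simp: split_beta)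
  also have "\<dots> = (\<Sum>j\<in>{1..k}. \<Sum>ws\<in>paths X j. \<Sum>yz\<in>(set ws \<union> neg ` set ws) \<times> neg ` set ws. q ^ Suc j)"
    using paths_card(1)[OF finX] by (intro sum.cong refl, subst sum.Sigma) (auto simp: split_beta)
  also have "\<dots> \<le> (\<Sum>j\<in>{1..k}. \<Sum>ws\<in>paths X j. 2 * real k ^ 2 * q ^ Suc j)"
  proof (intro sum_mono)
    fix j ws assume j: "j \<in> {1..k}" and ws: "ws \<in> paths X j"
    have "card (set ws) \<le> k" using card_length[of ws] j ws by (auto simp: paths_def)
    moreover from this have "card (set ws \<union> neg ` set ws) \<le> 2 * k"
      using card_Un_le[of "set ws" "neg ` set ws"] card_image_le[of "set ws" neg] by simp
    moreover have "card (neg ` set ws) \<le> k"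
      using card_image_le[of "set ws" neg] \<open>card (set ws) \<le> k\<close> by simp
    ultimately have "card ((set ws \<union> neg ` set ws) \<times> neg ` set ws) \<le> 2 * k * k"
      unfolding card_cartesian_product by (intro mult_le_mono)
    then have "real (card ((set ws \<union> neg ` set ws) \<times> neg ` set ws)) \<le> real (2 * k * k)"
      by (simp only: of_nat_le_iff)
    also have "real (2 * k * k) = 2 * real k ^ 2" by (simp add: power2_eq_square)
    finally have "real (card ((set ws \<union> neg ` set ws) \<times> neg ` set ws)) \<le> 2 * real k ^ 2" .
    then show "(\<Sum>yz\<in>(set ws \<union> neg ` set ws) \<times> neg ` set ws. q ^ Suc j) \<le> 2 * real k ^ 2 * q ^ Suc j"
      using q_nonneg by (simp only: sum_constant) (intro mult_right_mono, auto)
  qed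
  also have "\<dots> \<le> (\<Sum>j\<in>{1..k}. 2 * real k ^ 2 * q)"
  proof (rule sum_mono)
    fix j assume "j \<in> {1..k}"
    have "(\<Sum>ws\<in>paths X j. 2 * real k ^ 2 * q ^ Suc j) = 2 * real k ^ 2 * (\<Sum>ws\<in>paths X j. q ^ Suc j)"
      by (simp add: sum_distrib_left)
    also have "\<dots> \<le> 2 * real k ^ 2 * ((2 * real (card X)) ^ j * q ^ Suc j)"
      by (intro mult_left_mono sum_paths_le finX q_nonneg) auto
    also have "\<dots> = 2 * real k ^ 2 * q * (2 * card X * q) ^ j"
      by (simp add: power_mult_distrib)
    also have "\<dots> \<le> 2 * real k ^ 2 * q * 1"
      using assms q_nonneg by (intro mult_left_mono power_le_one) auto
    finally show "(\<Sum>ws\<in>paths X j. 2 * real k ^ 2 * q ^ Suc j) \<le> 2 * real k ^ 2 * q" by simp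
  qed
  also have "\<dots> = 2 * real k ^ 3 * q" by (simp add: power2_eq_square power3_eq_cube)
  finally show ?thesis .
qed

text \<open>A contradiction contains a bicycle, and a bicycle with more than k literals contains a
  path with k + 1 literals.\<close>

lemma unif_prob_contra_le:
  assumes "2 * card X * q \<le> 1" "1 \<le> k"
  shows "unif_prob Q m (\<lambda>F. \<exists>l. reach F l (neg l) \<and> reach F (neg l) l) \<le>
    2 * card X * (2 * card X * q) ^ k + 2 * real k ^ 3 * q"
proof -
  have "unif_prob Q m (\<lambda>F. \<exists>l. reach F l (neg l) \<and> reach F (neg l) l) \<le>
      unif_prob Q m (\<lambda>F. (\<exists>us. length us = Suc k \<and> litpath False F us) \<or>
        (\<exists>ws y z. bicycle F ws y z \<and> length ws \<le> k))"
  proof (rule unif_prob_mono[OF finite_Q])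
    fix F :: "'x cnf" assume "\<exists>l. reach F l (neg l) \<and> reach F (neg l) l"
    then obtain ws y z where b: "bicycle F ws y z" using bicycle_of_contra by blast
    show "(\<exists>us. length us = Suc k \<and> litpath False F us) \<or>
        (\<exists>ws y z. bicycle F ws y z \<and> length ws \<le> k)"
    proof (cases "length ws \<le> k")
      case False
      then have "length (take (Suc k) ws) = Suc k" by simp
      moreover have "litpath False F (take (Suc k) ws)"
        using b by (intro litpath_take) (simp add: bicycle_def)
      ultimately show ?thesis by blast
    qed (use b in blast)
  qed
  also have "\<dots> \<le> unif_prob Q m (\<lambda>F. \<exists>us. length us = Suc k \<and> litpath False F us) +
      unif_prob Q m (\<lambda>F. \<exists>ws y z. bicycle F ws y z \<and> length ws \<le> k)"
    by (rule unif_prob_disj[OF finite_Q])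
  also have "\<dots> \<le> 2 * card X * (2 * card X * q) ^ k + 2 * real k ^ 3 * q"
    by (intro add_mono unif_prob_False_path_le unif_prob_bicycle_le assms)
  finally show ?thesis .
qed

text \<open>At most \<open>4 * card X\<close> clauses contain a given variable, and d of them have
  to be present.\<close>

lemma unif_prob_degree_le:
  assumes "1 \<le> d"
  shows "unif_prob Q m (\<lambda>F. \<exists>x. d \<le> card {C \<in> F. x \<in> clause_vars C}) \<le>
    card X * ((4 * card X * q) ^ d / fact d)"
proof -
  define S where "S = (\<lambda>x. {C \<in> Q. x \<in> clause_vars C})"
  have finS: "finite (S x)" for x using finite_Q by (simp add: S_def)
  have cardS: "card (S x) \<le> 4 * card X" for x
  proof -
    have "S x \<subseteq> (\<lambda>(a, b). {a, b}) ` ({Pos x, Neg x} \<times> lits X)"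
    proof
      fix C assume "C \<in> S x"
      then obtain a b where ab: "C = {a, b}" "a \<in> lits X" "b \<in> lits X" "lit_var a = x \<or> lit_var b = x"
        by (auto simp: S_def Q_def two_clauses_iff clause_vars_def lits_def)
      then obtain a' b' where ab': "C = {a', b'}" "lit_var a' = x" "b' \<in> lits X"
        by (metis insert_commute)
      then have "a' \<in> {Pos x, Neg x}" by (cases a') auto
      then show "C \<in> (\<lambda>(a, b). {a, b}) ` ({Pos x, Neg x} \<times> lits X)"
        using ab' by (intro image_eqI[of _ _ "(a', b')"]) auto
    qed
    then have "card (S x) \<le> card ((\<lambda>(a, b). {a, b}) ` ({Pos x, Neg x} \<times> lits X))"
      using finX by (intro card_mono) auto
    also have "\<dots> \<le> card ({Pos x, Neg x} \<times> lits X)"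
      using finX by (intro card_image_le) auto
    also have "\<dots> = 4 * card X"
      using finX by (simp add: card_cartesian_product card_lits)
    finally show ?thesis .
  qed
  define I where "I = Sigma X (\<lambda>x. {H. H \<subseteq> S x \<and> card H = d})"
  have finH: "finite {H. H \<subseteq> S x \<and> card H = d}" for x
    using finS[of x] by (auto intro: finite_subset[of _ "Pow (S x)"])
  have "unif_prob Q m (\<lambda>F. \<exists>x. d \<le> card {C \<in> F. x \<in> clause_vars C}) \<le> (\<Sum>i\<in>I. q ^ card (snd i))"
    unfolding q_eq
  proof (rule unif_prob_first_moment[OF finite_Q m_le_card_Q])
    show "finite I" using finX finH by (auto simp: I_def)
    show "finite (snd i)" if i: "i \<in> I" for i
    proof -
      obtain x where "snd i \<subseteq> S x" using i by (auto simp: I_def)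
      then show ?thesis using finite_subset[OF _ finS] by blast
    qed
    fix F assume "F \<subseteq> Q" "\<exists>x. d \<le> card {C \<in> F. x \<in> clause_vars C}"
    then have F: "F \<subseteq> two_clauses X" "\<exists>x. d \<le> card {C \<in> F. x \<in> clause_vars C}"
      by (simp_all add: Q_def)
    then obtain x where x: "d \<le> card {C \<in> F. x \<in> clause_vars C}" by blast
    then have "{C \<in> F. x \<in> clause_vars C} \<noteq> {}" using assms by (auto simp del: Collect_empty_eq)
    then have "x \<in> X" using F(1) by (auto simp: two_clauses_def)
    obtain H where H: "H \<subseteq> {C \<in> F. x \<in> clause_vars C}" "card H = d"
      using obtain_subset_with_card_n[OF x] by blast
    then have "(x, H) \<in> I" using F(1) \<open>x \<in> X\<close> by (auto simp: I_def S_def Q_def)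
    then show "\<exists>i\<in>I. snd i \<subseteq> F" using H(1) by (intro bexI[of _ "(x, H)"]) auto
  qed
  also have "\<dots> = (\<Sum>x\<in>X. \<Sum>H | H \<subseteq> S x \<and> card H = d. q ^ card H)"
    unfolding I_def using finX finH by (subst sum.Sigma) (auto simp: split_beta)
  also have "\<dots> \<le> (\<Sum>x\<in>X. (4 * card X * q) ^ d / fact d)"
  proof (rule sum_mono)
    fix x
    have "(\<Sum>H | H \<subseteq> S x \<and> card H = d. q ^ card H) = real (card (S x) choose d) * q ^ d"
      using finS[of x] by (simp add: n_subsets)
    also have "real (card (S x) choose d) \<le> real (4 * card X) ^ d / fact d"
    proof -
      have "(card (S x) choose d) * fact d \<le> card (S x) ^ d" by (rule binomial_fact_pow)
      also have "\<dots> \<le> (4 * card X) ^ d" by (rule power_mono[OF cardS]) simp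
      finally have "real ((card (S x) choose d) * fact d) \<le> real ((4 * card X) ^ d)"
        by (simp only: of_nat_le_iff)
      then show ?thesis by (simp add: field_simps)
    qed
    finally show "(\<Sum>H | H \<subseteq> S x \<and> card H = d. q ^ card H) \<le> (4 * card X * q) ^ d / fact d"
      using q_nonneg by (simp add: power_mult_distrib mult_right_mono)
  qed
  finally show ?thesis by simp
qed

end

subsection \<open>Diagrams along a depth-first order\<close>

text \<open>The list is the order of discovery. A visited vertex with an unvisited neighbour is
  still on the stack, and the stack is always a path; \<open>S\<close> and \<open>U\<close> describe
  the state from which the search continues.\<close>

lemma dfs_order_from:
  assumes "finite T" "distinct U" "set U \<inter> T = {}" "successively (\<lambda>v u. adj u v) U"
    "\<And>x y. x \<in> S \<Longrightarrow> y \<in> T \<Longrightarrow> \<not> adj x y"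
  shows "\<exists>ys. distinct ys \<and> set ys = T \<and> (\<forall>i\<le>length ys. \<exists>p. distinct p \<and> successively adj p \<and>
    {x \<in> S \<union> set U \<union> set (take i ys). \<exists>y\<in>set (drop i ys). adj x y} \<subseteq> set p)"
  using assms
proof (induction "2 * card T + length U" arbitrary: S U T rule: less_induct)
  case less
  show ?case
  proof (cases "T = {}")
    case True
    then show ?thesis by (intro exI[of _ "[]"]) (auto intro: exI[of _ "[]"])
  next
    case False
    then have cT: "card T > 0" using less.prems(1) by (simp add: card_gt_0_iff)
    have pushed: ?thesis
      if t: "t \<in> T" and chain: "successively (\<lambda>v u. adj u v) (t # U)" for t
    proof -
      have "2 * card (T - {t}) + length (t # U) < 2 * card T + length U"
        using t cT less.prems(1) by (simp add: card_Diff_singleton)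
      then have "\<exists>ys. distinct ys \<and> set ys = T - {t} \<and> (\<forall>i\<le>length ys. \<exists>p. distinct p \<and>
          successively adj p \<and>
          {x \<in> S \<union> set (t # U) \<union> set (take i ys). \<exists>y\<in>set (drop i ys). adj x y} \<subseteq> set p)"
        by (rule less.hyps[OF _ _ _ _ chain]) (use less.prems t in auto)
      then obtain ys where ys: "distinct ys" "set ys = T - {t}"
        "\<And>i. i \<le> length ys \<Longrightarrow> \<exists>p. distinct p \<and> successively adj p \<and>
          {x \<in> S \<union> set (t # U) \<union> set (take i ys). \<exists>y\<in>set (drop i ys). adj x y} \<subseteq> set p"
        by blast
      show ?thesis
      proof (rule exI[of _ "t # ys"], intro conjI allI impI)
        show "distinct (t # ys)" "set (t # ys) = T" using ys(1,2) t by auto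
        fix i assume i: "i \<le> length (t # ys)"
        show "\<exists>p. distinct p \<and> successively adj p \<and> {x \<in> S \<union> set U \<union> set (take i (t # ys)).
            \<exists>y\<in>set (drop i (t # ys)). adj x y} \<subseteq> set p"
        proof (cases i)
          \<comment> \<open>Exhausted vertices have no neighbour in \<open>T\<close>, so the current
            stack, read from bottom to top, is the path.\<close>
          case 0
          have "distinct (rev U)" "successively adj (rev U)"
            using less.prems(2,4) by (simp_all add: successively_rev)
          moreover have "{x \<in> S \<union> set U \<union> set (take i (t # ys)).
              \<exists>y\<in>set (drop i (t # ys)). adj x y} \<subseteq> set (rev U)"
            using 0 ys(2) t less.prems(5) by auto
          ultimately show ?thesis by blast
        next
          case (Suc j)
          have eq: "{x \<in> S \<union> set U \<union> set (take i (t # ys)). \<exists>y\<in>set (drop i (t # ys)). adj x y} =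
            {x \<in> S \<union> set (t # U) \<union> set (take j ys). \<exists>y\<in>set (drop j ys). adj x y}"
            using Suc by auto
          show ?thesis unfolding eq by (rule ys(3)) (use i Suc in simp)
        qed
      qed
    qed
    show ?thesis
    proof (cases U)
      case Nil
      obtain t where "t \<in> T" using False by blast
      then show ?thesis using pushed[of t] Nil by simp
    next
      case (Cons u U')
      show ?thesis
      proof (cases "\<exists>t\<in>T. adj u t")
        case True
        then obtain t where "t \<in> T" "adj u t" by blast
        then show ?thesis using pushed[of t] Cons less.prems(4) by simp
      next
        case False
        have succ: "successively (\<lambda>v u. adj u v) U'"
          using less.prems(4) Cons by (cases U') auto
        have "2 * card T + length U' < 2 * card T + length U" using Cons by simp
        then have "\<exists>ys. distinct ys \<and> set ys = T \<and> (\<forall>i\<le>length ys. \<exists>p. distinct p \<and>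
            successively adj p \<and>
            {x \<in> insert u S \<union> set U' \<union> set (take i ys). \<exists>y\<in>set (drop i ys). adj x y} \<subseteq> set p)"
          by (rule less.hyps[OF _ _ _ _ succ]) (use less.prems Cons False in auto)
        then obtain ys where ys: "distinct ys" "set ys = T"
          "\<And>i. i \<le> length ys \<Longrightarrow> \<exists>p. distinct p \<and> successively adj p \<and>
            {x \<in> insert u S \<union> set U' \<union> set (take i ys). \<exists>y\<in>set (drop i ys). adj x y} \<subseteq> set p"
          by blast
        have "insert u S \<union> set U' = S \<union> set U" using Cons by auto
        then show ?thesis using ys by (intro exI[of _ ys]) auto
      qed
    qed
  qed
qed

definition adjacent :: "'x cnf \<Rightarrow> 'x \<Rightarrow> 'x \<Rightarrow> bool" where
  "adjacent F x y \<longleftrightarrow> (\<exists>a b. {a, b} \<in> F \<and> lit_var a = x \<and> lit_var b = y)"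

text \<open>Each new literal takes its sign from the clause that connects it, and
  \<open>link True\<close> accepts either sign of its predecessor.\<close>

lemma adjacent_path_imp_litpath:
  assumes "successively (adjacent F) p"
  shows "\<exists>us. map lit_var us = p \<and> successively (link True F) us"
  using assms
proof (induction p rule: rev_induct)
  case (snoc y p)
  then obtain us where us: "map lit_var us = p" "successively (link True F) us"
    by (auto simp: successively_append_iff)
  show ?case
  proof (cases "us = []")
    case True
    then show ?thesis using us by (intro exI[of _ "[Pos y]"]) auto
  next
    case False
    then have "adjacent F (lit_var (last us)) y"
      using snoc.prems us(1) by (auto simp: successively_append_iff last_map)
    then obtain a b where ab: "{a, b} \<in> F" "lit_var a = lit_var (last us)" "lit_var b = y"
      by (auto simp: adjacent_def)
    then have "link True F (last us) b"
      using lit_var_eqD[OF ab(2)] by (auto simp: link_def link_clauses_def)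
    then show ?thesis using us ab(3) False
      by (intro exI[of _ "us @ [b]"]) (auto simp: successively_append_iff)
  qed
qed simp

text \<open>If \<alpha> falsifies a clause inside \<open>A\<close>, the subfunction is constantly
  false. Otherwise these clauses are settled, and the remaining ones depend on \<alpha> only through
  variables in \<open>act\<close>.\<close>

lemma card_range_subfun_le:
  assumes "F \<subseteq> two_clauses X"
    and act: "finite act" "{x \<in> A. \<exists>y\<in>cnf_vars F - A. adjacent F x y} \<subseteq> act"
  shows "card (range (subfun (cnf_vars F) (\<lambda>\<alpha>. satisfies \<alpha> F) A)) \<le> 1 + 2 ^ card act"
proof -
  define V where "V = cnf_vars F"
  define out where "out = {C \<in> F. \<not> clause_vars C \<subseteq> A}"
  define \<Phi> where "\<Phi> = (\<lambda>\<gamma> \<beta>. \<forall>C\<in>out. \<exists>l\<in>C. lit_holds (mix V A \<gamma> \<beta>) l)"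
  have hold_cong: "lit_holds \<alpha> l = lit_holds \<beta> l" if "\<alpha> (lit_var l) = \<beta> (lit_var l)"
    for \<alpha> \<beta> :: "'a \<Rightarrow> bool" and l using that by (cases l) auto
  have "subfun V (\<lambda>\<alpha>. satisfies \<alpha> F) A \<alpha> \<in>
      insert (\<lambda>_. False) (\<Phi> ` (act \<rightarrow>\<^sub>E UNIV))" for \<alpha>
  proof (cases "\<forall>C\<in>F - out. \<exists>l\<in>C. lit_holds \<alpha> l")
    case inner: True
    have "subfun V (\<lambda>\<alpha>. satisfies \<alpha> F) A \<alpha> \<beta> = \<Phi> (restrict \<alpha> act) \<beta>" for \<beta>
    proof -
      have in1: "lit_holds (mix V A \<alpha> \<beta>) l = lit_holds \<alpha> l" if "C \<in> F - out" "l \<in> C" for C l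
      proof (rule hold_cong)
        have "lit_var l \<in> A" "lit_var l \<in> V"
          using that by (auto simp: out_def clause_vars_def V_def cnf_vars_def)
        then show "mix V A \<alpha> \<beta> (lit_var l) = \<alpha> (lit_var l)" by (simp add: mix_def)
      qed
      have in2: "lit_holds (mix V A \<alpha> \<beta>) l = lit_holds (mix V A (restrict \<alpha> act) \<beta>) l"
        if C: "C \<in> out" "l \<in> C" for C l
      proof (rule hold_cong)
        have "lit_var l \<in> act" if lA: "lit_var l \<in> A"
        proof -
          obtain l' where l': "l' \<in> C" "lit_var l' \<notin> A" using C(1) by (auto simp: out_def clause_vars_def)
          have CF: "C \<in> F" using C(1) by (simp add: out_def)
          then have "C \<in> two_clauses X" using assms(1) by blast
          then obtain a b where "C = {a, b}" unfolding two_clauses_iff by blast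
          then have "C = {l, l'}" using l' C(2) lA by auto
          then have "adjacent F (lit_var l) (lit_var l')"
            using CF unfolding adjacent_def by blast
          moreover have "lit_var l' \<in> cnf_vars F - A"
            using l' CF by (auto simp: cnf_vars_def clause_vars_def)
          ultimately show ?thesis using act(2) lA by blast
        qed
        then show "mix V A \<alpha> \<beta> (lit_var l) = mix V A (restrict \<alpha> act) \<beta> (lit_var l)"
          by (simp add: mix_def restrict_def)
      qed
      have "satisfies (mix V A \<alpha> \<beta>) F \<longleftrightarrow>
          (\<forall>C\<in>F - out. \<exists>l\<in>C. lit_holds (mix V A \<alpha> \<beta>) l) \<and> (\<forall>C\<in>out. \<exists>l\<in>C. lit_holds (mix V A \<alpha> \<beta>) l)"
        by (auto simp: satisfies_def out_def)
      moreover have "\<forall>C\<in>F - out. \<exists>l\<in>C. lit_holds (mix V A \<alpha> \<beta>) l"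
        using in1 inner by blast
      moreover have "(\<forall>C\<in>out. \<exists>l\<in>C. lit_holds (mix V A \<alpha> \<beta>) l) = \<Phi> (restrict \<alpha> act) \<beta>"
        unfolding \<Phi>_def using in2 by blast
      ultimately show ?thesis unfolding subfun_def by blast
    qed
    then have "subfun V (\<lambda>\<alpha>. satisfies \<alpha> F) A \<alpha> = \<Phi> (restrict \<alpha> act)" by blast
    moreover have "restrict \<alpha> act \<in> act \<rightarrow>\<^sub>E UNIV" by simp
    ultimately show ?thesis by blast
  next
    case False
    then obtain C where C: "C \<in> F" "clause_vars C \<subseteq> A" "\<forall>l\<in>C. \<not> lit_holds \<alpha> l"
      by (auto simp: out_def)
    have "\<not> satisfies (mix V A \<alpha> \<beta>) F" for \<beta>
    proof
      assume "satisfies (mix V A \<alpha> \<beta>) F"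
      then obtain l where l: "l \<in> C" "lit_holds (mix V A \<alpha> \<beta>) l"
        using C(1) unfolding satisfies_def by blast
      have "lit_var l \<in> A" "lit_var l \<in> V"
        using l(1) C(1,2) by (auto simp: clause_vars_def V_def cnf_vars_def)
      then have "mix V A \<alpha> \<beta> (lit_var l) = \<alpha> (lit_var l)" by (simp add: mix_def)
      then have "lit_holds \<alpha> l" using hold_cong l(2) by blast
      then show False using C(3) l(1) by blast
    qed
    then have "subfun V (\<lambda>\<alpha>. satisfies \<alpha> F) A \<alpha> = (\<lambda>_. False)"
      by (simp add: subfun_def fun_eq_iff)
    then show ?thesis by simp
  qed
  then have sub: "range (subfun V (\<lambda>\<alpha>. satisfies \<alpha> F) A) \<subseteq>
      insert (\<lambda>_. False) (\<Phi> ` (act \<rightarrow>\<^sub>E UNIV))" by blast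
  have fin: "finite (act \<rightarrow>\<^sub>E (UNIV :: bool set))" using act(1) by (intro finite_PiE) auto
  have "card (range (subfun V (\<lambda>\<alpha>. satisfies \<alpha> F) A)) \<le>
      card (insert (\<lambda>_. False) (\<Phi> ` (act \<rightarrow>\<^sub>E UNIV)))"
    using sub fin by (intro card_mono) auto
  also have "\<dots> \<le> Suc (card (\<Phi> ` (act \<rightarrow>\<^sub>E UNIV)))"
    by (rule card_insert_le_m1) auto
  also have "\<dots> \<le> Suc (card (act \<rightarrow>\<^sub>E (UNIV :: bool set)))"
    using card_image_le[OF fin, of \<Phi>] by simp
  also have "\<dots> = 1 + 2 ^ card act" using act(1) by (simp add: card_PiE)
  finally show ?thesis by (simp add: V_def)
qed

lemma cnf_obdd_size_le:
  fixes X :: "nat set"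
  assumes "finite X" "F \<subseteq> two_clauses X"
    and short: "\<And>us. length us = Suc L \<Longrightarrow> \<not> litpath True F us"
  shows "cnf_obdd_size F \<le> (card X + 1) * (1 + 2 ^ L)"
proof -
  have VX: "cnf_vars F \<subseteq> X"
    using assms(2) by (force simp: cnf_vars_def two_clauses_def)
  then have finV: "finite (cnf_vars F)" using assms(1) finite_subset by blast
  have path: "length p \<le> L" if p: "distinct p" "successively (adjacent F) p" for p
  proof (rule ccontr)
    assume len: "\<not> length p \<le> L"
    obtain us where us: "map lit_var us = p" "successively (link True F) us"
      using adjacent_path_imp_litpath[OF p(2)] by blast
    then have "litpath True F us" using p(1) by (simp add: litpath_def)
    then have "litpath True F (take (Suc L) us)" by (rule litpath_take)
    moreover have "length us = length p" using us(1) by auto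
    then have "length (take (Suc L) us) = Suc L" using len by simp
    ultimately show False using short by blast
  qed
  obtain xs where xs: "distinct xs" "set xs = cnf_vars F"
    "\<And>i. i \<le> length xs \<Longrightarrow> \<exists>p. distinct p \<and> successively (adjacent F) p \<and>
      {x \<in> set (take i xs). \<exists>y\<in>set (drop i xs). adjacent F x y} \<subseteq> set p"
    using dfs_order_from[OF finV, of "[]" "adjacent F" "{}"] by auto
  have "card (range (subfun (cnf_vars F) (\<lambda>\<alpha>. satisfies \<alpha> F) (set (take i xs)))) \<le> 1 + 2 ^ L"
    if i: "i \<le> length xs" for i
  proof -
    obtain p where p: "distinct p" "successively (adjacent F) p"
      "{x \<in> set (take i xs). \<exists>y\<in>set (drop i xs). adjacent F x y} \<subseteq> set p"
      using xs(3)[OF i] by blast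
    have "set xs = set (take i xs) \<union> set (drop i xs)" by (metis append_take_drop_id set_append)
    then have "{x \<in> set (take i xs). \<exists>y\<in>cnf_vars F - set (take i xs). adjacent F x y} \<subseteq> set p"
      using p(3) xs(2) by blast
    then have "card (range (subfun (cnf_vars F) (\<lambda>\<alpha>. satisfies \<alpha> F) (set (take i xs)))) \<le>
        1 + 2 ^ card (set p)"
      by (intro card_range_subfun_le[OF assms(2)]) auto
    also have "\<dots> \<le> 1 + 2 ^ L"
      using path[OF p(1,2)] p(1) by (simp add: distinct_card power_increasing)
    finally show ?thesis .
  qed
  then have "(\<Sum>i\<le>length xs. card (range (subfun (cnf_vars F) (\<lambda>\<alpha>. satisfies \<alpha> F) (set (take i xs))))) \<le>
      (\<Sum>i\<le>length xs. 1 + 2 ^ L)"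
    by (intro sum_mono) auto
  then have "cnf_obdd_size F \<le> (\<Sum>i\<le>length xs. 1 + 2 ^ L)"
    unfolding cnf_obdd_size_def using obdd_size_le[OF xs(1,2)] by (meson order_trans)
  also have "\<dots> = (length xs + 1) * (1 + 2 ^ L)" by simp
  also have "\<dots> \<le> (card X + 1) * (1 + 2 ^ L)"
  proof -
    have "length xs = card (cnf_vars F)" using xs(1,2) by (metis distinct_card)
    also have "\<dots> \<le> card X" by (rule card_mono[OF assms(1) VX])
    finally show ?thesis by (intro mult_le_mono1) simp
  qed
  finally show ?thesis .
qed

subsection \<open>Asymptotics\<close>

lemma prob_random_2cnf_tendsto_1:
  assumes "\<forall>\<^sub>F n in sequentially. m n \<le> card (two_clauses {1..n})"
    and "\<forall>\<^sub>F n in sequentially. unif_prob (two_clauses {1..n}) (m n) (\<lambda>F. F \<notin> A n) \<le> e n"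
    and "e \<longlonglongrightarrow> 0"
  shows "(\<lambda>n. measure_pmf.prob (random_2cnf n (m n)) (A n)) \<longlonglongrightarrow> 1"
proof (rule tendsto_sandwich)
  show "\<forall>\<^sub>F n in sequentially. 1 - e n \<le> measure_pmf.prob (random_2cnf n (m n)) (A n)"
    using assms(1,2)
  proof eventually_elim
    case (elim n)
    then show ?case
      using unif_prob_Not[of "two_clauses {1..n}" "m n" "\<lambda>F. F \<in> A n"] by (simp add: prob_random_2cnf)
  qed
  show "\<forall>\<^sub>F n in sequentially. measure_pmf.prob (random_2cnf n (m n)) (A n) \<le> 1"
    by simp
  show "(\<lambda>n. 1 - e n) \<longlonglongrightarrow> 1"
    using tendsto_diff[OF tendsto_const assms(3), of 1] by simp
qed simp

lemma card_two_clauses_real: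
  "real (card (two_clauses {1..n})) = 2 * real n * (real n - 1)"
  by (cases n) (simp_all add: card_two_clauses algebra_simps)

lemma eventually_m_le:
  "\<forall>\<^sub>F n in sequentially. nat \<lfloor>\<delta> * real n\<rfloor> \<le> card (two_clauses {1..n})"
proof -
  have "\<forall>\<^sub>F n in sequentially. \<delta> * real n \<le> 2 * real n * (real n - 1)"
    by real_asymp
  moreover have "\<forall>\<^sub>F n in sequentially. (0::real) \<le> 2 * real n * (real n - 1)"
    by real_asymp
  ultimately show ?thesis
  proof eventually_elim
    case (elim n)
    then have "real (nat \<lfloor>\<delta> * real n\<rfloor>) \<le> real (card (two_clauses {1..n}))"
      unfolding card_two_clauses_real by linarith
    then show ?case by simp
  qed
qed

text \<open>For n \<ge> 2 the left side equals m / (n - 1) with m the number of clauses, and this is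
  at most a quantity tending to \<delta>.\<close>

lemma eventually_density_le:
  assumes "0 \<le> \<delta>" "\<delta> < \<rho>"
  shows "\<forall>\<^sub>F n in sequentially.
    2 * real (card {1..n}) * (real (nat \<lfloor>\<delta> * real n\<rfloor>) / real (card (two_clauses {1..n}))) \<le> \<rho>"
proof -
  have "(\<lambda>n. \<delta> * real n / (real n - 1)) \<longlonglongrightarrow> \<delta>"
    by real_asymp
  then have "\<forall>\<^sub>F n in sequentially. \<delta> * real n / (real n - 1) < \<rho>"
    using assms(2) by (rule order_tendstoD)
  then show ?thesis
    using eventually_ge_at_top[of 2]
  proof eventually_elim
    case (elim n)
    have "real (nat \<lfloor>\<delta> * real n\<rfloor>) \<le> \<delta> * real n"
      using assms(1) by simp
    then have "real (nat \<lfloor>\<delta> * real n\<rfloor>) / (real n - 1) \<le> \<delta> * real n / (real n - 1)"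
      using elim by (intro divide_right_mono) auto
    moreover have "2 * real (card {1..n}) * (real (nat \<lfloor>\<delta> * real n\<rfloor>) / real (card (two_clauses {1..n})))
        = real (nat \<lfloor>\<delta> * real n\<rfloor>) / (real n - 1)"
      unfolding card_two_clauses_real using elim by (simp add: field_simps)
    ultimately show ?case using elim by linarith
  qed
qed

text \<open>With s about x n, L at most x^2 n and z = 1 - x, about \<kappa> s (n - s - L) queries
  find (1 + \<theta>) x n (1 - x - x^2) clauses on average. For small x this exceeds s + L, and the
  Chernoff exponent is linear in n.\<close>

lemma bern_expect_no_path_le:
  assumes "0 < (\<theta>::real)"
  obtains \<gamma> \<nu> K :: real where "0 < \<gamma>" "0 < \<nu>"
    "\<And>n L b. 2 \<le> n \<Longrightarrow> 2 \<le> L \<Longrightarrow> real L \<le> \<gamma> * real n \<Longrightarrow>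
      (1 + \<theta>) / ((if b then 4 else 2) * real n) \<le> 1 \<Longrightarrow>
      bern_expect ((1 + \<theta>) / ((if b then 4 else 2) * real n)) (two_clauses {1..n})
        (\<lambda>F. of_bool (\<not> (\<exists>us. length us = L \<and> litpath b F us))) \<le> exp (K - \<nu> * real n)"
proof -
  \<comment> \<open>The bound 1/10 keeps s + L below n; the other one makes the error x (7 + 2
    \<theta>) at most \<theta> / 2, as needed for \<open>key\<close>.\<close>
  define x where "x = min (1 / 10) (\<theta> / (14 + 4 * \<theta>))"
  have x: "0 < x" using assms by (simp add: x_def)
  have x': "x \<le> 1 / 10" unfolding x_def by (rule min.cobounded1)
  note x = x x'
  have "x \<le> \<theta> / (14 + 4 * \<theta>)" by (simp add: x_def)
  then have x\<theta>: "x * (7 + 2 * \<theta>) \<le> \<theta> / 2"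
    using assms by (simp add: field_simps)
  define c where "c = 1 + \<theta>"
  have c: "0 < c" using assms by (simp add: c_def)
  have xx: "x * x \<le> x" using x by (simp add: mult_left_le)
  \<comment> \<open>In units of x^2 n, the product (1 + x) (1 + 2 x) is the cost of s + L in the
    exponent and c (1 - x - x^2) the gain from the queries.\<close>
  have key: "(1 + x) * (1 + 2 * x) - c * (1 - x - x\<^sup>2) \<le> - \<theta> / 2"
  proof -
    have "(1 + x) * (1 + 2 * x) \<le> 1 + 5 * x" using xx by (simp add: power2_eq_square algebra_simps)
    moreover have "c * (1 - 2 * x) \<le> c * (1 - x - x\<^sup>2)"
      using xx c by (intro mult_left_mono) (simp_all add: power2_eq_square)
    moreover have "1 + 5 * x - c * (1 - 2 * x) \<le> - \<theta> / 2"
      using x\<theta> by (simp add: c_def algebra_simps)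
    ultimately show ?thesis by linarith
  qed
  define \<gamma> where "\<gamma> = x\<^sup>2"
  define \<nu> where "\<nu> = x\<^sup>2 * \<theta> / 2"
  \<comment> \<open>The three summands collect the rounding errors in s, in w and in M, in this
    order.\<close>
  define K where "K = (x + 2 * x\<^sup>2) + c * x\<^sup>2 + c * x"
  show ?thesis
  proof (rule that[of \<gamma> \<nu> K])
    show "0 < \<gamma>" "0 < \<nu>" using x assms by (simp_all add: \<gamma>_def \<nu>_def)
    fix n L :: nat and b :: bool
    assume n: "2 \<le> n" and L: "2 \<le> L" "real L \<le> \<gamma> * real n"
      and p1: "(1 + \<theta>) / ((if b then 4 else 2) * real n) \<le> 1"
    define \<kappa> :: nat where "\<kappa> = (if b then 4 else 2)"
    have \<kappa>: "real \<kappa> = (if b then 4 else 2)" "1 \<le> real \<kappa>" by (simp_all add: \<kappa>_def)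
    define p where "p = c / (real \<kappa> * real n)"
    have p: "0 \<le> p" "p \<le> 1" using p1 c n by (simp_all add: p_def c_def \<kappa>)
    define s where "s = nat \<lceil>x * real n\<rceil>"
    have s: "x * real n \<le> real s" "real s \<le> x * real n + 1"
      using x by (simp_all add: s_def real_nat_ceiling_ge)
    have s0: "0 < s" using x n by (simp add: s_def)
    have xn: "x * real n \<le> real n / 10" using mult_right_mono[OF x', of "real n"] by simp
    have xxn: "x\<^sup>2 * real n \<le> real n / 100"
    proof -
      have "x\<^sup>2 \<le> (1 / 10)\<^sup>2" using x by (intro power_mono) auto
      then have "x\<^sup>2 * real n \<le> (1 / 10)\<^sup>2 * real n" by (rule mult_right_mono) simp
      then show ?thesis by (simp add: power2_eq_square)
    qed
    have lt: "s + L < n" using s(2) L(2) xn xxn n unfolding \<gamma>_def by linarith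
    define w where "w = n - s - L"
    have w: "real w = real n - real s - real L" "1 \<le> w" using lt by (simp_all add: w_def)
    have w_ge: "real w \<ge> real n * (1 - x - x\<^sup>2) - 1"
      using w(1) s(2) L(2) by (simp add: \<gamma>_def algebra_simps)
    define M where "M = \<kappa> * s * w - 1"
    have prod1: "1 \<le> \<kappa> * s * w" using s0 w(2) by (simp add: \<kappa>_def)
    have M: "M < (if b then 4 else 2) * s * (card {1..n} - s - L)"
    proof -
      have "M < \<kappa> * s * w" using prod1 unfolding M_def by linarith
      then show ?thesis unfolding \<kappa>_def w_def by simp
    qed
    have Mr: "real M = real \<kappa> * real s * real w - 1"
      using prod1 by (simp add: M_def of_nat_diff)
    have "bern_expect p (two_clauses {1..n}) (\<lambda>F. of_bool (\<not> (\<exists>us. length us = L \<and> litpath b F us))) \<le>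
        (1 / (1 - x)) ^ (s + L) * (1 - p * (1 - (1 - x))) ^ M"
      by (rule long_litpath_bound[OF p _ _ L(1) _ s0 M]) (use x in auto)
    also have "\<dots> \<le> exp (real (s + L) * (x + 2 * x\<^sup>2)) * exp (- (p * x * real M))"
    proof (rule mult_mono)
      have "- x - 2 * x\<^sup>2 \<le> ln (1 - x)" using ln_one_minus_pos_lower_bound[of x] x by simp
      then have "exp (- x - 2 * x\<^sup>2) \<le> 1 - x" using x by (subst (asm) ln_ge_iff) auto
      then have "1 / (1 - x) \<le> 1 / exp (- x - 2 * x\<^sup>2)"
        using x by (intro divide_left_mono) auto
      also have "\<dots> = exp (x + 2 * x\<^sup>2)" by (simp add: exp_minus[symmetric] inverse_eq_divide[symmetric])
      finally have "(1 / (1 - x)) ^ (s + L) \<le> exp (x + 2 * x\<^sup>2) ^ (s + L)"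
        using x by (intro power_mono) auto
      then show "(1 / (1 - x)) ^ (s + L) \<le> exp (real (s + L) * (x + 2 * x\<^sup>2))"
        by (simp only: exp_of_nat_mult)
      have "p * x \<le> 1" using p x by (intro mult_le_one) auto
      then have "(1 - p * x) ^ M \<le> exp (- (p * x)) ^ M"
        using exp_ge_add_one_self[of "- (p * x)"] by (intro power_mono) auto
      also have "\<dots> = exp (- (p * x * real M))" by (simp add: exp_of_nat_mult[symmetric] mult.commute)
      finally show "(1 - p * (1 - (1 - x))) ^ M \<le> exp (- (p * x * real M))" by simp
    qed (use p x in \<open>auto intro!: zero_le_power simp: mult_le_one\<close>)
    also have "\<dots> = exp (real (s + L) * (x + 2 * x\<^sup>2) - p * x * real M)"
      by (simp add: exp_add[symmetric])
    also have "\<dots> \<le> exp (K - \<nu> * real n)"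
    proof -
      have 1: "real (s + L) * (x + 2 * x\<^sup>2) \<le> (x * real n + 1 + x\<^sup>2 * real n) * (x + 2 * x\<^sup>2)"
        using s(2) L(2) x by (intro mult_right_mono) (auto simp: \<gamma>_def)
      have n0: "0 < real n" using n by simp
      have "p * x * real M = c * x * (real s * real w / real n) - c * x / (real \<kappa> * real n)"
        using n0 \<kappa>(2) unfolding Mr p_def by (simp add: field_simps)
      moreover have "c * x / (real \<kappa> * real n) \<le> c * x"
      proof -
        have "1 * 1 \<le> real \<kappa> * real n" using \<kappa>(2) n by (intro mult_mono) auto
        then show ?thesis using c x by (simp add: divide_le_eq mult_left_le)
      qed
      moreover have "c * x * (x * (real n * (1 - x - x\<^sup>2) - 1)) \<le> c * x * (real s * real w / real n)"
      proof (rule mult_left_mono)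
        have "x * (real n * (1 - x - x\<^sup>2) - 1) \<le> x * real w"
          using w_ge x by (intro mult_left_mono) auto
        also have "\<dots> \<le> real s / real n * real w"
          using s(1) n0 by (intro mult_right_mono) (auto simp: field_simps)
        finally show "x * (real n * (1 - x - x\<^sup>2) - 1) \<le> real s * real w / real n" by simp
      qed (use c x in simp)
      ultimately have "real (s + L) * (x + 2 * x\<^sup>2) - p * x * real M \<le>
          (x * real n + 1 + x\<^sup>2 * real n) * (x + 2 * x\<^sup>2) -
          (c * x * (x * (real n * (1 - x - x\<^sup>2) - 1)) - c * x)"
        using 1 by linarith
      also have "\<dots> = x\<^sup>2 * real n * ((1 + x) * (1 + 2 * x) - c * (1 - x - x\<^sup>2)) + K"
        by (simp add: K_def power2_eq_square algebra_simps)
      also have "\<dots> \<le> x\<^sup>2 * real n * (- \<theta> / 2) + K"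
        using key by (intro add_right_mono mult_left_mono) auto
      also have "\<dots> = K - \<nu> * real n" by (simp add: \<nu>_def)
      finally show ?thesis by simp
    qed
    finally show "bern_expect ((1 + \<theta>) / ((if b then 4 else 2) * real n)) (two_clauses {1..n})
        (\<lambda>F. of_bool (\<not> (\<exists>us. length us = L \<and> litpath b F us))) \<le> exp (K - \<nu> * real n)"
      by (simp add: p_def c_def \<kappa>)
  qed
qed

text \<open>The density \<open>2 (1 + 3\<theta>) / k\<close> leaves room for two rounds of exposure with clause
  probabilities \<open>(1 + \<theta>) / (k n)\<close> and \<open>\<theta> / (k n)\<close>.\<close>

lemma unif_prob_le_two_rounds:
  fixes \<theta> k :: real
  assumes "0 < \<theta>" "0 < k" "1 \<le> n" "(1 + \<theta>) / (k * real n) \<le> 1" "\<theta> / (k * real n) \<le> 1"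
    and "nat \<lfloor>2 * (1 + 3 * \<theta>) / k * real n\<rfloor> \<le> card (two_clauses {1..n})"
    and dec: "\<And>F G. F \<subseteq> G \<Longrightarrow> G \<subseteq> two_clauses {1..n} \<Longrightarrow> P G \<Longrightarrow> P F"
  shows "unif_prob (two_clauses {1..n}) (nat \<lfloor>2 * (1 + 3 * \<theta>) / k * real n\<rfloor>) P \<le>
    (1 + 3 * \<theta>) / \<theta> * bern_expect ((1 + \<theta>) / (k * real n) + \<theta> / (k * real n) -
      (1 + \<theta>) / (k * real n) * (\<theta> / (k * real n))) (two_clauses {1..n}) (\<lambda>F. of_bool (P F))"
proof -
  define p where "p = (1 + \<theta>) / (k * real n)"
  define q where "q = \<theta> / (k * real n)"
  define m where "m = nat \<lfloor>2 * (1 + 3 * \<theta>) / k * real n\<rfloor>"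
  define N where "N = real (card (two_clauses {1..n}))"
  define u where "u = unif_prob (two_clauses {1..n}) m P"
  have pq: "0 \<le> p" "p \<le> 1" "0 \<le> q" "q \<le> 1"
    using assms by (simp_all add: p_def q_def)
  have r1: "p + q - p * q \<le> 1"
  proof -
    have "0 \<le> (1 - p) * (1 - q)" using pq by simp
    then show ?thesis by (simp add: algebra_simps)
  qed
  have r0: "0 \<le> p + q - p * q"
    using pq mult_left_le[of q p] by simp
  \<comment> \<open>The expected size stays below m + 1 by this factor, so the binomial set has at
    most m elements with probability at least \<theta> / (1 + 3 \<theta>).\<close>
  have "(p + q - p * q) * N / real (Suc m) \<le> (1 + 2 * \<theta>) / (1 + 3 * \<theta>)"
  proof -
    have n: "0 < real n" using assms(3) by simp
    have N: "0 \<le> N" "N \<le> 2 * real n * real n"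
    proof -
      have "N = 2 * real n * (real n - 1)" by (simp only: N_def card_two_clauses_real)
      also have "\<dots> \<le> 2 * real n * real n" by (intro mult_left_mono) auto
      finally show "N \<le> 2 * real n * real n" .
    qed (simp add: N_def)
    have "(p + q - p * q) * N \<le> (1 + 2 * \<theta>) / (k * real n) * N"
    proof (rule mult_right_mono[OF _ N(1)])
      have "p + q = (1 + 2 * \<theta>) / (k * real n)"
        by (simp add: p_def q_def add_divide_distrib[symmetric])
      then show "p + q - p * q \<le> (1 + 2 * \<theta>) / (k * real n)" using pq by simp
    qed
    also have "\<dots> \<le> (1 + 2 * \<theta>) / (k * real n) * (2 * real n * real n)"
      using assms N by (intro mult_left_mono) auto
    also have "\<dots> = (1 + 2 * \<theta>) * (2 * real n / k)"
      using n assms by (simp add: field_simps)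
    finally have 1: "(p + q - p * q) * N \<le> (1 + 2 * \<theta>) * (2 * real n / k)" .
    have 2: "(1 + 3 * \<theta>) * (2 * real n / k) \<le> real (Suc m)"
    proof -
      have "2 * (1 + 3 * \<theta>) / k * real n \<le> real (Suc m)" unfolding m_def by linarith
      then show ?thesis by (simp add: algebra_simps)
    qed
    have pos: "0 < 2 * real n / k" using n assms by simp
    have "(p + q - p * q) * N / real (Suc m) \<le> (1 + 2 * \<theta>) * (2 * real n / k) / real (Suc m)"
      using 1 by (intro divide_right_mono) auto
    also have "\<dots> \<le> (1 + 2 * \<theta>) * (2 * real n / k) / ((1 + 3 * \<theta>) * (2 * real n / k))"
      using 2 pos assms(1,2) by (intro divide_left_mono mult_pos_pos) auto
    also have "\<dots> = (1 + 2 * \<theta>) / (1 + 3 * \<theta>)" using n assms(2) by simp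
    finally show ?thesis .
  qed
  then have "\<theta> / (1 + 3 * \<theta>) \<le> 1 - (p + q - p * q) * N / real (Suc m)"
    using assms(1) by (simp add: field_simps)
  then have "u * (\<theta> / (1 + 3 * \<theta>)) \<le> u * (1 - (p + q - p * q) * N / real (Suc m))"
    by (rule mult_left_mono) (simp add: u_def unif_prob_nonneg)
  also have "\<dots> \<le> bern_expect (p + q - p * q) (two_clauses {1..n}) (\<lambda>F. of_bool (P F))"
    unfolding u_def N_def using assms(6) dec r0 r1 by (intro unif_prob_le_bern_expect) (auto simp: m_def)
  finally have "u \<le> (1 + 3 * \<theta>) / \<theta> * bern_expect (p + q - p * q) (two_clauses {1..n}) (\<lambda>F. of_bool (P F))"
    using assms(1) by (simp add: field_simps)
  then show ?thesis by (simp add: u_def p_def q_def m_def)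
qed

lemma power_le_exp_of_ge:
  assumes "0 < \<rho>" "\<rho> < 1" "y \<le> real j"
  shows "\<rho> ^ j \<le> exp (ln \<rho> * y)"
proof -
  have "\<rho> ^ j = exp (ln \<rho> * real j)"
    using assms by (simp add: exp_of_nat2_mult)
  also have "ln \<rho> * real j \<le> ln \<rho> * y"
    using assms by (intro mult_left_mono_neg) auto
  finally show ?thesis by simp
qed

section \<open>Density below 1/2\<close>

lemma cnf_obdd_size_poly_whp:
  assumes "0 \<le> \<delta>" "\<delta> < 1 / 2"
  shows "\<exists>c>0. (\<lambda>n. measure_pmf.prob (random_2cnf n (nat \<lfloor>\<delta> * real n\<rfloor>))
    {F. real (cnf_obdd_size F) \<le> real n powr c}) \<longlonglongrightarrow> 1"
proof -
  \<comment> \<open>The midpoint of the branching factor 2 \<delta> and 1.\<close>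
  define \<rho> where "\<rho> = (1 + 2 * \<delta>) / 2"
  have \<rho>: "0 < \<rho>" "\<rho> < 1" "\<delta> < \<rho> / 2" using assms by (simp_all add: \<rho>_def)
  have lnr: "ln \<rho> < 0" using \<rho> by simp
  \<comment> \<open>Chosen so that \<rho> to the power \<open>L n\<close> is at most n^-2, which
    beats the 2 n starting literals.\<close>
  define C where "C = - 2 / ln \<rho>"
  have C: "0 < C" using lnr by (simp add: C_def divide_neg_neg)
  define L where "L = (\<lambda>n::nat. nat \<lceil>C * ln (real n)\<rceil>)"
  \<comment> \<open>2 to the power \<open>L n\<close> contributes C ln 2; the factor n + 1 and the
    constants are absorbed by n^2 each.\<close>
  define c where "c = C * ln 2 + 4"
  have "(\<lambda>n. measure_pmf.prob (random_2cnf n (nat \<lfloor>\<delta> * real n\<rfloor>))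
      {F. real (cnf_obdd_size F) \<le> real n powr c}) \<longlonglongrightarrow> 1"
  proof (rule prob_random_2cnf_tendsto_1[where e = "\<lambda>n. 2 / real n"])
    show "\<forall>\<^sub>F n in sequentially. nat \<lfloor>\<delta> * real n\<rfloor> \<le> card (two_clauses {1..n})"
      by (rule eventually_m_le)
    show "(\<lambda>n. 2 / real n) \<longlonglongrightarrow> 0" by real_asymp
    show "\<forall>\<^sub>F n in sequentially. unif_prob (two_clauses {1..n}) (nat \<lfloor>\<delta> * real n\<rfloor>)
        (\<lambda>F. F \<notin> {F. real (cnf_obdd_size F) \<le> real n powr c}) \<le> 2 / real n"
      using eventually_m_le[of \<delta>] eventually_density_le[OF assms(1) \<rho>(3)] eventually_ge_at_top[of 2]
    proof eventually_elim
      case (elim n)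
      define m where "m = nat \<lfloor>\<delta> * real n\<rfloor>"
      define Q where "Q = two_clauses {1..n}"
      define q where "q = real m / real (card Q)"
      have finQ: "finite Q" by (simp add: Q_def)
      have q: "0 \<le> q" "4 * real n * q \<le> \<rho>"
        using elim(2) by (simp_all add: q_def m_def Q_def)
      have lnn: "0 < ln (real n)" using elim(3) by simp
      then have CL: "0 < C * ln (real n)" using C by simp
      have L: "1 \<le> L n" "C * ln (real n) \<le> real (L n)" "real (L n) \<le> C * ln (real n) + 1"
        using CL by (simp_all add: L_def real_nat_ceiling_ge) linarith+
      have "unif_prob Q m (\<lambda>F. F \<notin> {F. real (cnf_obdd_size F) \<le> real n powr c}) \<le>
          unif_prob Q m (\<lambda>F. \<exists>us. length us = Suc (L n) \<and> litpath True F us)"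
      proof (rule unif_prob_mono[OF finQ])
        fix F assume F: "F \<subseteq> Q" "F \<notin> {F. real (cnf_obdd_size F) \<le> real n powr c}"
        show "\<exists>us. length us = Suc (L n) \<and> litpath True F us"
        proof (rule ccontr)
          assume no: "\<not> ?thesis"
          have "cnf_obdd_size F \<le> (card {1..n} + 1) * (1 + 2 ^ L n)"
            by (rule cnf_obdd_size_le) (use F no in \<open>auto simp: Q_def\<close>)
          then have "real (cnf_obdd_size F) \<le> real ((card {1..n} + 1) * (1 + 2 ^ L n))"
            by (simp only: of_nat_le_iff)
          also have "\<dots> = (real n + 1) * (1 + 2 ^ L n)" by (simp add: algebra_simps)
          also have "\<dots> \<le> real n powr 2 * (real n powr 2 * real n powr (C * ln 2))"
          proof (rule mult_mono)
            have n2: "real n powr 2 = real n * real n"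
              using elim(3) by (simp add: powr_numeral power2_eq_square)
            have "2 * real n \<le> real n * real n" using elim(3) by (intro mult_right_mono) auto
            moreover have "2 \<le> real n" using elim(3) by simp
            ultimately show "real n + 1 \<le> real n powr 2" using n2 by linarith
            have "(2::real) ^ L n = 2 powr real (L n)" by (simp add: powr_realpow)
            also have "\<dots> \<le> 2 powr (C * ln (real n) + 1)" using L(3) by (intro powr_mono) auto
            also have "\<dots> = 2 * real n powr (C * ln 2)"
              using elim(3) by (simp add: powr_def exp_add algebra_simps)
            finally have "(2::real) ^ L n \<le> 2 * real n powr (C * ln 2)" .
            moreover have "1 \<le> real n powr (C * ln 2)"
              using elim(3) C by (intro ge_one_powr_ge_zero) auto
            ultimately have "1 + (2::real) ^ L n \<le> 4 * real n powr (C * ln 2)" by linarith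
            also have "\<dots> \<le> real n powr 2 * real n powr (C * ln 2)"
            proof (rule mult_right_mono)
              have "2 * 2 \<le> real n * real n" using elim(3) by (intro mult_mono) auto
              then show "4 \<le> real n powr 2" using n2 by simp
            qed simp
            finally show "1 + 2 ^ L n \<le> real n powr 2 * real n powr (C * ln 2)" .
          qed auto
          also have "\<dots> = real n powr c"
            by (simp only: c_def powr_add[symmetric]) (simp add: algebra_simps)
          finally show False using F(2) by simp
        qed
      qed
      also have "\<dots> \<le> 2 * real (card {1..n}) * (4 * real (card {1..n}) * q) ^ L n"
        using unif_prob_True_path_le[of "{1..n}" m "L n"] elim(1) L(1) by (simp add: Q_def q_def m_def)
      also have "\<dots> \<le> 2 * real n * \<rho> ^ L n"
        using q by (simp add: mult_left_mono power_mono)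
      also have "\<dots> \<le> 2 * real n * exp (ln \<rho> * (C * ln (real n)))"
        using power_le_exp_of_ge[OF \<rho>(1,2) L(2)] by (intro mult_left_mono) auto
      also have "ln \<rho> * (C * ln (real n)) = - 2 * ln (real n)"
        using lnr by (simp add: C_def)
      also have "exp (- 2 * ln (real n)) = 1 / (real n)\<^sup>2"
        using elim(3) by (simp add: exp_minus exp_double inverse_eq_divide)
      also have "2 * real n * (1 / (real n)\<^sup>2) = 2 / real n"
        by (simp add: power2_eq_square)
      finally show ?case by (simp add: Q_def m_def)
    qed
  qed
  moreover have "0 < c" using C by (simp add: c_def add_pos_pos)
  ultimately show ?thesis by blast
qed

section \<open>Density above 1\<close>

lemma satisfies_antimono: "satisfies \<alpha> G \<Longrightarrow> F \<subseteq> G \<Longrightarrow> satisfies \<alpha> F"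
  by (auto simp: satisfies_def)

lemma one_minus_power_le_exp:
  assumes "0 \<le> (x::real)" "x \<le> 1" "y \<le> real j"
  shows "(1 - x) ^ j \<le> exp (- (x * y))"
proof -
  have "(1 - x) ^ j \<le> exp (- x) ^ j"
    using exp_ge_add_one_self[of "- x"] assms by (intro power_mono) auto
  also have "\<dots> = exp (- (x * real j))" by (simp add: exp_of_nat_mult[symmetric] mult.commute)
  also have "\<dots> \<le> exp (- (x * y))" using assms by (simp add: mult_left_mono)
  finally show ?thesis .
qed

lemma unsat_whp:
  assumes "1 < \<delta>"
  shows "(\<lambda>n. measure_pmf.prob (random_2cnf n (nat \<lfloor>\<delta> * real n\<rfloor>))
    {F. cnf_obdd_size F = 1}) \<longlonglongrightarrow> 1"
proof -
  \<comment> \<open>Makes \<delta> the two-round density 2 (1 + 3 \<theta>) / k with k = 2, the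
    number of clauses per pair for implications.\<close>
  define \<theta> where "\<theta> = (\<delta> - 1) / 3"
  have \<theta>: "0 < \<theta>" using assms by (simp add: \<theta>_def)
  have \<delta>: "2 * (1 + 3 * \<theta>) / 2 = \<delta>" by (simp add: \<theta>_def field_simps)
  obtain \<gamma> \<nu> K where g: "0 < \<gamma>" "0 < \<nu>"
    and path: "\<And>n L b. 2 \<le> n \<Longrightarrow> 2 \<le> L \<Longrightarrow> real L \<le> \<gamma> * real n \<Longrightarrow>
      (1 + \<theta>) / ((if b then 4 else 2) * real n) \<le> 1 \<Longrightarrow>
      bern_expect ((1 + \<theta>) / ((if b then 4 else 2) * real n)) (two_clauses {1..n})
        (\<lambda>F. of_bool (\<not> (\<exists>us. length us = L \<and> litpath b F us))) \<le> exp (K - \<nu> * real n)"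
    using bern_expect_no_path_le[OF \<theta>] by blast
  define e where "e = (\<lambda>n::nat. (1 + 3 * \<theta>) / \<theta> * (exp (K - \<nu> * real n) +
    2 * exp (- (\<theta> / (2 * real n) * ((\<gamma> * real n / 2 - 1) * (\<gamma> * real n / 2 - 2) / 2)))))"
  have e1: "(\<lambda>n::nat. exp (K - \<nu> * real n)) \<longlonglongrightarrow> 0"
    using g(2) by real_asymp
  have e2: "(\<lambda>n::nat. exp (- (\<theta> / (2 * real n) *
      ((\<gamma> * real n / 2 - 1) * (\<gamma> * real n / 2 - 2) / 2)))) \<longlonglongrightarrow> 0"
    using g(1) \<theta> by real_asymp
  have e: "e \<longlonglongrightarrow> 0"
    unfolding e_def using tendsto_mult[OF tendsto_const tendsto_add[OF e1 tendsto_mult[OF tendsto_const e2, of 2]],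
      of "(1 + 3 * \<theta>) / \<theta>"] by simp
  have ev: "\<forall>\<^sub>F n in sequentially. (1 + \<theta>) / (2 * real n) \<le> 1"
    "\<forall>\<^sub>F n in sequentially. \<theta> / (2 * real n) \<le> 1"
    "\<forall>\<^sub>F n in sequentially. 4 \<le> \<gamma> * real n"
    using g(1) \<theta> by real_asymp+
  show ?thesis
  proof (rule prob_random_2cnf_tendsto_1[OF eventually_m_le _ e])
    show "\<forall>\<^sub>F n in sequentially. unif_prob (two_clauses {1..n}) (nat \<lfloor>\<delta> * real n\<rfloor>)
        (\<lambda>F. F \<notin> {F. cnf_obdd_size F = 1}) \<le> e n"
      using ev eventually_m_le[of \<delta>] eventually_ge_at_top[of 2]
    proof eventually_elim
      case (elim n)
      define p where "p = (1 + \<theta>) / (2 * real n)"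
      define q where "q = \<theta> / (2 * real n)"
      have pq: "0 \<le> p" "p \<le> 1" "0 \<le> q" "q \<le> 1"
        using elim \<theta> by (simp_all add: p_def q_def)
      \<comment> \<open>The path needs 2 h \<le> \<gamma> n literals. As h is linear in n and q of
        order 1 / n, the exponent of the second round is linear in n.\<close>
      define h where "h = nat \<lfloor>\<gamma> * real n / 2\<rfloor>"
      have h: "\<gamma> * real n / 2 - 1 \<le> real h" "real h \<le> \<gamma> * real n / 2" "1 \<le> h"
        using elim(3) by (simp_all add: h_def) linarith+
      have "unif_prob (two_clauses {1..n}) (nat \<lfloor>\<delta> * real n\<rfloor>) (\<lambda>F. F \<notin> {F. cnf_obdd_size F = 1}) \<le>
          unif_prob (two_clauses {1..n}) (nat \<lfloor>\<delta> * real n\<rfloor>) (\<lambda>F. \<exists>\<alpha>. satisfies \<alpha> F)"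
      proof (rule unif_prob_mono)
        fix F assume F: "F \<subseteq> two_clauses {1..n}" "F \<notin> {F. cnf_obdd_size F = 1}"
        have "cnf_vars F \<subseteq> {1..n}" using F(1) by (force simp: cnf_vars_def two_clauses_def)
        then have "finite (cnf_vars F)" by (rule finite_subset) simp
        then have "\<not> (\<forall>\<alpha>. \<not> satisfies \<alpha> F)"
          using obdd_size_const_False[of "cnf_vars F" "\<lambda>\<alpha>. satisfies \<alpha> F"] F(2)
          unfolding cnf_obdd_size_def by blast
        then show "\<exists>\<alpha>. satisfies \<alpha> F" by blast
      qed simp
      also have "\<dots> \<le> (1 + 3 * \<theta>) / \<theta> * bern_expect (p + q - p * q) (two_clauses {1..n})
          (\<lambda>F. of_bool (\<exists>\<alpha>. satisfies \<alpha> F))"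
        using unif_prob_le_two_rounds[of \<theta> 2 n "\<lambda>F. \<exists>\<alpha>. satisfies \<alpha> F"] elim \<theta> \<delta> satisfies_antimono
        unfolding p_def q_def by (simp add: \<delta>) blast
      also have "\<dots> \<le> (1 + 3 * \<theta>) / \<theta> * (exp (K - \<nu> * real n) + 2 * (1 - q) ^ (h choose 2))"
      proof (rule mult_left_mono)
        have "bern_expect p (two_clauses {1..n}) (\<lambda>F. of_bool (\<not> (\<exists>us. length us = 2 * h \<and> litpath False F us)))
            \<le> exp (K - \<nu> * real n)"
          using path[of n "2 * h" False] elim h unfolding p_def by simp
        then show "bern_expect (p + q - p * q) (two_clauses {1..n}) (\<lambda>F. of_bool (\<exists>\<alpha>. satisfies \<alpha> F)) \<le>
            exp (K - \<nu> * real n) + 2 * (1 - q) ^ (h choose 2)"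
          using bern_expect_sat_le[OF pq, of "{1..n}" h] h(3) by simp
      qed (use \<theta> in simp)
      also have "\<dots> \<le> e n"
      proof -
        have "real (h choose 2) = real h * (real h - 1) / 2"
          using h(3) by (simp add: choose_two real_of_nat_div of_nat_diff)
        moreover have "(\<gamma> * real n / 2 - 1) * (\<gamma> * real n / 2 - 2) \<le> real h * (real h - 1)"
          using h elim(3) by (intro mult_mono) auto
        ultimately have "(\<gamma> * real n / 2 - 1) * (\<gamma> * real n / 2 - 2) / 2 \<le> real (h choose 2)"
          by simp
        from one_minus_power_le_exp[OF pq(3,4) this] show ?thesis
          unfolding e_def q_def using \<theta> by (intro mult_left_mono add_left_mono) auto
      qed
      finally show ?case .
    qed
  qed
qed

section \<open>Density between 1/2 and 1\<close>

lemma hard_to_cut_antimono: "hard_to_cut X s F \<Longrightarrow> s' \<le> s \<Longrightarrow> hard_to_cut X s' F"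
  unfolding hard_to_cut_def by (meson order_trans)

lemma hard_to_cut_whp:
  assumes "1 / 2 < \<delta>"
  obtains \<eta> :: real and e :: "nat \<Rightarrow> real" where "0 < \<eta>" "e \<longlonglongrightarrow> 0"
    "\<forall>\<^sub>F n in sequentially. unif_prob (two_clauses {1..n}) (nat \<lfloor>\<delta> * real n\<rfloor>)
      (\<lambda>F. \<not> hard_to_cut {1..n} (nat \<lceil>\<eta> * real n\<rceil>) F) \<le> e n"
proof -
  define \<theta> where "\<theta> = (2 * \<delta> - 1) / 3"
  have \<theta>: "0 < \<theta>" using assms by (simp add: \<theta>_def)
  have \<delta>: "2 * (1 + 3 * \<theta>) / 4 = \<delta>" by (simp add: \<theta>_def field_simps)
  obtain \<gamma> \<nu> K where g: "0 < \<gamma>" "0 < \<nu>"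
    and path: "\<And>n L b. 2 \<le> n \<Longrightarrow> 2 \<le> L \<Longrightarrow> real L \<le> \<gamma> * real n \<Longrightarrow>
      (1 + \<theta>) / ((if b then 4 else 2) * real n) \<le> 1 \<Longrightarrow>
      bern_expect ((1 + \<theta>) / ((if b then 4 else 2) * real n)) (two_clauses {1..n})
        (\<lambda>F. of_bool (\<not> (\<exists>us. length us = L \<and> litpath b F us))) \<le> exp (K - \<nu> * real n)"
    using bern_expect_no_path_le[OF \<theta>] by blast
  \<comment> \<open>The union bound costs exp (3 r) with r about \<gamma> n / \<kappa>, the second
    round gains about exp (\<theta> \<gamma>^2 n / 128). This k makes the cost at most the square
    root of the gain.\<close>
  define k where "k = nat \<lceil>768 / (\<theta> * \<gamma>)\<rceil> + 1"
  define \<kappa> where "\<kappa> = real k"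
  have k: "1 \<le> k" "768 / (\<theta> * \<gamma>) \<le> \<kappa>" "0 < \<kappa>"
    by (simp_all add: k_def \<kappa>_def) linarith
  have k\<theta>: "3 * \<gamma> / \<kappa> \<le> \<theta> * \<gamma>\<^sup>2 / 256"
    using k(2,3) \<theta> g(1) by (simp add: field_simps power2_eq_square)
  define \<eta> where "\<eta> = \<gamma> / (8 * \<kappa>)"
  have \<eta>: "0 < \<eta>" using g k by (simp add: \<eta>_def)
  define e where "e = (\<lambda>n::nat. (1 + 3 * \<theta>) / \<theta> * (exp (K - \<nu> * real n) +
    exp (\<theta> * \<gamma>\<^sup>2 / 256 * real n - \<theta> / (8 * real n) * ((\<gamma> * real n - \<kappa>)\<^sup>2 / 16 - 1))))"
  have e1: "(\<lambda>n::nat. exp (K - \<nu> * real n)) \<longlonglongrightarrow> 0"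
    using g(2) by real_asymp
  have e2: "(\<lambda>n::nat. exp (\<theta> * \<gamma>\<^sup>2 / 256 * real n -
      \<theta> / (8 * real n) * ((\<gamma> * real n - \<kappa>)\<^sup>2 / 16 - 1))) \<longlonglongrightarrow> 0"
    using g(1) \<theta> by real_asymp
  have e: "e \<longlonglongrightarrow> 0"
    unfolding e_def using tendsto_mult[OF tendsto_const tendsto_add[OF e1 e2], of "(1 + 3 * \<theta>) / \<theta>"]
    by simp
  have ev: "\<forall>\<^sub>F n in sequentially. (1 + \<theta>) / (4 * real n) \<le> 1"
    "\<forall>\<^sub>F n in sequentially. \<theta> / (4 * real n) \<le> 1"
    "\<forall>\<^sub>F n in sequentially. \<gamma> * real n / \<kappa> \<ge> 10"
    using g(1) \<theta> k(3) by real_asymp+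
  have "\<forall>\<^sub>F n in sequentially. unif_prob (two_clauses {1..n}) (nat \<lfloor>\<delta> * real n\<rfloor>)
      (\<lambda>F. \<not> hard_to_cut {1..n} (nat \<lceil>\<eta> * real n\<rceil>) F) \<le> e n"
    using ev eventually_m_le[of \<delta>] eventually_ge_at_top[of 2]
  proof eventually_elim
    case (elim n)
    define p where "p = (1 + \<theta>) / (4 * real n)"
    define q where "q = \<theta> / (4 * real n)"
    have pq: "0 \<le> p" "p \<le> 1" "0 \<le> q" "q \<le> 1"
      using elim \<theta> by (simp_all add: p_def q_def)
    define r where "r = nat \<lfloor>\<gamma> * real n / \<kappa>\<rfloor>"
    have r: "\<gamma> * real n / \<kappa> - 1 \<le> real r" "real r \<le> \<gamma> * real n / \<kappa>" "2 \<le> r"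
      using elim(3) by (simp_all add: r_def) linarith+
    define s where "s = r div 4"
    define D where "D = (r * k)\<^sup>2 div 16"
    have rk: "real (r * k) \<le> \<gamma> * real n" "\<gamma> * real n - \<kappa> \<le> real (r * k)"
      using r(1,2) k(3) by (simp_all add: \<kappa>_def field_simps)
    have rk2: "2 \<le> r * k" using r(3) k(1) by (metis mult_le_mono nat_mult_1_right)
    \<comment> \<open>s is about y / 4; the value \<eta> n = y / 8 leaves room for both roundings
      exactly when y \<ge> 10.\<close>
    have s\<eta>: "nat \<lceil>\<eta> * real n\<rceil> \<le> s"
    proof -
      define y where "y = \<gamma> * real n / \<kappa>"
      have "real r / 4 - 1 \<le> real s" unfolding s_def by linarith
      moreover have "\<eta> * real n = y / 8" by (simp add: \<eta>_def y_def)
      moreover have "10 \<le> y" "y - 1 \<le> real r" using elim(3) r(1) by (simp_all add: y_def)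
      ultimately have "\<eta> * real n \<le> real s" by linarith
      then show ?thesis by (simp add: nat_le_iff ceiling_le_iff)
    qed
    have "unif_prob (two_clauses {1..n}) (nat \<lfloor>\<delta> * real n\<rfloor>)
        (\<lambda>F. \<not> hard_to_cut {1..n} (nat \<lceil>\<eta> * real n\<rceil>) F) \<le>
        unif_prob (two_clauses {1..n}) (nat \<lfloor>\<delta> * real n\<rfloor>) (\<lambda>F. \<not> hard_to_cut {1..n} s F)"
      by (rule unif_prob_mono) (use hard_to_cut_antimono[OF _ s\<eta>] in \<open>simp, blast\<close>)
    also have "\<dots> \<le> (1 + 3 * \<theta>) / \<theta> * bern_expect (p + q - p * q) (two_clauses {1..n})
        (\<lambda>F. of_bool (\<not> hard_to_cut {1..n} s F))"
    proof -
      have "\<not> hard_to_cut {1..n} s F"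
        if "F \<subseteq> G" "G \<subseteq> two_clauses {1..n}" "\<not> hard_to_cut {1..n} s G" for F G
        using hard_to_cut_mono[of "{1..n}" s F G] that finite_subset[OF that(2)] by auto
      then show ?thesis
        using unif_prob_le_two_rounds[of \<theta> 4 n "\<lambda>F. \<not> hard_to_cut {1..n} s F"] elim \<theta>
        unfolding p_def q_def \<delta> by simp
    qed
    also have "\<dots> \<le> (1 + 3 * \<theta>) / \<theta> * (exp (K - \<nu> * real n) + 4 ^ r * (2 ^ s * (1 - q / 2) ^ D))"
    proof (rule mult_left_mono)
      have "bern_expect p (two_clauses {1..n}) (\<lambda>F. of_bool (\<not> (\<exists>us. length us = r * k \<and> litpath True F us)))
          \<le> exp (K - \<nu> * real n)"
        using path[of n "r * k" True] elim rk(1) rk2 unfolding p_def by simp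
      moreover have "bern_expect (p + q - p * q) (two_clauses {1..n}) (\<lambda>F. of_bool (\<not> hard_to_cut {1..n} s F)) \<le>
          bern_expect p (two_clauses {1..n}) (\<lambda>F. of_bool (\<not> (\<exists>us. length us = r * k \<and> litpath True F us)))
          + 4 ^ r * (2 ^ s * (1 - q / 2) ^ D)"
        by (rule bern_expect_cut_le[OF pq _ k(1) rk2]) (simp_all add: s_def D_def)
      ultimately show "bern_expect (p + q - p * q) (two_clauses {1..n}) (\<lambda>F. of_bool (\<not> hard_to_cut {1..n} s F)) \<le>
          exp (K - \<nu> * real n) + 4 ^ r * (2 ^ s * (1 - q / 2) ^ D)" by linarith
    qed (use \<theta> in simp)
    also have "\<dots> \<le> e n"
    proof -
      have "(4::real) ^ r * 2 ^ s \<le> 4 ^ r * 2 ^ r"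
        by (intro mult_left_mono power_increasing) (auto simp: s_def)
      also have "\<dots> = 8 ^ r" by (simp add: power_mult_distrib[symmetric])
      also have "\<dots> \<le> exp 3 ^ r"
      proof (rule power_mono)
        have "(2::real) ^ 3 \<le> exp 1 ^ 3"
          using exp_ge_add_one_self[of "1::real"] by (intro power_mono) auto
        then show "(8::real) \<le> exp 3" by (simp add: exp_of_nat_mult[symmetric])
      qed simp
      also have "\<dots> = exp (3 * real r)" by (simp add: exp_of_nat_mult[symmetric] mult.commute)
      also have "\<dots> \<le> exp (\<theta> * \<gamma>\<^sup>2 / 256 * real n)"
      proof -
        have "3 * real r \<le> 3 * \<gamma> / \<kappa> * real n" using r(2) by simp
        also have "\<dots> \<le> \<theta> * \<gamma>\<^sup>2 / 256 * real n" by (rule mult_right_mono[OF k\<theta>]) simp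
        finally show ?thesis by simp
      qed
      finally have 1: "(4::real) ^ r * 2 ^ s \<le> exp (\<theta> * \<gamma>\<^sup>2 / 256 * real n)" .
      have "(\<gamma> * real n - \<kappa>)\<^sup>2 \<le> (real (r * k))\<^sup>2"
        using rk(2) elim(3) k(3) by (intro power_mono) (auto simp: field_simps)
      moreover have "(real (r * k))\<^sup>2 / 16 - 1 \<le> real D"
      proof -
        have "real ((r * k)\<^sup>2) / 16 - 1 \<le> real D" unfolding D_def by linarith
        then show ?thesis by simp
      qed
      ultimately have "(\<gamma> * real n - \<kappa>)\<^sup>2 / 16 - 1 \<le> real D" by linarith
      from one_minus_power_le_exp[OF _ _ this, of "q / 2"]
      have 2: "(1 - q / 2) ^ D \<le> exp (- (\<theta> / (8 * real n) * ((\<gamma> * real n - \<kappa>)\<^sup>2 / 16 - 1)))"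
        using pq by (simp add: q_def)
      have "4 ^ r * (2 ^ s * (1 - q / 2) ^ D) = (4 ^ r * 2 ^ s) * (1 - q / 2) ^ D" by simp
      also have "\<dots> \<le> exp (\<theta> * \<gamma>\<^sup>2 / 256 * real n) *
          exp (- (\<theta> / (8 * real n) * ((\<gamma> * real n - \<kappa>)\<^sup>2 / 16 - 1)))"
        using pq by (intro mult_mono 1 2) auto
      also have "\<dots> = exp (\<theta> * \<gamma>\<^sup>2 / 256 * real n -
          \<theta> / (8 * real n) * ((\<gamma> * real n - \<kappa>)\<^sup>2 / 16 - 1))"
        unfolding exp_add[symmetric] by simp
      finally show ?thesis unfolding e_def using \<theta> by (intro mult_left_mono add_left_mono) auto
    qed
    finally show ?case .
  qed
  with \<eta> e show ?thesis by (rule that)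
qed

lemma power_div_fact_le_exp:
  assumes "0 \<le> (x::real)"
  shows "x ^ d / fact d \<le> exp x"
proof -
  have sm: "(\<lambda>i. x ^ i /\<^sub>R fact i) sums exp x" by (rule exp_converges)
  have "(\<Sum>i\<in>{d}. x ^ i /\<^sub>R fact i) \<le> (\<Sum>i. x ^ i /\<^sub>R fact i)"
    by (rule sum_le_suminf[OF sums_summable[OF sm]]) (use assms in auto)
  also have "\<dots> = exp x" by (rule sums_unique[OF sm, symmetric])
  finally have "(\<Sum>i\<in>{d}. x ^ i /\<^sub>R fact i) \<le> exp x" .
  then show ?thesis by (simp add: divide_inverse mult.commute)
qed

text \<open>Writing 2^d / d! as exp (- 2 d) times (2 exp 2)^d / d!, the first factor is at most n^-2
  since d \<ge> ln n, and the second is one term of the series of exp (2 exp 2).\<close>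

lemma unif_prob_degree_le_inverse:
  assumes "m \<le> card (two_clauses {1..n})" "1 \<le> n" "ln (real n) \<le> real d" "1 \<le> d"
    "2 * real n * (real m / real (card (two_clauses {1..n}))) \<le> 1"
  shows "unif_prob (two_clauses {1..n}) m (\<lambda>F. \<exists>x. d \<le> card {C \<in> F. x \<in> clause_vars C}) \<le>
    exp (2 * exp 2) / real n"
proof -
  define q where "q = real m / real (card (two_clauses {1..n}))"
  have q: "0 \<le> q" "4 * real n * q \<le> 2" using assms(5) by (simp_all add: q_def)
  have "unif_prob (two_clauses {1..n}) m (\<lambda>F. \<exists>x. d \<le> card {C \<in> F. x \<in> clause_vars C}) \<le>
      real n * ((4 * real n * q) ^ d / fact d)"
    using unif_prob_degree_le[of "{1..n}" m d] assms(1,4) by (simp add: q_def)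
  also have "\<dots> \<le> real n * (2 ^ d / fact d)"
    using q by (intro mult_left_mono divide_right_mono power_mono) auto
  also have "(2::real) ^ d / fact d = exp (- 2 * real d) * ((2 * exp 2) ^ d / fact d)"
    by (simp add: power_mult_distrib exp_of_nat_mult[symmetric] mult.commute exp_minus field_simps)
  also have "\<dots> \<le> exp (- 2 * ln (real n)) * exp (2 * exp 2)"
    using assms(3) by (intro mult_mono power_div_fact_le_exp) auto
  also have "exp (- 2 * ln (real n)) = 1 / (real n)\<^sup>2"
    using assms(2) by (simp add: exp_minus exp_double inverse_eq_divide)
  also have "real n * (1 / (real n)\<^sup>2 * exp (2 * exp 2)) = exp (2 * exp 2) / real n"
    by (simp add: power2_eq_square)
  finally show ?thesis by (simp add: mult_left_mono)
qed

lemma cnf_obdd_size_exp_whp: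
  assumes "1 / 2 < \<delta>" "\<delta> < 1"
  shows "(\<lambda>n. measure_pmf.prob (random_2cnf n (nat \<lfloor>\<delta> * real n\<rfloor>))
    {F. real (cnf_obdd_size F) \<ge> exp (real n powr (1 / 4))}) \<longlonglongrightarrow> 1"
proof -
  define \<rho> where "\<rho> = (1 + \<delta>) / 2"
  have \<rho>: "0 < \<rho>" "\<rho> < 1" "\<delta> < \<rho>" using assms by (simp_all add: \<rho>_def)
  have \<delta>0: "0 \<le> \<delta>" using assms by simp
  define a where "a = ln \<rho>"
  have a: "a < 0" using \<rho> by (simp add: a_def)
  obtain \<eta> e0 where \<eta>: "0 < (\<eta>::real)" and e0: "e0 \<longlonglongrightarrow> (0::real)"
    and cut: "\<forall>\<^sub>F n in sequentially. unif_prob (two_clauses {1..n}) (nat \<lfloor>\<delta> * real n\<rfloor>)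
      (\<lambda>F. \<not> hard_to_cut {1..n} (nat \<lceil>\<eta> * real n\<rceil>) F) \<le> e0 n"
    using hard_to_cut_whp[OF assms(1)] by blast
  define e1 where "e1 = (\<lambda>n::nat. 2 * real n * exp (a * (ln (real n))\<^sup>2) + ((ln (real n))\<^sup>2 + 1) ^ 3 / real n)"
  define e2 where "e2 = (\<lambda>n::nat. (2 * real n * exp (a * sqrt (ln (real n))) + (sqrt (ln (real n)) + 1)\<^sup>2)
    / (real n / (ln (real n))\<^sup>2))"
  define e3 where "e3 = (\<lambda>n::nat. exp (2 * exp 2) / real n)"
  have e: "e1 \<longlonglongrightarrow> 0" "e2 \<longlonglongrightarrow> 0" "e3 \<longlonglongrightarrow> 0"
    using a unfolding e1_def e2_def e3_def by real_asymp+
  have lim: "(\<lambda>n. e1 n + e2 n + e3 n + e0 n) \<longlonglongrightarrow> 0"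
    using tendsto_add[OF tendsto_add[OF tendsto_add[OF e(1,2)] e(3)] e0] by simp
  have "(\<lambda>n::nat. (real n / (ln (real n))\<^sup>2 * (ln (real n) + 1) +
      2 * (ln (real n) + 1) * ((2 * ln (real n) + 3) powr (2 * (sqrt (ln (real n)) + 1))) * sqrt (real n))
      / real n) \<longlonglongrightarrow> 0"
    by real_asymp
  from order_tendstoD(2)[OF this \<eta>]
  have ev1: "\<forall>\<^sub>F n::nat in sequentially. (real n / (ln (real n))\<^sup>2 * (ln (real n) + 1) +
      2 * (ln (real n) + 1) * ((2 * ln (real n) + 3) powr (2 * (sqrt (ln (real n)) + 1))) * sqrt (real n))
      / real n < \<eta>" .
  have ev2: "\<forall>\<^sub>F n::nat in sequentially. exp (real n powr (1 / 4)) \<le> 2 powr sqrt (real n)"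
    by real_asymp
  show ?thesis
  proof (rule prob_random_2cnf_tendsto_1[OF eventually_m_le _ lim])
    show "\<forall>\<^sub>F n in sequentially. unif_prob (two_clauses {1..n}) (nat \<lfloor>\<delta> * real n\<rfloor>)
        (\<lambda>F. F \<notin> {F. real (cnf_obdd_size F) \<ge> exp (real n powr (1 / 4))}) \<le>
        e1 n + e2 n + e3 n + e0 n"
      using cut ev1 ev2 eventually_m_le[of \<delta>] eventually_density_le[OF \<delta>0 \<rho>(3)] eventually_ge_at_top[of 3]
    proof eventually_elim
      case (elim n)
      define m where "m = nat \<lfloor>\<delta> * real n\<rfloor>"
      define Q where "Q = two_clauses {1..n}"
      define q where "q = real m / real (card Q)"
      define l where "l = ln (real n)"
      have n: "3 \<le> real n" using elim(6) by simp
      have l: "0 < l" using n by (simp add: l_def)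
      have finQ: "finite Q" by (simp add: Q_def)
      have mQ: "m \<le> card Q" using elim(4) by (simp add: m_def Q_def)
      have q: "0 \<le> q" "2 * real n * q \<le> \<rho>" "2 * real n * q \<le> 1"
        using elim(5) assms \<rho>(2) by (simp_all add: q_def m_def Q_def)
      \<comment> \<open>Depth \<open>k1\<close> makes \<rho>^k1 beat every power of n, which
        excludes contradictions. Depth \<open>k\<close> keeps (2 d + 1)^(2 k) below every positive
        power of n, while bad literals still number fewer than \<beta> with high probability; these
        spoil at most about \<beta> ln n = n / ln n clauses.\<close>
      define k1 where "k1 = nat \<lceil>l\<^sup>2\<rceil>"
      define d where "d = nat \<lceil>l\<rceil>"
      define k where "k = nat \<lceil>sqrt l\<rceil>"
      define \<beta> where "\<beta> = real n / l\<^sup>2"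
      have rnd: "1 \<le> nat \<lceil>y\<rceil> \<and> y \<le> real (nat \<lceil>y\<rceil>) \<and> real (nat \<lceil>y\<rceil>) \<le> y + 1" if "0 < y" for y :: real
        using that by linarith
      have k1: "1 \<le> k1" "l\<^sup>2 \<le> real k1" "real k1 \<le> l\<^sup>2 + 1"
        using rnd[of "l\<^sup>2"] l by (simp_all add: k1_def)
      have d: "1 \<le> d" "l \<le> real d" "real d \<le> l + 1"
        using rnd[OF l] by (simp_all add: d_def)
      have k: "1 \<le> k" "sqrt l \<le> real k" "real k \<le> sqrt l + 1"
        using rnd[of "sqrt l"] l by (simp_all add: k_def)
      have \<beta>: "0 < \<beta>" using l n by (simp add: \<beta>_def)
      let ?contra = "\<lambda>F. \<exists>l :: nat literal. reach F l (neg l) \<and> reach F (neg l) l"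
      let ?bad = "\<lambda>F. \<beta> \<le> real (card {l \<in> lits {1..n}. bad_lit F k l})"
      let ?deg = "\<lambda>F. \<exists>x. d \<le> card {C \<in> F. x \<in> clause_vars C}"
      let ?easy = "\<lambda>F. \<not> hard_to_cut {1..n} (nat \<lceil>\<eta> * real n\<rceil>) F"
      have "unif_prob Q m (\<lambda>F. F \<notin> {F. real (cnf_obdd_size F) \<ge> exp (real n powr (1 / 4))}) \<le>
          unif_prob Q m (\<lambda>F. ((?contra F \<or> ?bad F) \<or> ?deg F) \<or> ?easy F)"
      proof (rule unif_prob_mono[OF finQ])
        fix F assume F: "F \<subseteq> Q" "F \<notin> {F. real (cnf_obdd_size F) \<ge> exp (real n powr (1 / 4))}"
        show "((?contra F \<or> ?bad F) \<or> ?deg F) \<or> ?easy F"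
        proof (rule ccontr)
          assume "\<not> ?thesis"
          then have nc: "\<And>l. \<not> (reach F l (neg l) \<and> reach F (neg l) l)" and nb: "\<not> ?bad F"
            and nd: "\<And>x. card {C \<in> F. x \<in> clause_vars C} \<le> d"
            and hc: "hard_to_cut {1..n} (nat \<lceil>\<eta> * real n\<rceil>) F"
            by (auto simp: not_le intro: less_imp_le)
          define B where "B = card {l \<in> lits {1..n}. bad_lit F k l}"
          have B: "real B \<le> \<beta>" using nb by (simp add: B_def)
          have "\<exists>t. 2 ^ t \<le> cnf_obdd_size F \<and>
              nat \<lceil>\<eta> * real n\<rceil> \<le> B * d + 2 * d * (2 * d + 1) ^ (2 * k) * t"
            by (rule cnf_obdd_size_ge[OF _ _ nc hc nd]) (use F(1) in \<open>simp_all add: B_def Q_def\<close>)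
          then obtain t where t: "2 ^ t \<le> cnf_obdd_size F"
            "nat \<lceil>\<eta> * real n\<rceil> \<le> B * d + 2 * d * (2 * d + 1) ^ (2 * k) * t"
            by blast
          \<comment> \<open>With smaller t both terms on the right of the bound would be o(n),
            against at least \<eta> n crossing clauses.\<close>
          have "sqrt (real n) \<le> real t"
          proof (rule ccontr)
            assume "\<not> sqrt (real n) \<le> real t"
            then have tn: "real t \<le> sqrt (real n)" by simp
            have "\<eta> * real n \<le> real (nat \<lceil>\<eta> * real n\<rceil>)" by (rule real_nat_ceiling_ge)
            also have "\<dots> \<le> real (B * d + 2 * d * (2 * d + 1) ^ (2 * k) * t)"
              using t(2) by (simp only: of_nat_le_iff)
            also have "\<dots> = real B * real d + 2 * real d * (2 * real d + 1) ^ (2 * k) * real t"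
              by (simp add: add.commute)
            also have "\<dots> \<le> \<beta> * (l + 1) + 2 * (l + 1) * ((2 * l + 3) powr (2 * (sqrt l + 1))) * sqrt (real n)"
            proof (intro add_mono mult_mono B d(3) tn)
              have "(2 * real d + 1) ^ (2 * k) \<le> (2 * l + 3) ^ (2 * k)"
                using d(3) by (intro power_mono) auto
              also have "\<dots> = (2 * l + 3) powr real (2 * k)"
                using l by (subst powr_realpow) auto
              also have "\<dots> \<le> (2 * l + 3) powr (2 * (sqrt l + 1))"
                using k(3) l by (intro powr_mono) auto
              finally show "(2 * real d + 1) ^ (2 * k) \<le> (2 * l + 3) powr (2 * (sqrt l + 1))" .
            qed (use d(3) l \<beta> in auto)
            also have "\<dots> < \<eta> * real n"
              using elim(2) n unfolding l_def[symmetric] \<beta>_def by (simp add: divide_less_eq)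
            finally show False by simp
          qed
          then have "2 powr sqrt (real n) \<le> 2 powr real t" by (intro powr_mono) auto
          also have "\<dots> = real (2 ^ t)" by (simp add: powr_realpow)
          also have "\<dots> \<le> real (cnf_obdd_size F)" using t(1) by (simp only: of_nat_le_iff)
          finally show False using elim(3) F(2) by simp
        qed
      qed
      also have "\<dots> \<le> unif_prob Q m ?contra + unif_prob Q m ?bad + unif_prob Q m ?deg + unif_prob Q m ?easy"
        using unif_prob_disj[OF finQ, of m "\<lambda>F. (?contra F \<or> ?bad F) \<or> ?deg F" ?easy]
          unif_prob_disj[OF finQ, of m "\<lambda>F. ?contra F \<or> ?bad F" ?deg]
          unif_prob_disj[OF finQ, of m ?contra ?bad] by linarith
      also have "\<dots> \<le> e1 n + e2 n + e3 n + e0 n"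
      proof (intro add_mono)
        have "unif_prob Q m ?contra \<le> 2 * real n * (2 * real n * q) ^ k1 + 2 * real k1 ^ 3 * q"
          using unif_prob_contra_le[of "{1..n}" m k1] mQ q(3) k1(1) unfolding Q_def q_def by simp
        also have "\<dots> \<le> 2 * real n * exp (a * l\<^sup>2) + (l\<^sup>2 + 1) ^ 3 / real n"
        proof (rule add_mono)
          have "(2 * real n * q) ^ k1 \<le> \<rho> ^ k1" using q by (intro power_mono) auto
          also have "\<dots> \<le> exp (a * l\<^sup>2)"
            unfolding a_def by (rule power_le_exp_of_ge[OF \<rho>(1,2) k1(2)])
          finally show "2 * real n * (2 * real n * q) ^ k1 \<le> 2 * real n * exp (a * l\<^sup>2)"
            by (intro mult_left_mono) auto
          have "2 * real k1 ^ 3 * q = real k1 ^ 3 * (2 * q)" by simp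
          also have "\<dots> \<le> (l\<^sup>2 + 1) ^ 3 * (1 / real n)"
            using q n k1(3) by (intro mult_mono power_mono) (auto simp: field_simps)
          finally show "2 * real k1 ^ 3 * q \<le> (l\<^sup>2 + 1) ^ 3 / real n" by simp
        qed
        finally show "unif_prob Q m ?contra \<le> e1 n" by (simp add: e1_def l_def)
        have "unif_prob Q m ?bad \<le> (\<Sum>l\<in>lits {1..n}. unif_prob Q m (\<lambda>F. bad_lit F k l)) / \<beta>"
          by (rule unif_prob_markov[OF finQ _ \<beta>]) simp
        also have "\<dots> \<le> (2 * real n * (2 * real n * q) ^ k + real k ^ 2) / \<beta>"
          using sum_unif_prob_bad_lit_le[of "{1..n}" m k] mQ q(3) k(1) \<beta> unfolding Q_def q_def
          by (intro divide_right_mono) auto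
        also have "\<dots> \<le> (2 * real n * exp (a * sqrt l) + (sqrt l + 1)\<^sup>2) / \<beta>"
        proof (intro divide_right_mono add_mono mult_left_mono)
          have "(2 * real n * q) ^ k \<le> \<rho> ^ k" using q by (intro power_mono) auto
          also have "\<dots> \<le> exp (a * sqrt l)"
            unfolding a_def by (rule power_le_exp_of_ge[OF \<rho>(1,2) k(2)])
          finally show "(2 * real n * q) ^ k \<le> exp (a * sqrt l)" .
          show "real k ^ 2 \<le> (sqrt l + 1)\<^sup>2" using k(3) by (intro power_mono) auto
        qed (use \<beta> in auto)
        finally show "unif_prob Q m ?bad \<le> e2 n" by (simp add: e2_def l_def \<beta>_def)
        show "unif_prob Q m ?deg \<le> e3 n"
          unfolding e3_def Q_def
          by (rule unif_prob_degree_le_inverse)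
            (use mQ q(3) d n in \<open>auto simp: Q_def q_def l_def\<close>)
        show "unif_prob Q m ?easy \<le> e0 n" using elim(1) by (simp add: Q_def m_def)
      qed
      finally show ?case by (simp add: Q_def m_def)
    qed
  qed
qed

theorem theorem1:
  fixes \<delta> :: real
  assumes "\<delta> \<ge> 0"
  shows "\<exists>c d :: real. c > 0 \<and> d > 0 \<and>
    (\<delta> < 1 / 2 \<longrightarrow>
      (\<lambda>n. measure_pmf.prob (random_2cnf n (nat \<lfloor>\<delta> * real n\<rfloor>))
             {F. real (cnf_obdd_size F) \<le> real n powr c}) \<longlonglongrightarrow> 1) \<and>
    (1 / 2 < \<delta> \<and> \<delta> < 1 \<longrightarrow>
      (\<lambda>n. measure_pmf.prob (random_2cnf n (nat \<lfloor>\<delta> * real n\<rfloor>))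
             {F. real (cnf_obdd_size F) \<ge> exp (real n powr d)}) \<longlonglongrightarrow> 1) \<and>
    (\<delta> > 1 \<longrightarrow>
      (\<lambda>n. measure_pmf.prob (random_2cnf n (nat \<lfloor>\<delta> * real n\<rfloor>))
             {F. cnf_obdd_size F = 1}) \<longlonglongrightarrow> 1)"
proof -
  \<comment> \<open>From 1/2 on the condition on \<open>c\<close> is void and c = 1 is taken; d =
    1/4 serves every density between 1/2 and 1.\<close>
  obtain c :: real where "0 < c" and "\<delta> < 1 / 2 \<longrightarrow>
      (\<lambda>n. measure_pmf.prob (random_2cnf n (nat \<lfloor>\<delta> * real n\<rfloor>))
             {F. real (cnf_obdd_size F) \<le> real n powr c}) \<longlonglongrightarrow> 1"
    using cnf_obdd_size_poly_whp[OF assms] zero_less_one by (cases "\<delta> < 1 / 2") blast+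
  then show ?thesis
    using cnf_obdd_size_exp_whp[of \<delta>] unsat_whp[of \<delta>]
    by (intro exI[of _ c] exI[of _ "1 / 4 :: real"]) simp
qed

end
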